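(* Let $N\geqslant0$, $n\geqslant1$ and $w$ be integers. (i) If $f\in\mathscr{J}_N^{(w)}$, then for every $\Sigma$ (a connected component of the complement of the diagonals, with $n=1$), $[f]_\Sigma(\tau)\in\mathrm{QMod}_{\leqslant w}(SL_2(\mathbb{Z}))$. (ii) If $f\in\mathscr{J}_N^{(w)}(\Gamma_1(n))$, then for every $\Sigma$, $[f]_\Sigma(\tau)\in\mathrm{QMod}_{\leqslant w}(\Gamma_1(n))$.
   Context: $\Gamma_1(n)=\{g\in SL_2(\mathbb{Z}) : g\equiv\begin{pmatrix}1&*\\0&1\end{pmatrix}\bmod n\}$. For $\Gamma\subset SL_2(\mathbb{Z})$, a quasi-modular form of weight $w$ and depth $p$ for $\Gamma$ is a holomorphic $f:\mathbb{H}\to\mathbb{C}$ for which there exist holomorphic $f_0=f,f_1,\dots,f_p$ with $(c\tau+d)^{-w}f\left(\frac{a\tau+b}{c\tau+d}\right)=\sum_{i=0}^pf_i(\tau)\left(\frac{c}{c\tau+d}\right)^i$ for all $\begin{pmatrix}a&b\\c&d\end{pmatrix}\in\Gamma$. $\mathrm{QMod}_w(\Gamma)$ is the set of those of weight $w$, and $\mathrm{QMod}_{\leqslant w}(\Gamma)=\bigoplus_{w'\leqslant w}\mathrm{QMod}_{w'}(\Gamma)$. $\wp(z;\tau)$ is the Weierstrass function of the lattice $\langle1,\tau\rangle$ and $\wp^{(s)}$ its $s$-th derivative in $z$ ($\wp^{(s)}$ has weight $s+2$). $\mathscr{J}_N$ is the ring of functions of $(z_1,\dots,z_N;\tau)\in\mathbb{C}^N\times\mathbb{H}$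 generated by the Eisenstein series $G_2,G_4,G_6$ (weights $2,4,6$) and the functions $\wp^{(s)}(z_i-z_j;\tau)$, $i\neq j$, $s\geqslant0$. $\mathscr{J}_N(\Gamma_1(n))$ is the ring generated by the quasi-modular forms for $\Gamma_1(n)$ and the functions $\wp^{(s)}(z_i-z_j-k\tau;n\tau)$, $i\ne j$, $k\in\mathbb{Z}/n\mathbb{Z}$, $s\geqslant0$. The superscript $(w)$ denotes the part of weight $w$. Elements of $\mathscr{J}_N(\Gamma_1(n))$ are periodic under $z_i\mapsto z_i+1$ and $z_i\mapsto z_i+n\tau$, and have poles at most along $z_i-z_j\equiv k\tau$ modulo $1,n\tau$ (for $\mathscr{J}_N$ take $n=1$). Let $R_\tau=\mathbb{R}/(n\,\mathrm{Im}\,\tau)\mathbb{Z}$ and $\Delta_\tau\subset R_\tau^N$ be the union of the diagonals $\{x_j-x_i\equiv k\,\mathrm{Im}\,\tau \bmod n\,\mathrm{Im}\,\tau\}$, $i\neq j$, $k\in\mathbb{Z}/n\mathbb{Z}$. The connected components of $R_\tau^N\setminus\Delta_\tau$ are indexed by a discrete datum $\Sigma$ independent of $\tau$ (rescale coordinates by $1/\mathrm{Im}\,\tau$ to identify them with the components of $(\mathbb{R}/n\mathbb{Z})^N\setminus\bigcup_{i\neq j}\{x_j-x_i\in\mathbb{Z}/n\mathbb{Z}\}$); write $U_\Sigma$ for the component. For $\alpha\in U_\Sigma$, let $\mathsf{T}_\alpha$ be the real $N$-torus of points $(z_1,\dots,z_N)\in(\mathbb{C}/\langle1,n\tau\rangle)^N$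 of the form $z_j=t_j+i\alpha_j$, $t_j\in[0,1]$. Set $[f]_\Sigma(\tau)=\int_{\mathsf{T}_\alpha}f(z_1,\dots,z_N;\tau)\,dz_1\cdots dz_N$, which does not depend on the choice of $\alpha\in U_\Sigma$. *)

theory Defs
  imports "HOL-Analysis.Analysis" "HOL-Complex_Analysis.Complex_Analysis" "HOL-Number_Theory.Cong"
begin

section \<open>Quasi-modular forms\<close>

definition upper_half :: "complex set" where
  "upper_half = {\<tau>. Im \<tau> > 0}"

definition SL2Z :: "(int^2^2) set" where
  "SL2Z = {A. det A = 1}"

definition Gamma1 :: "nat \<Rightarrow> (int^2^2) set" where
  "Gamma1 n = {A \<in> SL2Z. [A$1$1 = 1] (mod int n) \<and> [A$2$1 = 0] (mod int n) \<and> [A$2$2 = 1] (mod int n)}"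

definition automorphy :: "int^2^2 \<Rightarrow> complex \<Rightarrow> complex" where
  "automorphy A \<tau> = of_int (A$2$1) * \<tau> + of_int (A$2$2)"

definition moebius_act :: "int^2^2 \<Rightarrow> complex \<Rightarrow> complex" where
  "moebius_act A \<tau> = (of_int (A$1$1) * \<tau> + of_int (A$1$2)) / automorphy A \<tau>"

text \<open>
  Only the values on the upper half plane matter; no growth condition at the cusps is part of
  the definition, so negative weights are meaningful.
\<close>

definition quasimodular_of_depth :: "(int^2^2) set \<Rightarrow> int \<Rightarrow> nat \<Rightarrow> (complex \<Rightarrow> complex) \<Rightarrow> bool" where
  "quasimodular_of_depth \<Gamma> w p f \<longleftrightarrow>
     (\<exists>F :: nat \<Rightarrow> complex \<Rightarrow> complex. F 0 = f \<and> (\<forall>i\<le>p. F i holomorphic_on upper_half) \<and>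
        (\<forall>A\<in>\<Gamma>. \<forall>\<tau>\<in>upper_half.
           automorphy A \<tau> powi (-w) * f (moebius_act A \<tau>) =
           (\<Sum>i\<le>p. F i \<tau> * (of_int (A$2$1) / automorphy A \<tau>) ^ i)))"

definition QMod :: "(int^2^2) set \<Rightarrow> int \<Rightarrow> (complex \<Rightarrow> complex) set" where
  "QMod \<Gamma> w = {f. \<exists>p. quasimodular_of_depth \<Gamma> w p f}"

definition QMod_le :: "(int^2^2) set \<Rightarrow> int \<Rightarrow> (complex \<Rightarrow> complex) set" where
  "QMod_le \<Gamma> w = {f. \<exists>W g. finite W \<and> W \<subseteq> {..w} \<and> (\<forall>v\<in>W. g v \<in> QMod \<Gamma> v) \<and>
     (\<forall>\<tau>\<in>upper_half. f \<tau> = (\<Sum>v\<in>W. g v \<tau>))}"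

section \<open>Eisenstein series and the Weierstrass function\<close>

text \<open>
  Eisenstein summation (inner sum over \<open>d\<close>, outer sum over \<open>c\<close>), which is needed for \<open>k = 2\<close>:
  there the double series is not absolutely convergent, but both iterated sums are. Other common
  normalisations of \<open>G\<^sub>k\<close> differ by a nonzero constant factor, which does not affect the
  complex algebra generated by these series.
\<close>

definition eisenstein_G :: "nat \<Rightarrow> complex \<Rightarrow> complex" where
  "eisenstein_G k \<tau> =
     (\<Sum>\<^sub>\<infinity>c::int. \<Sum>\<^sub>\<infinity>d::int\<in>{d. (c, d) \<noteq> (0, 0)}. 1 / (of_int c * \<tau> + of_int d) ^ k)"

definition lattice_point :: "complex \<Rightarrow> int \<times> int \<Rightarrow> complex" where
  "lattice_point \<tau> = (\<lambda>(a, b). of_int a + of_int b * \<tau>)"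

definition weierstrass_wp :: "complex \<Rightarrow> complex \<Rightarrow> complex" where
  "weierstrass_wp z \<tau> = 1 / z\<^sup>2 +
     (\<Sum>\<^sub>\<infinity>l\<in>UNIV - {(0, 0)}. 1 / (z - lattice_point \<tau> l)\<^sup>2 - 1 / (lattice_point \<tau> l)\<^sup>2)"

definition wp_deriv :: "nat \<Rightarrow> complex \<Rightarrow> complex \<Rightarrow> complex" where
  "wp_deriv s z \<tau> = (deriv ^^ s) (\<lambda>u. weierstrass_wp u \<tau>) z"

section \<open>The graded rings of multivariate elliptic functions\<close>

text \<open>
  Points of $\mathbb{C}^N$ are represented by functions on the natural numbers of which only the
  values at indices below \<open>N\<close> are relevant.
\<close>

type_synonym ell_fun = "(nat \<Rightarrow> complex) \<Rightarrow> complex \<Rightarrow> complex"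

definition regular_points :: "nat \<Rightarrow> nat \<Rightarrow> ((nat \<Rightarrow> complex) \<times> complex) set" where
  "regular_points N n = {(z, \<tau>). \<tau> \<in> upper_half \<and>
     (\<forall>i<N. \<forall>j<N. i \<noteq> j \<longrightarrow> (\<forall>k<n. z i - z j - of_nat k * \<tau> \<notin> range (lattice_point (of_nat n * \<tau>))))}"

text \<open>
  The weight-\<open>w\<close> part of the complex algebra generated by homogeneous generators (\<open>gens v g\<close>:
  the function \<open>g\<close> is a generator of weight \<open>v\<close>), i.e. the span of the monomials of weight \<open>w\<close>.
  The last rule identifies functions that agree off the polar divisor, so that the arbitrary
  values that total functions take at poles are irrelevant.
\<close>

inductive graded_part ::
  "nat \<Rightarrow> nat \<Rightarrow> (int \<Rightarrow> ell_fun \<Rightarrow> bool) \<Rightarrow> int \<Rightarrow> ell_fun \<Rightarrow> bool"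
  for N n gens where
  gen: "gens w f \<Longrightarrow> graded_part N n gens w f"
| const: "graded_part N n gens 0 (\<lambda>z \<tau>. c)"
| zero: "graded_part N n gens w (\<lambda>z \<tau>. 0)"
| add: "graded_part N n gens w f \<Longrightarrow> graded_part N n gens w g \<Longrightarrow>
    graded_part N n gens w (\<lambda>z \<tau>. f z \<tau> + g z \<tau>)"
| mult: "graded_part N n gens v f \<Longrightarrow> graded_part N n gens w g \<Longrightarrow>
    graded_part N n gens (v + w) (\<lambda>z \<tau>. f z \<tau> * g z \<tau>)"
| agree: "graded_part N n gens w f \<Longrightarrow> (\<And>z \<tau>. (z, \<tau>) \<in> regular_points N n \<Longrightarrow> g z \<tau> = f z \<tau>) \<Longrightarrow>
    graded_part N n gens w g"

inductive gens_full :: "nat \<Rightarrow> int \<Rightarrow> ell_fun \<Rightarrow> bool" for N where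
  "k \<in> {2, 4, 6} \<Longrightarrow> gens_full N (int k) (\<lambda>z \<tau>. eisenstein_G k \<tau>)"
| "i < N \<Longrightarrow> j < N \<Longrightarrow> i \<noteq> j \<Longrightarrow> gens_full N (int s + 2) (\<lambda>z \<tau>. wp_deriv s (z i - z j) \<tau>)"

inductive gens_Gamma1 :: "nat \<Rightarrow> nat \<Rightarrow> int \<Rightarrow> ell_fun \<Rightarrow> bool" for N n where
  "g \<in> QMod (Gamma1 n) w \<Longrightarrow> gens_Gamma1 N n w (\<lambda>z \<tau>. g \<tau>)"
| "i < N \<Longrightarrow> j < N \<Longrightarrow> i \<noteq> j \<Longrightarrow> k < n \<Longrightarrow>
    gens_Gamma1 N n (int s + 2) (\<lambda>z \<tau>. wp_deriv s (z i - z j - of_nat k * \<tau>) (of_nat n * \<tau>))"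

definition ellring :: "nat \<Rightarrow> int \<Rightarrow> ell_fun set" where
  "ellring N w = {f. graded_part N 1 (gens_full N) w f}"

definition ellring_Gamma1 :: "nat \<Rightarrow> nat \<Rightarrow> int \<Rightarrow> ell_fun set" where
  "ellring_Gamma1 N n w = {f. graded_part N n (gens_Gamma1 N n) w f}"

section \<open>Chambers and integration over real tori\<close>

text \<open>The circle $\mathbb{R}/n\mathbb{Z}$: its points are cosets, with the quotient topology.\<close>

definition circle_class :: "nat \<Rightarrow> real \<Rightarrow> real set" where
  "circle_class n x = range (\<lambda>m::int. x + of_nat n * of_int m)"

definition circle_top :: "nat \<Rightarrow> real set topology" where
  "circle_top n = topology (\<lambda>U. U \<subseteq> range (circle_class n) \<and> open (circle_class n -` U))"

lemma openin_circle_top: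
  "openin (circle_top n) U \<longleftrightarrow> U \<subseteq> range (circle_class n) \<and> open (circle_class n -` U)"
proof -
  have "istopology (\<lambda>U. U \<subseteq> range (circle_class n) \<and> open (circle_class n -` U))"
    unfolding istopology_def
  proof (intro conjI allI impI)
    fix S T
    assume "S \<subseteq> range (circle_class n) \<and> open (circle_class n -` S)"
      and "T \<subseteq> range (circle_class n) \<and> open (circle_class n -` T)"
    then show "S \<inter> T \<subseteq> range (circle_class n)" and "open (circle_class n -` (S \<inter> T))"
      by (blast, simp only: vimage_Int open_Int)
  next
    fix K
    assume K: "\<forall>U\<in>K. U \<subseteq> range (circle_class n) \<and> open (circle_class n -` U)"
    then show "\<Union>K \<subseteq> range (circle_class n)" by blast
    have "open (\<Union>U\<in>K. circle_class n -` U)" using K by (intro open_UN) blast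
    then show "open (circle_class n -` \<Union>K)" by (simp only: vimage_Union)
  qed
  then show ?thesis
    unfolding circle_top_def by (simp only: topology_inverse')
qed

lemma topspace_circle_top: "topspace (circle_top n) = range (circle_class n)"
proof
  show "topspace (circle_top n) \<subseteq> range (circle_class n)"
    using openin_topspace[of "circle_top n"] unfolding openin_circle_top by blast
  have "circle_class n -` range (circle_class n) = UNIV" by blast
  then have "openin (circle_top n) (range (circle_class n))"
    unfolding openin_circle_top by (simp only: open_UNIV order_refl simp_thms)
  then show "range (circle_class n) \<subseteq> topspace (circle_top n)" by (rule openin_subset)
qed

lemma quotient_map_circle_class: "quotient_map euclideanreal (circle_top n) (circle_class n)"
proof -
  have "{x. circle_class n x \<in> U} = circle_class n -` U" for U by blast
  then show ?thesis
    by (simp only: quotient_map_def topspace_circle_top openin_circle_top topspace_euclidean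
        open_openin[symmetric] UNIV_I simp_thms) blast
qed

definition torus_class :: "nat \<Rightarrow> nat \<Rightarrow> (nat \<Rightarrow> real) \<Rightarrow> (nat \<Rightarrow> real set)" where
  "torus_class N n x = (\<lambda>j\<in>{..<N}. circle_class n (x j))"

definition off_diagonals :: "nat \<Rightarrow> nat \<Rightarrow> (nat \<Rightarrow> real set) set" where
  "off_diagonals N n = torus_class N n ` {x. \<forall>i<N. \<forall>j<N. i \<noteq> j \<longrightarrow> x j - x i \<notin> \<int>}"

definition chambers :: "nat \<Rightarrow> nat \<Rightarrow> (nat \<Rightarrow> real set) set set" where
  "chambers N n = connected_components_of
     (subtopology (product_topology (\<lambda>_. circle_top n) {..<N}) (off_diagonals N n))"

text \<open>
  Real lifts \<open>\<alpha>\<close> of the points of the component $U_\Sigma$ of $R_\tau^N\setminus\Delta_\tau$,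
  where $R_\tau = \mathbb{R}/(n\,\mathrm{Im}\,\tau)\mathbb{Z}$ is rescaled to $\mathbb{R}/n\mathbb{Z}$.
\<close>

definition chamber_lifts :: "nat \<Rightarrow> nat \<Rightarrow> (nat \<Rightarrow> real set) set \<Rightarrow> complex \<Rightarrow> (nat \<Rightarrow> real) set" where
  "chamber_lifts N n S \<tau> = {\<alpha>. torus_class N n (\<lambda>j. \<alpha> j / Im \<tau>) \<in> S}"

definition torus_integral :: "nat \<Rightarrow> ell_fun \<Rightarrow> (nat \<Rightarrow> real) \<Rightarrow> complex \<Rightarrow> complex" where
  "torus_integral N f \<alpha> \<tau> =
     (LINT t:(\<Pi>\<^sub>E j\<in>{..<N}. {0..1})|(\<Pi>\<^sub>M j\<in>{..<N}. lborel).
        f (\<lambda>j. complex_of_real (t j) + \<i> * complex_of_real (\<alpha> j)) \<tau>)"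

text \<open>
  For \<open>f\<close> in the rings above, the integral does not depend on the choice of \<open>\<alpha>\<close> in the chamber.
\<close>

definition bracket :: "nat \<Rightarrow> nat \<Rightarrow> (nat \<Rightarrow> real set) set \<Rightarrow> ell_fun \<Rightarrow> complex \<Rightarrow> complex" where
  "bracket N n S f \<tau> = torus_integral N f (SOME \<alpha>. \<alpha> \<in> chamber_lifts N n S \<tau>) \<tau>"

end

(*
The bracket is computed by integrating one variable at a time inside a larger filtered ring, spanned
by products of quasi-modular forms and of the Eisenstein functions E_m(z_i - z_j - k tau; n tau),
m >= 1. Here E_1 is 1-periodic with E_1(u + n tau) = E_1(u) - 2 pi i and E_1' = -E_2 = -(wp + G_2), so
that the derivatives of wp are, up to constants, the E_m.

As a function of its last variable u, an element F of the ring is a polynomial in y = E_1(u - z_0)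
with elliptic coefficients, so there is G in the ring, of weight one more, with G(u) - G(u + n tau) =
F(u). Hence the integral of F over a horizontal circle is 2 pi i times the sum of the residues of G in
a period strip, and these are Laurent coefficients, which again lie in the ring (with one variable
less, and back in the original weight). After the last integration only values and Taylor coefficients of
E_m at the points k tau remain. They are quasi-modular, except that for m = 1 the modular object is the
Hecke form E_1(k tau; n tau) + 2 pi i k/n; this constant, and the quasi-period -2 pi i, are the reason
for the mixed weights. The transformation law of E_1 (and with it that of G_2) follows from the
invariance of wp: the difference of the two sides has constant derivative, is odd, and its slope is
read off from the quasi-period.

Which poles lie in the strip depends only on the integer parts of differences of the heights. So the
integral is locally constant in the heights, and being periodic it is constant on chambers; this
provides one combinatorial type that serves all tau.
*)

theory Submission
  imports Defs
begin

(* Otherwise matrix entries such as A$1$2 have exponentially many parses. *)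
no_notation fps_nth (infixl \<open>$\<close> 75)

text \<open>Elliptic functions are not closed under integrating out a variable: the residue formula
  for the inner integral holds for one arrangement of the heights only, and continuing it past a
  pole changes it. The induction therefore runs over functions that are merely 1-periodic, for a
  fixed arrangement of the heights. Ellipticity of the integrand in all its variables is used only
  at the end, to move heights by multiples of n Im \<tau>. The antidifference exists because y is
  shifted by a non-zero constant c: some polynomial p of degree at most d + 1 satisfies p(Y) - p(Y +
  c) = Y^d. This costs one weight, and a residue, being the coefficient of v^(-1), gives it back.
  The constant c = -2 pi i is the difference of the limits of pi cot (pi z) at +i infinity and at -i
  infinity; convergence of the Eisenstein functions rests on the exponential approach of the
  cotangent and its derivatives to these limits. The modular laws start from wp because its series
  converges absolutely and may be reindexed by a matrix, which the conditionally convergent series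
  for E_1 and G_2 do not permit.\<close>

section \<open>Partial fractions of the cotangent\<close>

(*
kap m z is the sum of (z + a)^(-m) over all integers a, taken in Eisenstein order for m = 1, where it is
pi cot (pi z); kreg m is its part without a = 0.
*)
definition kreg :: "nat \<Rightarrow> complex \<Rightarrow> complex" where
  "kreg m z = (Polygamma (m - 1) (1 - z) + (-1) ^ m * Polygamma (m - 1) (1 + z)) / fact (m - 1)"

definition kap :: "nat \<Rightarrow> complex \<Rightarrow> complex" where
  "kap m z = 1 / z ^ m + kreg m z"

lemma one_plus_notin_nonpos_Ints:
  fixes z :: complex
  assumes "z \<notin> \<int> - {0}"
  shows "1 + z \<notin> \<int>\<^sub>\<le>\<^sub>0" "1 - z \<notin> \<int>\<^sub>\<le>\<^sub>0"
proof -
  show "1 + z \<notin> \<int>\<^sub>\<le>\<^sub>0"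
  proof
    assume *: "1 + z \<in> \<int>\<^sub>\<le>\<^sub>0"
    then have "1 + z - 1 \<in> \<int>" using nonpos_Ints_Int Ints_diff Ints_1 by blast
    with assms * show False by auto
  qed
  show "1 - z \<notin> \<int>\<^sub>\<le>\<^sub>0"
  proof
    assume *: "1 - z \<in> \<int>\<^sub>\<le>\<^sub>0"
    then have "1 - (1 - z) \<in> \<int>" using nonpos_Ints_Int Ints_diff Ints_1 by blast
    with assms * show False by auto
  qed
qed

text \<open>The sums over positive and over negative shifts are polygamma values, so differentiation
  is inherited from \<open>Polygamma\<close>; this covers m = 1, where neither half of the series
  converges by itself.\<close>

lemma has_field_derivative_kreg:
  assumes "m \<ge> 1" "z \<notin> \<int> - {0}"
  shows "(kreg m has_field_derivative - of_nat m * kreg (Suc m) z) (at z)"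
proof -
  obtain k where m: "m = Suc k" using assms(1) by (cases m) auto
  note n = one_plus_notin_nonpos_Ints[OF assms(2)]
  have "((\<lambda>z. (Polygamma k (1 - z) + (-1) ^ Suc k * Polygamma k (1 + z)) / fact k)
     has_field_derivative (Polygamma (Suc k) (1 - z) * (0 - 1) +
        (-1) ^ Suc k * (Polygamma (Suc k) (1 + z) * (0 + 1))) / fact k) (at z)"
    by (intro DERIV_add DERIV_cdivide DERIV_cmult DERIV_chain2[OF has_field_derivative_Polygamma] n derivative_intros)
  moreover have "(Polygamma (Suc k) (1 - z) * (0 - 1) +
        (-1) ^ Suc k * (Polygamma (Suc k) (1 + z) * (0 + 1))) / fact k = - of_nat m * kreg (Suc m) z"
    proof -
    have "of_nat (Suc k) * (x / fact (Suc k)) = x / fact k" for x :: complex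
      by (simp add: fact_Suc del: of_nat_Suc)
    from this[of "Polygamma (Suc k) (1 - z) + (-1) ^ Suc (Suc k) * Polygamma (Suc k) (1 + z)"]
    show ?thesis unfolding kreg_def m by (simp add: field_simps del: of_nat_Suc fact_Suc)
  qed
  moreover have "kreg m = (\<lambda>z. (Polygamma k (1 - z) + (-1) ^ Suc k * Polygamma k (1 + z)) / fact k)"
    unfolding kreg_def m by simp
  ultimately show ?thesis by simp
qed

lemma has_field_derivative_inverse_power:
  fixes z :: complex
  assumes "z \<noteq> 0"
  shows "((\<lambda>z. 1 / z ^ m) has_field_derivative - of_nat m * (1 / z ^ Suc m)) (at z)"
proof (cases m)
  case (Suc k)
  have "((\<lambda>z. 1 / z ^ m) has_field_derivative (0 * z ^ m - 1 * (of_nat m * z ^ (m - Suc 0))) / (z ^ m * z ^ m)) (at z)"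
    using assms by (intro derivative_intros DERIV_divide DERIV_pow) (auto intro!: derivative_eq_intros)
  moreover have "(0 * z ^ m - 1 * (of_nat m * z ^ (m - Suc 0))) / (z ^ m * z ^ m) = - of_nat m * (1 / z ^ Suc m)"
    using assms by (simp add: Suc divide_simps)
  ultimately show ?thesis by metis
qed auto

lemma has_field_derivative_kap:
  assumes "m \<ge> 1" "z \<notin> \<int>"
  shows "(kap m has_field_derivative - of_nat m * kap (Suc m) z) (at z)"
proof -
  have z: "z \<noteq> 0" "z \<notin> \<int> - {0}" using assms by auto
  have "((\<lambda>z. 1 / z ^ m + kreg m z) has_field_derivative
      - of_nat m * (1 / z ^ Suc m) + - of_nat m * kreg (Suc m) z) (at z)"
    by (intro DERIV_add has_field_derivative_inverse_power has_field_derivative_kreg assms z)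
  then show ?thesis unfolding kap_def[abs_def] by (simp only: distrib_left)
qed

lemma holomorphic_on_kap: "m \<ge> 1 \<Longrightarrow> S \<inter> \<int> = {} \<Longrightarrow> kap m holomorphic_on S"
  unfolding holomorphic_on_def field_differentiable_def
  by (meson disjoint_iff has_field_derivative_kap has_field_derivative_at_within)

lemma kreg_minus: "kreg m (-z) = (-1) ^ m * kreg m z"
  unfolding kreg_def by (cases "even m") (auto simp: diff_divide_distrib)

lemma kap_minus: "kap m (-z) = (-1) ^ m * kap m z"
proof -
  have "1 / (- z) ^ m = (-1) ^ m * (1 / z ^ m)"
    by (cases "even m") auto
  then show ?thesis unfolding kap_def by (simp add: kreg_minus distrib_left)
qed

lemma kap_Polygamma:
  assumes "m \<ge> 1" "z \<noteq> 0"
  shows "kap m z = (Polygamma (m - 1) (1 - z) + (-1) ^ m * Polygamma (m - 1) z) / fact (m - 1)"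
proof -
  obtain k where m: "m = Suc k" using assms(1) by (cases m) auto
  show ?thesis
    unfolding kap_def kreg_def m add.commute[of 1 z] Polygamma_plus1[OF assms(2)]
    using assms(2) by (simp add: add_divide_distrib distrib_left mult.assoc[symmetric] power_add[symmetric] mult_2[symmetric] diff_divide_distrib)
qed

text \<open>The recurrences of \<open>Polygamma\<close> at z and at -z produce the same term, -fact
  (m - 1) / z^m, on both sides.\<close>

lemma kap_plus_1:
  assumes "m \<ge> 1" "z \<notin> \<int>"
  shows "kap m (z + 1) = kap m z"
proof -
  obtain k where m: "m = Suc k" using assms(1) by (cases m) auto
  have z: "z \<noteq> 0" "z + 1 \<noteq> 0" "- z \<noteq> 0"
    using assms(2) Ints_0 Ints_minus[of "-1"] by (auto simp: add_eq_0_iff2)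
  have a: "Polygamma k (1 - z) = Polygamma k (-z) + (-1) ^ k * fact k / ((-z) ^ Suc k)"
    using Polygamma_plus1[OF z(3), of k] by (simp add: algebra_simps)
  have b: "(-1) ^ k * fact k / ((-z) ^ Suc k) = - fact k / (z ^ Suc k)"
    by (cases "even k") auto
  have c: "(-1) ^ Suc k * Polygamma k (z + 1) = (-1) ^ Suc k * Polygamma k z - fact k / (z ^ Suc k)"
    unfolding Polygamma_plus1[OF z(1), of k] by (cases "even k") (auto simp: algebra_simps)
  have "kap m (z + 1) = (Polygamma k (- z) + (-1) ^ Suc k * Polygamma k (z + 1)) / fact k"
    using kap_Polygamma[OF assms(1) z(2)] by (simp add: m)
  moreover have "kap m z = (Polygamma k (1 - z) + (-1) ^ Suc k * Polygamma k z) / fact k"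
    using kap_Polygamma[OF assms(1) z(1)] by (simp add: m)
  ultimately show ?thesis unfolding a b c by simp
qed

text \<open>Differentiate the reflection formula Gamma z * Gamma (1 - z) = pi / sin (pi z) and
  divide by it.\<close>

lemma kap_1_cot:
  assumes "z \<notin> \<int>"
  shows "kap 1 z = of_real pi * cot (of_real pi * z)"
proof -
  have z0: "z \<noteq> 0" using assms by auto
  have z: "z \<notin> \<int>\<^sub>\<le>\<^sub>0" "1 - z \<notin> \<int>\<^sub>\<le>\<^sub>0"
    using assms nonpos_Ints_Int one_plus_notin_nonpos_Ints(2)[of z] by auto
  let ?s = "sin (of_real pi * z)"
  have s: "?s \<noteq> 0"
    using assms by (auto simp: sin_eq_0 mult.commute)
  have "((\<lambda>z. Gamma z * Gamma (1 - z)) has_field_derivative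
     (Gamma z * Digamma z) * Gamma (1 - z) + (Gamma (1 - z) * Digamma (1 - z) * (0 - 1)) * Gamma z) (at z)"
    by (intro derivative_intros z DERIV_chain2[OF has_field_derivative_Gamma] DERIV_mult)
  moreover have "((\<lambda>z. of_real pi / sin (of_real pi * z)) has_field_derivative
     (0 * ?s - of_real pi * (cos (of_real pi * z) * (of_real pi * 1))) / (?s * ?s)) (at z)"
    using s by (intro derivative_intros DERIV_divide DERIV_chain2[OF DERIV_sin] DERIV_cmult)
  ultimately have "(Gamma z * Digamma z) * Gamma (1 - z) + (Gamma (1 - z) * Digamma (1 - z) * (0 - 1)) * Gamma z
    = (0 * ?s - of_real pi * (cos (of_real pi * z) * (of_real pi * 1))) / (?s * ?s)"
    unfolding Gamma_reflection_complex by (rule DERIV_unique)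
  then have "(Gamma z * Gamma (1 - z)) * (Digamma (1 - z) - Digamma z) = 
     (of_real pi / ?s) * (of_real pi * cos (of_real pi * z) / ?s)"
    by (simp add: algebra_simps)
  then have "Digamma (1 - z) - Digamma z = of_real pi * cos (of_real pi * z) / ?s"
    unfolding Gamma_reflection_complex using s by (simp add: divide_simps split: if_splits)
  then show ?thesis using kap_Polygamma[of 1 z] z0 by (simp add: cot_def)
qed

text \<open>With X = exp (2 pi i w) one has pi cot (pi w) = pi i (X + 1) / (X - 1), so the deviation
  from -pi i is 2 pi i X / (X - 1), which is of the size of X.\<close>

lemma kap_1_bound_upper:
  assumes "\<delta> > 0" "Im w \<ge> \<delta>"
  shows "norm (kap 1 w + \<i> * of_real pi) \<le> 2 * pi / (1 - exp (- 2 * pi * \<delta>)) * exp (- 2 * pi * Im w)"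
proof -
  define X where "X = exp (2 * \<i> * of_real pi * w)"
  have nX: "norm X = exp (- 2 * pi * Im w)" unfolding X_def by simp
  have le: "norm X \<le> exp (- 2 * pi * \<delta>)" unfolding nX using assms by simp
  have lt: "exp (- 2 * pi * \<delta>) < 1" using assms by simp
  have X1: "1 - norm X > 0" "X \<noteq> 1" using le_less_trans[OF le lt] by auto
  have w: "w \<notin> \<int>" using assms by (auto elim!: Ints_cases)
  define e where "e = exp (\<i> * (of_real pi * w))"
  have e: "e \<noteq> 0" "exp (- (\<i> * (of_real pi * w))) = 1 / e" "X = e * e"
    unfolding e_def X_def by (auto simp: exp_minus field_simps simp flip: exp_add)
  have "kap 1 w = of_real pi * (cos (of_real pi * w) / sin (of_real pi * w))"
    using kap_1_cot[OF w] by (simp add: cot_def)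
  also have "\<dots> = of_real pi * \<i> * (X + 1) / (X - 1)"
    unfolding sin_exp_eq cos_exp_eq e_def[symmetric] e(2,3)
    using e X1 by (simp add: divide_simps)
  finally have "kap 1 w + \<i> * of_real pi = of_real pi * \<i> * 2 * X / (X - 1)"
    using X1 by (simp add: divide_simps) (simp add: algebra_simps)
  then have "norm (kap 1 w + \<i> * of_real pi) = 2 * pi * norm X / norm (X - 1)"
    by (simp add: norm_mult norm_divide)
  also have "\<dots> \<le> 2 * pi * norm X / (1 - exp (- 2 * pi * \<delta>))"
    using le lt X1 norm_triangle_ineq2[of 1 X] norm_minus_commute[of X 1]
    by (intro divide_left_mono mult_pos_pos) auto
  finally show ?thesis unfolding nX by simp
qed

(* The limit of kap m at +i infinity; at -i infinity the limit is its negative. *)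
definition kap_limit :: "nat \<Rightarrow> complex" where
  "kap_limit m = (if m = 1 then - \<i> * of_real pi else 0)"

text \<open>The step from m to m + 1 is Cauchy's estimate for a derivative on a disc of radius
  \<delta> / 2. It uses up half of the margin, so \<delta> is generalised in the induction.\<close>

lemma kap_bound_upper:
  assumes "m \<ge> 1" "\<delta> > 0"
  shows "\<exists>C\<ge>0. \<forall>w. Im w \<ge> \<delta> \<longrightarrow> norm (kap m w - kap_limit m) \<le> C * exp (- 2 * pi * Im w)"
  using assms
proof (induction m arbitrary: \<delta> rule: nat_induct_at_least)
  case base
  show ?case
    using kap_1_bound_upper[OF base] base
    by (intro exI[of _ "2 * pi / (1 - exp (- 2 * pi * \<delta>))"]) (auto simp: kap_limit_def)
next
  case (Suc m)
  obtain C where C: "C \<ge> 0" "\<And>w. Im w \<ge> \<delta> / 2 \<Longrightarrow> norm (kap m w - kap_limit m) \<le> C * exp (- 2 * pi * Im w)"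
    using Suc.IH[of "\<delta> / 2"] Suc.prems by auto
  show ?case
  \<comment> \<open>The factor \<open>exp (pi * \<delta>)\<close> pays for points of the disc that
    lie lower by up to \<delta> / 2; the divisor is the radius in Cauchy's estimate.\<close>
  proof (intro exI[of _ "C * exp (pi * \<delta>) / (\<delta> / 2)"] conjI allI impI)
    show "0 \<le> C * exp (pi * \<delta>) / (\<delta> / 2)" using C Suc.prems by simp
    fix w assume w: "Im w \<ge> \<delta>"
    have im: "Im v \<ge> Im w - \<delta> / 2" if "norm (w - v) \<le> \<delta> / 2" for v
      using abs_Im_le_cmod[of "w - v"] that by simp
    have nI: "v \<notin> \<int>" if "Im v \<ge> \<delta> / 2" for v
      using that Suc.prems by (auto elim!: Ints_cases)
    have sub: "cball w (\<delta> / 2) \<inter> \<int> = {}"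
      using im nI w by (force simp: dist_norm)
    have hol: "(\<lambda>v. kap m v - kap_limit m) holomorphic_on cball w (\<delta> / 2)"
      by (intro holomorphic_intros holomorphic_on_kap Suc.hyps sub)
    have "norm ((deriv ^^ 1) (\<lambda>v. kap m v - kap_limit m) w) \<le>
        fact 1 * (C * exp (pi * \<delta>) * exp (- 2 * pi * Im w)) / (\<delta> / 2) ^ 1"
    proof (rule Cauchy_inequality)
      show "(\<lambda>v. kap m v - kap_limit m) holomorphic_on ball w (\<delta> / 2)"
        using hol by (rule holomorphic_on_subset) auto
      show "continuous_on (cball w (\<delta> / 2)) (\<lambda>v. kap m v - kap_limit m)"
        using hol by (rule holomorphic_on_imp_continuous_on)
      fix v assume v: "norm (w - v) = \<delta> / 2"
      have "norm (kap m v - kap_limit m) \<le> C * exp (- 2 * pi * Im v)"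
        using im[of v] v w by (intro C) auto
      also have "\<dots> \<le> C * exp (- 2 * pi * (Im w - \<delta> / 2))"
        using im[of v] v C(1) by (intro mult_left_mono) auto
      also have "\<dots> = C * exp (pi * \<delta>) * exp (- 2 * pi * Im w)"
        by (simp add: exp_add[symmetric] mult.assoc) (simp add: algebra_simps)
      finally show "norm (kap m v - kap_limit m) \<le> C * exp (pi * \<delta>) * exp (- 2 * pi * Im w)" .
    qed (use Suc.prems in auto)
    moreover have "deriv (\<lambda>v. kap m v - kap_limit m) w = - of_nat m * kap (Suc m) w"
      using nI[of w] w Suc
      by (intro DERIV_imp_deriv) (auto intro!: derivative_eq_intros has_field_derivative_kap)
    ultimately have "norm (- of_nat m * kap (Suc m) w) \<le>
        fact 1 * (C * exp (pi * \<delta>) * exp (- 2 * pi * Im w)) / (\<delta> / 2) ^ 1"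
      by simp
    then have "real m * norm (kap (Suc m) w) \<le> C * exp (pi * \<delta>) / (\<delta> / 2) * exp (- 2 * pi * Im w)"
      by (simp add: norm_mult mult_ac)
    moreover have "1 * norm (kap (Suc m) w) \<le> real m * norm (kap (Suc m) w)"
      using Suc.hyps by (intro mult_right_mono) auto
    ultimately show "norm (kap (Suc m) w - kap_limit (Suc m)) \<le> C * exp (pi * \<delta>) / (\<delta> / 2) * exp (- 2 * pi * Im w)"
      using Suc.hyps by (simp add: kap_limit_def)
  qed
qed

lemma kap_limit_minus: "m \<ge> 1 \<Longrightarrow> (-1) ^ m * kap_limit m = - kap_limit m"
  by (simp add: kap_limit_def)

text \<open>For m = 1 the terms at b and -b do not tend to 0 separately, but their limits are
  opposite by \<open>kap_limit_minus\<close>, so the pair decays geometrically. The condition on b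
  puts both arguments, up to sign, at height at least 1.\<close>

lemma kap_sum_bound:
  assumes "m \<ge> 1" "\<epsilon> > 0"
  shows "\<exists>C\<ge>0. \<forall>z \<tau> b. Im \<tau> \<ge> \<epsilon> \<longrightarrow> \<bar>Im z\<bar> \<le> A \<longrightarrow> real b * \<epsilon> \<ge> A + 1 \<longrightarrow>
     norm (kap m (z - of_nat b * \<tau>) + kap m (z + of_nat b * \<tau>)) \<le> C * exp (- 2 * pi * \<epsilon>) ^ b"
proof -
  obtain C where C: "C \<ge> 0" "\<And>w. Im w \<ge> 1 \<Longrightarrow> norm (kap m w - kap_limit m) \<le> C * exp (- 2 * pi * Im w)"
    using kap_bound_upper[OF assms(1), of 1] by auto
  show ?thesis
  proof (intro exI[of _ "2 * C * exp (2 * pi * A)"] conjI allI impI)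
    show "2 * C * exp (2 * pi * A) \<ge> 0" using C by simp
    fix z \<tau> b assume h: "Im \<tau> \<ge> \<epsilon>" "\<bar>Im z\<bar> \<le> A" "real b * \<epsilon> \<ge> A + 1"
    have b: "real b * Im \<tau> \<ge> real b * \<epsilon>" using h by (intro mult_left_mono) auto
    have bd: "norm (kap m w - kap_limit m) \<le> C * exp (2 * pi * A) * exp (- 2 * pi * \<epsilon>) ^ b"
      if "Im w \<ge> real b * \<epsilon> - A" for w
    proof -
      have "norm (kap m w - kap_limit m) \<le> C * exp (- 2 * pi * Im w)" using that h by (intro C) auto
      also have "\<dots> \<le> C * exp (- 2 * pi * (real b * \<epsilon> - A))"
        using that C(1) by (intro mult_left_mono) auto
      also have "\<dots> = C * exp (2 * pi * A) * exp (- 2 * pi * \<epsilon>) ^ b"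
        by (simp add: exp_of_nat_mult[symmetric] exp_add[symmetric] mult.assoc) (simp add: algebra_simps)
      finally show ?thesis .
    qed
    have "kap m (z - of_nat b * \<tau>) = (-1) ^ m * kap m (of_nat b * \<tau> - z)"
      using kap_minus[of m "of_nat b * \<tau> - z"] by simp
    then have "kap m (z - of_nat b * \<tau>) + kap m (z + of_nat b * \<tau>) =
       (-1) ^ m * (kap m (of_nat b * \<tau> - z) - kap_limit m) + (kap m (z + of_nat b * \<tau>) - kap_limit m)"
      using kap_limit_minus[OF assms(1)] by (simp add: algebra_simps)
    also have "norm \<dots> \<le> norm (kap m (of_nat b * \<tau> - z) - kap_limit m) + norm (kap m (z + of_nat b * \<tau>) - kap_limit m)"
      by (rule norm_triangle_le) (simp add: norm_mult norm_power)
    also have "\<dots> \<le> 2 * C * exp (2 * pi * A) * exp (- 2 * pi * \<epsilon>) ^ b"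
      using bd[of "of_nat b * \<tau> - z"] bd[of "z + of_nat b * \<tau>"] b h(2) by (simp add: abs_le_iff)
    finally show "norm (kap m (z - of_nat b * \<tau>) + kap m (z + of_nat b * \<tau>)) \<le> 2 * C * exp (2 * pi * A) * exp (- 2 * pi * \<epsilon>) ^ b" .
  qed
qed

section \<open>Eisenstein functions\<close>

abbreviation lattice :: "complex \<Rightarrow> complex set" where
  "lattice \<tau> \<equiv> range (lattice_point \<tau>)"

lemma mem_lattice: "z \<in> lattice \<tau> \<longleftrightarrow> (\<exists>a b::int. z = of_int a + of_int b * \<tau>)"
  by (auto simp: lattice_point_def image_iff)

text \<open>These are the real coordinates in the basis 1, \<tau>. Closedness and discreteness of
  the lattice are read off from those of the integers.\<close>

lemma mem_lattice_coords:
  assumes "Im \<tau> > 0"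
  shows "z \<in> lattice \<tau> \<longleftrightarrow> Im z / Im \<tau> \<in> \<int> \<and> Re z - Im z / Im \<tau> * Re \<tau> \<in> \<int>"
proof
  assume "z \<in> lattice \<tau>"
  then show "Im z / Im \<tau> \<in> \<int> \<and> Re z - Im z / Im \<tau> * Re \<tau> \<in> \<int>"
    using assms by (auto simp: mem_lattice)
next
  assume "Im z / Im \<tau> \<in> \<int> \<and> Re z - Im z / Im \<tau> * Re \<tau> \<in> \<int>"
  then obtain a b :: int where "Im z / Im \<tau> = of_int b" "Re z - Im z / Im \<tau> * Re \<tau> = of_int a"
    by (meson Ints_cases)
  then have "z = of_int a + of_int b * \<tau>"
    using assms by (auto simp: complex_eq_iff field_simps)
  then show "z \<in> lattice \<tau>" by (auto simp: mem_lattice)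
qed

lemma zero_in_lattice [simp]: "0 \<in> lattice \<tau>"
  unfolding mem_lattice by (rule exI[of _ 0])+ simp

lemma lattice_add: "z \<in> lattice \<tau> \<Longrightarrow> w \<in> lattice \<tau> \<Longrightarrow> z + w \<in> lattice \<tau>"
  unfolding mem_lattice
proof (elim exE)
  fix a b c d :: int
  assume "z = of_int a + of_int b * \<tau>" "w = of_int c + of_int d * \<tau>"
  then have "z + w = of_int (a + c) + of_int (b + d) * \<tau>" by (simp add: algebra_simps)
  then show "\<exists>a b. z + w = of_int a + of_int b * \<tau>" by blast
qed

lemma lattice_minus: "z \<in> lattice \<tau> \<Longrightarrow> - z \<in> lattice \<tau>"
  unfolding mem_lattice
proof (elim exE)
  fix a b :: int
  assume "z = of_int a + of_int b * \<tau>"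
  then have "- z = of_int (- a) + of_int (- b) * \<tau>" by (simp add: algebra_simps)
  then show "\<exists>a b. - z = of_int a + of_int b * \<tau>" by blast
qed

lemma uminus_in_lattice_iff [simp]: "- z \<in> lattice \<tau> \<longleftrightarrow> z \<in> lattice \<tau>"
  using lattice_minus[of z \<tau>] lattice_minus[of "- z" \<tau>] by auto

lemma add_in_lattice_iff: "w \<in> lattice \<tau> \<Longrightarrow> z + w \<in> lattice \<tau> \<longleftrightarrow> z \<in> lattice \<tau>"
  using lattice_add[of z \<tau> w] lattice_add[of "z + w" \<tau> "- w"] by auto

lemma int_comb_in_lattice: "of_int a + of_int b * \<tau> \<in> lattice \<tau>"
  by (auto simp: mem_lattice)

lemma open_Compl_lattice:
  assumes "Im \<tau> > 0"
  shows "open (- lattice \<tau>)"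
proof -
  have "lattice \<tau> = (\<lambda>z. Im z / Im \<tau>) -` \<int> \<inter> (\<lambda>z. Re z - Im z / Im \<tau> * Re \<tau>) -` \<int>"
    using mem_lattice_coords[OF assms] by blast
  also have "closed \<dots>"
    using assms by (intro closed_Int continuous_closed_vimage closed_Ints continuous_intros) auto
  finally show ?thesis by (simp add: open_Compl)
qed

lemma open_Compl_lattice_minus_0:
  assumes "Im \<tau> > 0"
  shows "open (- (lattice \<tau> - {0}))"
proof -
  let ?U = "{z. \<bar>Im z / Im \<tau>\<bar> < 1} \<inter> {z. \<bar>Re z - Im z / Im \<tau> * Re \<tau>\<bar> < 1}"
  have zero: "z = 0" if "z \<in> lattice \<tau>" "z \<in> ?U" for z
  proof -
    have real_zero: "x = 0" if "x \<in> \<int>" "\<bar>x\<bar> < 1" for x :: real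
      using that by (auto elim!: Ints_cases)
    have "Im z / Im \<tau> = 0" "Re z - Im z / Im \<tau> * Re \<tau> = 0"
      using that mem_lattice_coords[OF assms, of z] real_zero by blast+
    then show ?thesis using assms by (auto simp: complex_eq_iff)
  qed
  have "- (lattice \<tau> - {0}) = - lattice \<tau> \<union> ?U"
  proof (rule set_eqI)
    show "z \<in> - (lattice \<tau> - {0}) \<longleftrightarrow> z \<in> - lattice \<tau> \<union> ?U" for z
      using zero[of z] by (cases "z = 0") auto
  qed
  moreover have "open ?U"
    using assms by (intro open_Int open_Collect_less continuous_intros) auto
  ultimately show ?thesis using open_Compl_lattice[OF assms] by auto
qed

lemma connected_Compl_lattice: "connected (- lattice \<tau>)"
proof -
  have "countable (lattice \<tau>)" by auto
  then show ?thesis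
    by (intro path_connected_imp_connected path_connected_complement_countable) auto
qed

section \<open>Convergence, derivatives and periods of the Eisenstein functions\<close>

lemma lattice_int_cases:
  assumes "z + of_int b * \<tau> \<in> \<int>"
  shows "z \<in> lattice \<tau>"
proof -
  obtain a where "z + of_int b * \<tau> = of_int a" using assms by (auto elim!: Ints_cases)
  then have "z = of_int a + of_int (- b) * \<tau>" by (simp add: algebra_simps)
  then show ?thesis by (metis int_comb_in_lattice)
qed

definition off_tail :: "complex \<Rightarrow> complex \<Rightarrow> bool" where
  "off_tail z \<tau> \<longleftrightarrow> (\<forall>b. z - of_nat (Suc b) * \<tau> \<notin> \<int> \<and> z + of_nat (Suc b) * \<tau> \<notin> \<int>)"

lemma off_tailI:
  assumes "Im \<tau> > 0" "z \<notin> lattice \<tau> - {0}"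
  shows "off_tail z \<tau>"
proof -
  have *: "z + of_int b * \<tau> \<notin> \<int>" if "b \<noteq> 0" for b
  proof
    assume h: "z + of_int b * \<tau> \<in> \<int>"
    then have "z = 0" using lattice_int_cases assms by auto
    with h obtain a where "of_int b * \<tau> = of_int a" by (auto elim!: Ints_cases)
    then have "Im (of_int b * \<tau>) = 0" by simp
    with that assms show False by auto
  qed
  have "z - of_nat (Suc b) * \<tau> \<notin> \<int>" "z + of_nat (Suc b) * \<tau> \<notin> \<int>" for b
    using *[of "int (Suc b)"] *[of "- int (Suc b)"] by (simp_all del: of_nat_Suc)
  then show ?thesis unfolding off_tail_def by blast
qed

(*
eis_fun m z tau is the iterated sum over b and a of (z + a + b tau)^(-m), with b and -b paired (which
matters only for m = 1); eis_reg is its part without (a, b) = (0, 0).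
*)
definition eis_tail :: "nat \<Rightarrow> complex \<Rightarrow> complex \<Rightarrow> complex" where
  "eis_tail m z \<tau> = (\<Sum>b. kap m (z - of_nat (Suc b) * \<tau>) + kap m (z + of_nat (Suc b) * \<tau>))"

definition eis_reg :: "nat \<Rightarrow> complex \<Rightarrow> complex \<Rightarrow> complex" where
  "eis_reg m z \<tau> = kreg m z + eis_tail m z \<tau>"

definition eis_fun :: "nat \<Rightarrow> complex \<Rightarrow> complex \<Rightarrow> complex" where
  "eis_fun m z \<tau> = 1 / z ^ m + eis_reg m z \<tau>"

lemma eis_fun_kap: "eis_fun m z \<tau> = kap m z + eis_tail m z \<tau>"
  by (simp add: eis_fun_def eis_reg_def kap_def)

text \<open>The arguments are arbitrary families \<open>Z\<close> and \<open>T\<close>, so that one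
  Weierstrass test serves for convergence at a point, holomorphy in z and holomorphy in
  \<tau>.\<close>

lemma uniform_limit_eis_tail:
  assumes "m \<ge> 1" "\<epsilon> > 0" "\<And>x. x \<in> X \<Longrightarrow> Im (T x) \<ge> \<epsilon>" "\<And>x. x \<in> X \<Longrightarrow> \<bar>Im (Z x)\<bar> \<le> A"
  shows "uniform_limit X (\<lambda>n x. \<Sum>b<n. kap m (Z x - of_nat (Suc b) * T x) + kap m (Z x + of_nat (Suc b) * T x))
    (\<lambda>x. eis_tail m (Z x) (T x)) sequentially"
proof -
  obtain C where C: "C \<ge> 0" "\<And>z \<tau> b. Im \<tau> \<ge> \<epsilon> \<Longrightarrow> \<bar>Im z\<bar> \<le> A \<Longrightarrow> real b * \<epsilon> \<ge> A + 1 \<Longrightarrow>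
     norm (kap m (z - of_nat b * \<tau>) + kap m (z + of_nat b * \<tau>)) \<le> C * exp (- 2 * pi * \<epsilon>) ^ b"
    using kap_sum_bound[OF assms(1,2), of A] by metis
  show ?thesis
    unfolding eis_tail_def
  proof (rule Weierstrass_m_test_ev)
    show "\<forall>\<^sub>F b in sequentially. \<forall>x\<in>X. norm (kap m (Z x - of_nat (Suc b) * T x) + kap m (Z x + of_nat (Suc b) * T x))
        \<le> C * exp (- 2 * pi * \<epsilon>) ^ Suc b"
    proof (rule eventually_sequentiallyI[of "nat \<lceil>(A + 1) / \<epsilon>\<rceil>"], intro ballI C(2) assms)
      fix b assume "nat \<lceil>(A + 1) / \<epsilon>\<rceil> \<le> b"
      then have "(A + 1) / \<epsilon> \<le> real (Suc b)" by linarith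
      then show "A + 1 \<le> real (Suc b) * \<epsilon>" using assms(2) by (simp add: pos_divide_le_eq)
    qed
    show "summable (\<lambda>b. C * exp (- 2 * pi * \<epsilon>) ^ Suc b)"
      using assms(2) by (intro summable_mult) (simp add: summable_geometric)
  qed
qed

lemma holomorphic_on_eis_tail:
  assumes "m \<ge> 1" "open D" "Z holomorphic_on D" "T holomorphic_on D"
    "\<And>x. x \<in> D \<Longrightarrow> Im (T x) > 0" "\<And>x. x \<in> D \<Longrightarrow> off_tail (Z x) (T x)"
  shows "(\<lambda>x. eis_tail m (Z x) (T x)) holomorphic_on D"
proof (rule holomorphic_uniform_sequence[OF assms(2)])
  fix n
  have k: "(\<lambda>x. kap m (h x)) holomorphic_on D" if "h holomorphic_on D" "\<And>x. x \<in> D \<Longrightarrow> h x \<notin> \<int>" for h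
    using holomorphic_on_compose_gen[OF that(1) holomorphic_on_kap[OF assms(1), of "- \<int>"]] that(2)
    by (auto simp: o_def)
  show "(\<lambda>x. \<Sum>b<n. kap m (Z x - of_nat (Suc b) * T x) + kap m (Z x + of_nat (Suc b) * T x)) holomorphic_on D"
    using assms(6) unfolding off_tail_def by (intro holomorphic_intros k assms(3,4)) blast+
next
  fix x assume "x \<in> D"
  then obtain d where d: "d > 0" "cball x d \<subseteq> D"
    using assms(2) open_contains_cball by blast
  have c: "continuous_on (cball x d) (\<lambda>x. Im (T x))" "continuous_on (cball x d) (\<lambda>x. \<bar>Im (Z x)\<bar>)"
    using holomorphic_on_subset[OF assms(3) d(2)] holomorphic_on_subset[OF assms(4) d(2)]
    by (auto intro!: continuous_intros holomorphic_on_imp_continuous_on)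
  \<comment> \<open>Compactness of the disc supplies the lower bound on Im \<tau> and the strip that
    \<open>uniform_limit_eis_tail\<close> asks for.\<close>
  obtain y where y: "y \<in> cball x d" "\<forall>v\<in>cball x d. Im (T y) \<le> Im (T v)"
    using continuous_attains_inf[OF _ _ c(1)] d(1) by auto
  obtain u where u: "u \<in> cball x d" "\<forall>v\<in>cball x d. \<bar>Im (Z v)\<bar> \<le> \<bar>Im (Z u)\<bar>"
    using continuous_attains_sup[OF _ _ c(2)] d(1) by auto
  have "uniform_limit (cball x d) (\<lambda>n x. \<Sum>b<n. kap m (Z x - of_nat (Suc b) * T x) + kap m (Z x + of_nat (Suc b) * T x))
     (\<lambda>x. eis_tail m (Z x) (T x)) sequentially"
    using y u d assms(5) by (intro uniform_limit_eis_tail[of m "Im (T y)" _ T Z "\<bar>Im (Z u)\<bar>"] assms(1)) auto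
  with d show "\<exists>d>0. cball x d \<subseteq> D \<and> uniform_limit (cball x d) (\<lambda>n x. \<Sum>b<n. kap m (Z x - of_nat (Suc b) * T x) + kap m (Z x + of_nat (Suc b) * T x))
     (\<lambda>x. eis_tail m (Z x) (T x)) sequentially" by blast
qed

lemma eis_tail_LIMSEQ:
  assumes "m \<ge> 1" "Im \<tau> > 0"
  shows "(\<lambda>n. \<Sum>b<n. kap m (z - of_nat (Suc b) * \<tau>) + kap m (z + of_nat (Suc b) * \<tau>)) \<longlonglongrightarrow> eis_tail m z \<tau>"
  using tendsto_uniform_limitI[OF uniform_limit_eis_tail[of m "Im \<tau>" "{z}" "\<lambda>_. \<tau>" "\<lambda>z. z" "\<bar>Im z\<bar>"], of z] assms
  by simp

lemma has_field_derivative_eis_tail: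
  assumes "m \<ge> 1" "Im \<tau> > 0" "z \<notin> lattice \<tau> - {0}"
  shows "((\<lambda>z. eis_tail m z \<tau>) has_field_derivative - of_nat m * eis_tail (Suc m) z \<tau>) (at z)"
proof -
  let ?S = "- (lattice \<tau> - {0})"
  let ?f = "\<lambda>m n z. \<Sum>b<n. kap m (z - of_nat (Suc b) * \<tau>) + kap m (z + of_nat (Suc b) * \<tau>)"
  have "\<exists>g'. \<forall>x\<in>?S. ((\<lambda>z. eis_tail m z \<tau>) has_field_derivative g' x) (at x) \<and>
     (\<lambda>n. \<Sum>b<n. - of_nat m * kap (Suc m) (x - of_nat (Suc b) * \<tau>) + - of_nat m * kap (Suc m) (x + of_nat (Suc b) * \<tau>)) \<longlonglongrightarrow> g' x"
  proof (rule has_complex_derivative_uniform_sequence)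
    show "open ?S" using open_Compl_lattice_minus_0[OF assms(2)] .
    fix n x assume "x \<in> ?S"
    then have o: "off_tail x \<tau>" using off_tailI[OF assms(2)] by blast
    have d: "((\<lambda>z. kap m (z - of_nat (Suc b) * \<tau>)) has_field_derivative - of_nat m * kap (Suc m) (x - of_nat (Suc b) * \<tau>) * (1 - 0)) (at x)"
      "((\<lambda>z. kap m (z + of_nat (Suc b) * \<tau>)) has_field_derivative - of_nat m * kap (Suc m) (x + of_nat (Suc b) * \<tau>) * (1 + 0)) (at x)" for b
      by (rule DERIV_chain2[OF has_field_derivative_kap[OF assms(1)]],
          use o in \<open>force simp: off_tail_def\<close>, intro derivative_intros)+
    show "(?f m n has_field_derivative (\<Sum>b<n. - of_nat m * kap (Suc m) (x - of_nat (Suc b) * \<tau>) + - of_nat m * kap (Suc m) (x + of_nat (Suc b) * \<tau>))) (at x)"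
      using d by (intro DERIV_sum DERIV_add) simp_all
  next
    fix x assume "x \<in> ?S"
    then obtain d where d: "d > 0" "cball x d \<subseteq> ?S"
      using open_Compl_lattice_minus_0[OF assms(2)] open_contains_cball by blast
    have "uniform_limit (cball x d) (?f m) (\<lambda>x. eis_tail m x \<tau>) sequentially"
    proof (rule uniform_limit_eis_tail[of m "Im \<tau>" _ "\<lambda>_. \<tau>" "\<lambda>z. z" "\<bar>Im x\<bar> + d"])
      fix v assume "v \<in> cball x d"
      then show "\<bar>Im v\<bar> \<le> \<bar>Im x\<bar> + d"
        using abs_Im_le_cmod[of "x - v"] by (simp add: dist_norm)
    qed (use assms in auto)
    with d show "\<exists>d>0. cball x d \<subseteq> ?S \<and> uniform_limit (cball x d) (?f m) (\<lambda>x. eis_tail m x \<tau>) sequentially" by blast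
  qed
  then obtain g' where g': "((\<lambda>z. eis_tail m z \<tau>) has_field_derivative g') (at z)"
     "(\<lambda>n. \<Sum>b<n. - of_nat m * kap (Suc m) (z - of_nat (Suc b) * \<tau>) + - of_nat m * kap (Suc m) (z + of_nat (Suc b) * \<tau>)) \<longlonglongrightarrow> g'"
    using assms(3) by blast
  have "(\<lambda>n. - of_nat m * ?f (Suc m) n z) \<longlonglongrightarrow> - of_nat m * eis_tail (Suc m) z \<tau>"
    by (intro tendsto_intros eis_tail_LIMSEQ assms) auto
  then have "g' = - of_nat m * eis_tail (Suc m) z \<tau>"
    using LIMSEQ_unique[OF g'(2)] by (simp add: sum_distrib_left distrib_left)
  with g'(1) show ?thesis by simp
qed

lemma Ints_subset_lattice: "\<int> \<subseteq> lattice \<tau>"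
proof
  fix z :: complex assume "z \<in> \<int>"
  then obtain a where "z = of_int a" by (auto elim: Ints_cases)
  then show "z \<in> lattice \<tau>" using int_comb_in_lattice[of a 0 \<tau>] by simp
qed

lemma has_field_derivative_eis_reg:
  assumes "m \<ge> 1" "Im \<tau> > 0" "z \<notin> lattice \<tau> - {0}"
  shows "((\<lambda>z. eis_reg m z \<tau>) has_field_derivative - of_nat m * eis_reg (Suc m) z \<tau>) (at z)"
proof -
  have "z \<notin> \<int> - {0}" using assms(3) Ints_subset_lattice by blast
  then show ?thesis
    unfolding eis_reg_def distrib_left
    by (intro DERIV_add has_field_derivative_kreg has_field_derivative_eis_tail assms)
qed

lemma has_field_derivative_eis_fun:
  assumes "m \<ge> 1" "Im \<tau> > 0" "z \<notin> lattice \<tau>"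
  shows "((\<lambda>z. eis_fun m z \<tau>) has_field_derivative - of_nat m * eis_fun (Suc m) z \<tau>) (at z)"
  unfolding eis_fun_def distrib_left
  by (intro DERIV_add has_field_derivative_inverse_power has_field_derivative_eis_reg assms)
     (use assms zero_in_lattice in metis, use assms in blast)

text \<open>A change of sign exchanges the two terms of each pair, so the parity survives the
  conditional summation at m = 1.\<close>

lemma eis_fun_minus:
  assumes "m \<ge> 1" "Im \<tau> > 0"
  shows "eis_fun m (- z) \<tau> = (-1) ^ m * eis_fun m z \<tau>"
proof -
  have "(\<lambda>n. (-1) ^ m * (\<Sum>b<n. kap m (z - of_nat (Suc b) * \<tau>) + kap m (z + of_nat (Suc b) * \<tau>)))
      \<longlonglongrightarrow> (-1) ^ m * eis_tail m z \<tau>"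
    by (intro tendsto_intros eis_tail_LIMSEQ assms)
  also have "(\<lambda>n. (-1) ^ m * (\<Sum>b<n. kap m (z - of_nat (Suc b) * \<tau>) + kap m (z + of_nat (Suc b) * \<tau>))) =
     (\<lambda>n. \<Sum>b<n. kap m (- z - of_nat (Suc b) * \<tau>) + kap m (- z + of_nat (Suc b) * \<tau>))"
  proof (rule ext, unfold sum_distrib_left, rule sum.cong, rule refl)
    fix b
    have "kap m (- z - of_nat (Suc b) * \<tau>) = (-1) ^ m * kap m (z + of_nat (Suc b) * \<tau>)"
      "kap m (- z + of_nat (Suc b) * \<tau>) = (-1) ^ m * kap m (z - of_nat (Suc b) * \<tau>)"
      using kap_minus[of m "z + of_nat (Suc b) * \<tau>"] kap_minus[of m "z - of_nat (Suc b) * \<tau>"] by simp_all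
    then show "(-1) ^ m * (kap m (z - of_nat (Suc b) * \<tau>) + kap m (z + of_nat (Suc b) * \<tau>)) =
       kap m (- z - of_nat (Suc b) * \<tau>) + kap m (- z + of_nat (Suc b) * \<tau>)" by (simp add: distrib_left)
  qed
  finally have "eis_tail m (- z) \<tau> = (-1) ^ m * eis_tail m z \<tau>"
    using eis_tail_LIMSEQ[OF assms, of "- z"] LIMSEQ_unique by blast
  then show ?thesis by (simp add: eis_fun_kap kap_minus distrib_left)
qed

lemma eis_fun_plus_1:
  assumes "m \<ge> 1" "Im \<tau> > 0" "z \<notin> lattice \<tau>"
  shows "eis_fun m (z + 1) \<tau> = eis_fun m z \<tau>"
proof -
  have o: "z - of_nat (Suc b) * \<tau> \<notin> \<int>" "z + of_nat (Suc b) * \<tau> \<notin> \<int>" for b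
    using off_tailI[OF assms(2), of z] assms(3) by (auto simp: off_tail_def)
  have "kap m (z + 1 - of_nat (Suc b) * \<tau>) = kap m (z - of_nat (Suc b) * \<tau>)"
    "kap m (z + 1 + of_nat (Suc b) * \<tau>) = kap m (z + of_nat (Suc b) * \<tau>)" for b
    using kap_plus_1[OF assms(1) o(1)[of b]] kap_plus_1[OF assms(1) o(2)[of b]]
    by (simp_all add: algebra_simps)
  moreover have "kap m (z + 1) = kap m z"
    using assms Ints_subset_lattice by (intro kap_plus_1) auto
  ultimately show ?thesis unfolding eis_fun_kap eis_tail_def by simp
qed

lemma kap_tendsto:
  assumes "m \<ge> 1" "Im \<tau> > 0"
  shows "(\<lambda>n. kap m (z + of_nat n * \<tau>)) \<longlonglongrightarrow> kap_limit m"
    and "(\<lambda>n. kap m (z - of_nat n * \<tau>)) \<longlonglongrightarrow> - kap_limit m"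
proof -
  show *: "(\<lambda>n. kap m (z + of_nat n * \<tau>)) \<longlonglongrightarrow> kap_limit m" for z
  proof -
    obtain C where C: "C \<ge> 0" "\<And>w. Im w \<ge> 1 \<Longrightarrow> norm (kap m w - kap_limit m) \<le> C * exp (- 2 * pi * Im w)"
      using kap_bound_upper[OF assms(1), of 1] by auto
    have im: "filterlim (\<lambda>n. Im (z + of_nat n * \<tau>)) at_top sequentially"
    proof -
      have "filterlim (\<lambda>n. Im z + Im \<tau> * real n) at_top sequentially"
        by (intro filterlim_tendsto_add_at_top[OF tendsto_const]
            filterlim_tendsto_pos_mult_at_top[OF tendsto_const assms(2)] filterlim_real_sequentially)
      then show ?thesis by (simp add: mult.commute)
    qed
    have "((\<lambda>n. exp (- (2 * pi * Im (z + of_nat n * \<tau>)))) \<longlongrightarrow> 0) sequentially"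
      by (intro filterlim_compose[OF exp_at_bot] filterlim_compose[OF filterlim_uminus_at_bot_at_top]
          filterlim_tendsto_pos_mult_at_top[OF tendsto_const _ im]) simp
    then have "(\<lambda>n. C * exp (- 2 * pi * Im (z + of_nat n * \<tau>))) \<longlonglongrightarrow> 0"
      using tendsto_mult_right_zero by fastforce
    moreover have "\<forall>\<^sub>F n in sequentially. norm (kap m (z + of_nat n * \<tau>) - kap_limit m) \<le> C * exp (- 2 * pi * Im (z + of_nat n * \<tau>))"
      using filterlim_at_top[THEN iffD1, OF im, rule_format, of 1] by eventually_elim (rule C)
    ultimately have "(\<lambda>n. kap m (z + of_nat n * \<tau>) - kap_limit m) \<longlonglongrightarrow> 0"
      by (rule Lim_null_comparison[rotated])
    then show ?thesis by (simp add: LIM_zero_iff)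
  qed
  have "(\<lambda>n. (-1) ^ m * kap m (- z + of_nat n * \<tau>)) \<longlonglongrightarrow> (-1) ^ m * kap_limit m"
    by (intro tendsto_intros *)
  moreover have "(-1) ^ m * kap m (- z + of_nat n * \<tau>) = kap m (z - of_nat n * \<tau>)" for n
    using kap_minus[of m "- z + of_nat n * \<tau>"] by simp
  ultimately show "(\<lambda>n. kap m (z - of_nat n * \<tau>)) \<longlonglongrightarrow> - kap_limit m"
    using kap_limit_minus[OF assms(1)] by simp
qed

text \<open>The shift by \<tau> moves the window -n..n of summation to -n+1..n+1. Only two boundary
  terms change, and their limits \<open>kap_limit m\<close> and \<open>- kap_limit m\<close> enter
  with opposite signs; so the quasi-period is the jump of the cotangent between the two
  ends.\<close>

lemma eis_fun_plus_tau:
  assumes "m \<ge> 1" "Im \<tau> > 0"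
  shows "eis_fun m (z + \<tau>) \<tau> = eis_fun m z \<tau> + 2 * kap_limit m"
proof -
  define F where "F = (\<lambda>z n. kap m z + (\<Sum>b<n. kap m (z - of_nat (Suc b) * \<tau>) + kap m (z + of_nat (Suc b) * \<tau>)))"
  have F: "F z \<longlonglongrightarrow> eis_fun m z \<tau>" for z
    unfolding F_def eis_fun_kap by (intro tendsto_intros eis_tail_LIMSEQ assms)
  have "F (z + \<tau>) n = F z n + kap m (z + \<tau> + of_nat n * \<tau>) - kap m (z - of_nat n * \<tau>)" for n
    by (induction n) (simp_all add: F_def algebra_simps)
  then have "F (z + \<tau>) = (\<lambda>n. F z n + kap m (z + \<tau> + of_nat n * \<tau>) - kap m (z - of_nat n * \<tau>))"
    by blast
  moreover have "\<dots> \<longlonglongrightarrow> eis_fun m z \<tau> + kap_limit m - (- kap_limit m)"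
    by (intro tendsto_intros F kap_tendsto assms)
  ultimately show ?thesis using LIMSEQ_unique[OF F[of "z + \<tau>"]] by simp
qed

lemma eis_fun_plus_int:
  assumes "m \<ge> 1" "Im \<tau> > 0" "z \<notin> lattice \<tau>"
  shows "eis_fun m (z + of_int a) \<tau> = eis_fun m z \<tau>"
proof (induction a rule: int_induct[of _ 0])
  case (step1 i)
  have "z + of_int i \<notin> lattice \<tau>"
    using assms(3) add_in_lattice_iff[OF int_comb_in_lattice[of i 0]] by simp
  from eis_fun_plus_1[OF assms(1,2) this] step1 show ?case by (simp add: add_ac)
next
  case (step2 i)
  have "z + of_int (i - 1) \<notin> lattice \<tau>"
    using assms(3) add_in_lattice_iff[OF int_comb_in_lattice[of "i - 1" 0]] by simp
  from eis_fun_plus_1[OF assms(1,2) this] step2 show ?case by (simp add: add_ac)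
qed auto

lemma eis_fun_plus_int_tau:
  assumes "m \<ge> 1" "Im \<tau> > 0"
  shows "eis_fun m (z + of_int b * \<tau>) \<tau> = eis_fun m z \<tau> + of_int b * (2 * kap_limit m)"
proof (induction b rule: int_induct[of _ 0])
  case (step1 i)
  from eis_fun_plus_tau[OF assms, of "z + of_int i * \<tau>"] step1 show ?case by (simp add: algebra_simps)
next
  case (step2 i)
  from eis_fun_plus_tau[OF assms, of "z + of_int (i - 1) * \<tau>"] step2 show ?case by (simp add: algebra_simps)
qed auto

section \<open>Lattice sums and the Weierstrass function\<close>

lemma has_sum_int_nonzero:
  fixes f :: "int \<Rightarrow> complex"
  assumes "summable (\<lambda>k. norm (f (int (Suc k))))" "summable (\<lambda>k. norm (f (- int (Suc k))))"
  shows "(f has_sum ((\<Sum>k. f (int (Suc k))) + (\<Sum>k. f (- int (Suc k))))) (UNIV - {0})"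
proof -
  have "((f \<circ> (\<lambda>k. int (Suc k))) has_sum (\<Sum>k. f (int (Suc k)))) UNIV"
    unfolding o_def by (rule norm_summable_imp_has_sum[OF assms(1) summable_sums[OF summable_norm_cancel[OF assms(1)]]])
  then have p: "(f has_sum (\<Sum>k. f (int (Suc k)))) (range (\<lambda>k. int (Suc k)))"
    by (subst has_sum_reindex) (auto simp: inj_on_def)
  have "((f \<circ> (\<lambda>k. - int (Suc k))) has_sum (\<Sum>k. f (- int (Suc k)))) UNIV"
    unfolding o_def by (rule norm_summable_imp_has_sum[OF assms(2) summable_sums[OF summable_norm_cancel[OF assms(2)]]])
  then have n: "(f has_sum (\<Sum>k. f (- int (Suc k)))) (range (\<lambda>k. - int (Suc k)))"
    by (subst has_sum_reindex) (auto simp: inj_on_def)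
  have "UNIV - {0} = range (\<lambda>k. int (Suc k)) \<union> range (\<lambda>k. - int (Suc k))"
  proof (intro set_eqI iffI)
    fix x :: int assume x: "x \<in> UNIV - {0}"
    then have "x = int (Suc (nat (x - 1))) \<or> x = - int (Suc (nat (- x - 1)))" by auto
    then show "x \<in> range (\<lambda>k. int (Suc k)) \<union> range (\<lambda>k. - int (Suc k))" by blast
  qed auto
  moreover have "range (\<lambda>k. int (Suc k)) \<inter> range (\<lambda>k. - int (Suc k)) = {}" by auto
  ultimately show ?thesis
    using has_sum_Un_disjoint[OF p n] by metis
qed

lemma has_sum_int_insert_0:
  fixes f :: "int \<Rightarrow> complex"
  assumes "(f has_sum s) (UNIV - {0})"
  shows "(f has_sum (f 0 + s)) UNIV"
proof -
  have "(f has_sum f 0) {0}" by (rule has_sum_finiteI) auto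
  from has_sum_Un_disjoint[OF this assms] show ?thesis by simp
qed

lemma summable_norm_inverse_shift_power:
  fixes z :: complex
  assumes "m \<ge> 2"
  shows "summable (\<lambda>k. norm (inverse ((z + of_nat k) ^ m)))"
proof -
  \<comment> \<open>Beyond this index the shifted term is compared with 1 / (k + 1)^m.\<close>
  define M where "M = Suc (nat \<lceil>norm z\<rceil>)"
  have "summable (\<lambda>k. norm (inverse ((z + of_nat (k + M)) ^ m)))"
  proof (rule summable_comparison_test)
    show "summable (\<lambda>k. inverse (real (Suc k)) ^ m)"
      using inverse_power_summable[OF assms, where ?'a = real] summable_Suc_iff[of "\<lambda>n. inverse (real n ^ m)"]
      by (simp add: power_inverse)
    show "\<exists>N. \<forall>k\<ge>N. norm (norm (inverse ((z + of_nat (k + M)) ^ m))) \<le> inverse (real (Suc k)) ^ m"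
    proof (intro exI allI impI)
      fix k
      have "real (Suc k) \<le> real (k + M) - norm z" unfolding M_def by linarith
      also have "\<dots> = norm (of_nat (k + M) :: complex) - norm z" by (simp only: norm_of_nat)
      also have "\<dots> \<le> norm (of_nat (k + M) + z)" by (rule norm_diff_ineq)
      finally have "real (Suc k) \<le> norm (z + of_nat (k + M))" by (simp add: add.commute)
      then have "inverse (norm (z + of_nat (k + M))) ^ m \<le> inverse (real (Suc k)) ^ m"
        by (intro power_mono le_imp_inverse_le) auto
      then show "norm (norm (inverse ((z + of_nat (k + M)) ^ m))) \<le> inverse (real (Suc k)) ^ m"
        by (simp add: norm_inverse norm_power power_inverse)
    qed
  qed
  then show ?thesis by (subst (asm) summable_iff_shift)
qed

lemma kreg_has_sum:
  assumes "m \<ge> 2" "z \<notin> \<int> - {0}"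
  shows "((\<lambda>a::int. 1 / (z + of_int a) ^ m) has_sum kreg m z) (UNIV - {0})"
proof -
  obtain k where m: "m = Suc k" "k \<noteq> 0" using assms(1) by (cases m) auto
  have P: "Polygamma k w = (-1) ^ m * fact k * (\<Sum>j. inverse ((w + of_nat j) ^ m))" for w :: complex
    using m by (simp add: Polygamma_def)
  have e1: "1 / (z + of_int (int (Suc j))) ^ m = inverse ((1 + z + of_nat j) ^ m)" for j
    by (simp add: divide_simps add_ac)
  have inv: "1 / (- w) ^ m = (-1) ^ m * inverse (w ^ m)" for w :: complex
    by (cases "even m") (auto simp: inverse_eq_divide)
  have e2: "1 / (z + of_int (- int (Suc j))) ^ m = (-1) ^ m * inverse ((1 - z + of_nat j) ^ m)" for j
    using inv[of "1 - z + of_nat j"] by (simp add: algebra_simps)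
  note s1 = summable_norm_inverse_shift_power[OF assms(1), of "1 + z"]
  have s2: "summable (\<lambda>j. norm ((-1) ^ m * inverse ((1 - z + of_nat j) ^ m)))"
    using summable_norm_inverse_shift_power[OF assms(1), of "1 - z"] by (simp add: norm_mult norm_power)
  have "((\<lambda>a::int. 1 / (z + of_int a) ^ m) has_sum
      ((\<Sum>j. 1 / (z + of_int (int (Suc j))) ^ m) + (\<Sum>j. 1 / (z + of_int (- int (Suc j))) ^ m))) (UNIV - {0})"
    by (rule has_sum_int_nonzero; unfold e1 e2) (fact s1, fact s2)
  then have "((\<lambda>a::int. 1 / (z + of_int a) ^ m) has_sum
      ((\<Sum>j. inverse ((1 + z + of_nat j) ^ m)) + (\<Sum>j. (-1) ^ m * inverse ((1 - z + of_nat j) ^ m)))) (UNIV - {0})"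
    by (simp only: e1 e2)
  moreover have "(\<Sum>j. (-1) ^ m * inverse ((1 - z + of_nat j) ^ m)) = (-1) ^ m * (\<Sum>j. inverse ((1 - z + of_nat j) ^ m))"
    by (rule suminf_mult[OF summable_norm_cancel[OF summable_norm_inverse_shift_power[OF assms(1)]]])
  moreover have "kreg m z = (\<Sum>j. inverse ((1 + z + of_nat j) ^ m)) + (-1) ^ m * (\<Sum>j. inverse ((1 - z + of_nat j) ^ m))"
    unfolding kreg_def m(1) diff_Suc_1 P[unfolded m(1)] by (cases "even k") (simp_all add: add_divide_distrib diff_divide_distrib)
  ultimately show ?thesis by simp
qed

lemma kap_has_sum:
  assumes "m \<ge> 2" "z \<notin> \<int>"
  shows "((\<lambda>a::int. 1 / (z + of_int a) ^ m) has_sum kap m z) UNIV"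
  unfolding kap_def using has_sum_int_insert_0[OF kreg_has_sum[OF assms(1), of z]] assms(2) by simp

lemma summable_norm_kap:
  assumes "m \<ge> 2" "Im \<tau> > 0"
  shows "summable (\<lambda>k. norm (kap m (z + of_nat (Suc k) * \<tau>)))"
proof -
  obtain C where C: "C \<ge> 0" "\<And>w. Im w \<ge> 1 \<Longrightarrow> norm (kap m w - kap_limit m) \<le> C * exp (- 2 * pi * Im w)"
    using kap_bound_upper[of m 1] assms by auto
  have "summable (\<lambda>k. C * exp (- 2 * pi * Im z) * exp (- 2 * pi * Im \<tau>) ^ Suc k)"
    using assms(2) by (intro summable_mult) (simp add: summable_geometric)
  moreover have "\<exists>N. \<forall>k\<ge>N. norm (norm (kap m (z + of_nat (Suc k) * \<tau>))) \<le> C * exp (- 2 * pi * Im z) * exp (- 2 * pi * Im \<tau>) ^ Suc k"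
  proof (intro exI allI impI)
    fix k assume "k \<ge> nat \<lceil>(1 - Im z) / Im \<tau>\<rceil>"
    then have "(1 - Im z) / Im \<tau> \<le> real (Suc k)" by linarith
    then have "1 \<le> Im (z + of_nat (Suc k) * \<tau>)" using assms(2) by (simp add: pos_divide_le_eq)
    from C(2)[OF this] have "norm (kap m (z + of_nat (Suc k) * \<tau>)) \<le> C * exp (- 2 * pi * Im (z + of_nat (Suc k) * \<tau>))"
      using assms by (simp add: kap_limit_def)
    also have "\<dots> = C * exp (- 2 * pi * Im z) * exp (- 2 * pi * Im \<tau>) ^ Suc k"
      by (simp only: exp_of_nat_mult[symmetric] mult.assoc exp_add[symmetric]) (simp add: algebra_simps)
    finally show "norm (norm (kap m (z + of_nat (Suc k) * \<tau>))) \<le> C * exp (- 2 * pi * Im z) * exp (- 2 * pi * Im \<tau>) ^ Suc k"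
      by simp
  qed
  ultimately show ?thesis by (rule summable_comparison_test[rotated])
qed

lemma eis_reg_has_sum:
  assumes "m \<ge> 2" "Im \<tau> > 0"
  shows "((\<lambda>b::int. if b = 0 then kreg m z else kap m (z - of_int b * \<tau>)) has_sum eis_reg m z \<tau>) UNIV"
proof -
  let ?f = "\<lambda>b::int. if b = 0 then kreg m z else kap m (z - of_int b * \<tau>)"
  have "kap m (z - of_nat (Suc k) * \<tau>) = (-1) ^ m * kap m (- z + of_nat (Suc k) * \<tau>)" for k
    using kap_minus[of m "- z + of_nat (Suc k) * \<tau>"] by simp
  then have s: "summable (\<lambda>k. norm (kap m (z - of_nat (Suc k) * \<tau>)))"
    using summable_norm_kap[OF assms, of "- z"] by (simp add: norm_mult norm_power)
  have "(?f has_sum ((\<Sum>k. kap m (z - of_nat (Suc k) * \<tau>)) + (\<Sum>k. kap m (z + of_nat (Suc k) * \<tau>)))) (UNIV - {0})"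
    using has_sum_int_nonzero[of ?f] s summable_norm_kap[OF assms, of z] by (simp del: of_nat_Suc)
  from has_sum_int_insert_0[OF this]
  show ?thesis
    using suminf_add[OF summable_norm_cancel[OF s] summable_norm_cancel[OF summable_norm_kap[OF assms, of z]]]
    by (simp add: eis_reg_def eis_tail_def del: of_nat_Suc)
qed

lemma mult_tau_notin_Ints:
  assumes "Im \<tau> > 0" "b \<noteq> 0"
  shows "of_int b * \<tau> \<notin> \<int>"
proof
  assume "of_int b * \<tau> \<in> \<int>"
  then obtain a where "of_int b * \<tau> = of_int a" by (auto elim!: Ints_cases)
  then have "Im (of_int b * \<tau>) = 0" by simp
  with assms show False by auto
qed

lemma eisenstein_inner_sum:
  assumes "m \<ge> 2" "Im \<tau> > 0"
  shows "((\<lambda>d::int. 1 / (of_int c * \<tau> + of_int d) ^ m) has_sum (if c = 0 then kreg m 0 else kap m (of_int c * \<tau>)))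
    {d. (c, d) \<noteq> (0, 0)}"
proof (cases "c = 0")
  case True
  then have e: "{d. (c, d) \<noteq> (0, 0)} = UNIV - {0}" by auto
  show ?thesis using True kreg_has_sum[OF assms(1), of 0] unfolding e by simp
next
  case False
  then have "{d. (c, d) \<noteq> (0, 0)} = UNIV" by auto
  then show ?thesis using False kap_has_sum[OF assms(1) mult_tau_notin_Ints[OF assms(2) False]] by simp
qed

text \<open>The definition sums in Eisenstein order, which is the order built into
  \<open>eis_reg\<close>, so nothing is rearranged and m = 2 is included. Evenness absorbs the sign
  of c.\<close>

lemma eisenstein_G_eq_eis_reg:
  assumes "m \<ge> 2" "even m" "Im \<tau> > 0"
  shows "eisenstein_G m \<tau> = eis_reg m 0 \<tau>"
proof -
  have "eisenstein_G m \<tau> = (\<Sum>\<^sub>\<infinity>c::int. if c = 0 then kreg m 0 else kap m (of_int c * \<tau>))"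
    unfolding eisenstein_G_def by (intro infsum_cong infsumI eisenstein_inner_sum assms)
  also have "\<dots> = (\<Sum>\<^sub>\<infinity>c::int. if c = 0 then kreg m 0 else kap m (0 - of_int c * \<tau>))"
    using kap_minus[of m] assms(2) by (intro infsum_cong) auto
  also have "\<dots> = eis_reg m 0 \<tau>"
    by (intro infsumI eis_reg_has_sum assms)
  finally show ?thesis .
qed

lemma finite_lattice_points:
  assumes "Im \<tau> > 0"
  shows "finite {p. norm (lattice_point \<tau> p) \<le> B}"
proof -
  define K where "K = \<lceil>B / Im \<tau>\<rceil>"
  define L where "L = \<lceil>B + of_int K * norm \<tau>\<rceil>"
  have "{p. norm (lattice_point \<tau> p) \<le> B} \<subseteq> {-L..L} \<times> {-K..K}"
  proof clarify
    fix a b assume h: "norm (lattice_point \<tau> (a, b)) \<le> B"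
    have "\<bar>of_int b\<bar> * Im \<tau> = \<bar>Im (lattice_point \<tau> (a, b))\<bar>"
      using assms by (simp add: lattice_point_def abs_mult)
    also have "\<dots> \<le> B" using h abs_Im_le_cmod order_trans by blast
    finally have "\<bar>of_int b\<bar> \<le> B / Im \<tau>" using assms by (simp add: pos_le_divide_eq)
    then have b: "\<bar>b\<bar> \<le> K" unfolding K_def by linarith
    have "norm (of_int a :: complex) = norm (lattice_point \<tau> (a, b) - of_int b * \<tau>)"
      by (simp add: lattice_point_def)
    also have "\<dots> \<le> B + \<bar>of_int b\<bar> * norm \<tau>"
      using norm_triangle_ineq4[of "lattice_point \<tau> (a, b)" "of_int b * \<tau>"] h by (simp add: norm_mult)
    also have "\<dots> \<le> B + of_int K * norm \<tau>" using b by (intro add_left_mono mult_right_mono) auto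
    finally have "\<bar>a\<bar> \<le> L" unfolding L_def by simp linarith
    with b show "a \<in> {-L..L} \<and> b \<in> {-K..K}" by auto
  qed
  then show ?thesis by (rule finite_subset) simp
qed

lemma lattice_point_eq_0_iff:
  assumes "Im \<tau> > 0"
  shows "lattice_point \<tau> p = 0 \<longleftrightarrow> p = (0, 0)"
proof -
  obtain a b where p: "p = (a, b)" by (cases p)
  have "Im (lattice_point \<tau> p) = of_int b * Im \<tau>" by (simp add: p lattice_point_def)
  moreover have "Re (lattice_point \<tau> p) = of_int a + of_int b * Re \<tau>" by (simp add: p lattice_point_def)
  ultimately show ?thesis using assms by (auto simp: complex_eq_iff p)
qed

text \<open>The product form is chosen so that the sum of |l|^(-3) over the lattice is dominated by
  a product of two single sums with exponent -3/2.\<close>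

lemma lattice_point_lower_bound:
  assumes "Im \<tau> > 0"
  shows "\<exists>K>0. \<forall>a b. (a, b) \<noteq> (0, 0) \<longrightarrow> (1 + \<bar>real_of_int a\<bar>) * (1 + \<bar>real_of_int b\<bar>) \<le> K * norm (lattice_point \<tau> (a, b)) ^ 2"
proof -
  \<comment> \<open>This is the constant in |a| + |b| \<le> D |l|, which follows from |b| \<le> |l|
    / Im \<tau> and the triangle inequality. As |a| + |b| \<ge> 1, both 1 + |a| and 1 + |b| are at
    most 2 D |l|.\<close>
  define D where "D = 1 + (norm \<tau> + 1) / Im \<tau>"
  have D: "D > 0" unfolding D_def using assms by (simp add: add_pos_nonneg)
  have "(1 + \<bar>real_of_int a\<bar>) * (1 + \<bar>real_of_int b\<bar>) \<le> 4 * D\<^sup>2 * norm (lattice_point \<tau> (a, b)) ^ 2"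
    if "(a, b) \<noteq> (0, 0)" for a b
  proof -
    let ?l = "lattice_point \<tau> (a, b)"
    have "\<bar>of_int b\<bar> * Im \<tau> = \<bar>Im ?l\<bar>"
      using assms by (simp add: lattice_point_def abs_mult)
    also have "\<dots> \<le> norm ?l" by (rule abs_Im_le_cmod)
    finally have b: "\<bar>of_int b\<bar> \<le> norm ?l / Im \<tau>" using assms by (simp add: pos_le_divide_eq)
    have "\<bar>real_of_int a\<bar> = norm (?l - of_int b * \<tau>)"
      by (simp add: lattice_point_def)
    also have "\<dots> \<le> norm ?l + \<bar>of_int b\<bar> * norm \<tau>"
      using norm_triangle_ineq4[of ?l "of_int b * \<tau>"] by (simp add: norm_mult)
    also have "\<dots> \<le> norm ?l + norm ?l / Im \<tau> * norm \<tau>" using b by (intro add_left_mono mult_right_mono) auto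
    finally have ab: "\<bar>real_of_int a\<bar> + \<bar>real_of_int b\<bar> \<le> D * norm ?l"
      using b by (simp add: D_def algebra_simps add_divide_distrib)
    have "1 \<le> \<bar>a\<bar> + \<bar>b\<bar>" using that by auto
    then have "1 \<le> \<bar>real_of_int a\<bar> + \<bar>real_of_int b\<bar>" by linarith
    then have "1 + \<bar>real_of_int a\<bar> \<le> 2 * (D * norm ?l)" "1 + \<bar>real_of_int b\<bar> \<le> 2 * (D * norm ?l)" using ab by linarith+
    then have "(1 + \<bar>real_of_int a\<bar>) * (1 + \<bar>real_of_int b\<bar>) \<le> (2 * (D * norm ?l)) * (2 * (D * norm ?l))"
      by (intro mult_mono) auto
    then show ?thesis by (simp add: power2_eq_square algebra_simps)
  qed
  then show ?thesis using D by (intro exI[of _ "4 * D\<^sup>2"]) auto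
qed

lemma summable_on_int_powr:
  "(\<lambda>a::int. (1 + \<bar>real_of_int a\<bar>) powr (- 3 / 2)) summable_on UNIV"
proof -
  have *: "summable (\<lambda>k. norm (complex_of_real ((1 + real (Suc k)) powr (- 3 / 2))))"
    using summable_real_powr_iff[of "- 3 / 2"] summable_iff_shift[of "\<lambda>n. real n powr (- 3 / 2)" 2]
    by (simp add: add_ac)
  have "(\<lambda>a::int. complex_of_real ((1 + \<bar>real_of_int a\<bar>) powr (- 3 / 2))) summable_on UNIV"
    by (rule has_sum_imp_summable, rule has_sum_int_insert_0, rule has_sum_int_nonzero) (use * in auto)
  from summable_on_iff_abs_summable_on_complex[THEN iffD1, OF this]
  show ?thesis by simp
qed

lemma summable_lattice_cubes:
  assumes "Im \<tau> > 0"
  shows "(\<lambda>l. 1 / norm (lattice_point \<tau> l) ^ 3) summable_on UNIV - {(0, 0)}"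
proof -
  let ?g = "\<lambda>a::int. (1 + \<bar>real_of_int a\<bar>) powr (- 3 / 2)"
  have "(\<lambda>p. norm (case p of (a, b) \<Rightarrow> ?g a * ?g b)) summable_on (UNIV \<times> UNIV)"
  proof (subst Infinite_Sum.abs_summable_on_Sigma_iff, intro conjI ballI)
    fix a show "(\<lambda>b. norm (case (a, b) of (a, b) \<Rightarrow> ?g a * ?g b)) summable_on UNIV"
      using summable_on_int_powr by (simp add: summable_on_cmult_right)
    have "(\<Sum>\<^sub>\<infinity>b. norm (case (a, b) of (a, b) \<Rightarrow> ?g a * ?g b)) = ?g a * infsum ?g UNIV" for a
      by (simp add: infsum_cmult_right')
    moreover have "infsum ?g UNIV \<ge> 0" by (intro infsum_nonneg) auto
    ultimately show "(\<lambda>a. norm (\<Sum>\<^sub>\<infinity>b. norm (case (a, b) of (a, b) \<Rightarrow> ?g a * ?g b))) summable_on UNIV"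
      using summable_on_int_powr by (simp add: summable_on_cmult_left)
  qed
  then have s: "(\<lambda>(a, b). ?g a * ?g b) summable_on UNIV" using abs_summable_summable by fastforce
  obtain K where K: "K > 0" "\<And>a b. (a, b) \<noteq> (0, 0) \<Longrightarrow>
      (1 + \<bar>real_of_int a\<bar>) * (1 + \<bar>real_of_int b\<bar>) \<le> K * norm (lattice_point \<tau> (a, b)) ^ 2"
    using lattice_point_lower_bound[OF assms] by blast
  show ?thesis
  proof (rule summable_on_comparison_test)
    show "(\<lambda>l. K powr (3 / 2) * (case l of (a, b) \<Rightarrow> ?g a * ?g b)) summable_on UNIV - {(0, 0)}"
      using s by (intro summable_on_cmult_right summable_on_subset_banach[OF s]) auto
    fix l assume l: "l \<in> UNIV - {(0::int, 0::int)}"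
    obtain a b where ab: "l = (a, b)" by (cases l)
    have n: "norm (lattice_point \<tau> l) > 0" using l lattice_point_eq_0_iff[OF assms, of l] by simp
    let ?A = "1 + \<bar>real_of_int a\<bar>" and ?B = "1 + \<bar>real_of_int b\<bar>"
    have AB: "?A > 0" "?B > 0" by linarith+
    have frac_bound: "1 / c \<le> y / x" if "x \<le> y * c" "x > 0" "c > 0" for x y c :: real
      using that by (simp add: field_simps)
    have "(?A * ?B) powr (3 / 2) \<le> (K * norm (lattice_point \<tau> l) ^ 2) powr (3 / 2)"
      using K(2)[of a b] l ab AB by (intro powr_mono2) auto
    also have "\<dots> = K powr (3 / 2) * norm (lattice_point \<tau> l) ^ 3"
    proof -
      have "(norm (lattice_point \<tau> l) ^ 2) powr (3 / 2) = (norm (lattice_point \<tau> l) powr 2) powr (3 / 2)"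
        by (simp only: powr_numeral[OF less_imp_le[OF n]])
      also have "\<dots> = norm (lattice_point \<tau> l) powr 3" unfolding powr_powr by simp
      also have "\<dots> = norm (lattice_point \<tau> l) ^ 3" by (rule powr_numeral[OF less_imp_le[OF n]])
      finally show ?thesis using K(1) by (simp add: powr_mult)
    qed
    finally have "1 / norm (lattice_point \<tau> l) ^ 3 \<le> K powr (3 / 2) / (?A * ?B) powr (3 / 2)"
      by (intro frac_bound) (use n AB in auto)
    also have "\<dots> = K powr (3 / 2) * (?g a * ?g b)"
    proof -
      have "(?A * ?B) powr (3 / 2) = ?A powr (3 / 2) * ?B powr (3 / 2)" using AB by (simp add: powr_mult)
      moreover have "?g x = inverse ((1 + \<bar>real_of_int x\<bar>) powr (3 / 2))" for x
        using powr_minus[of "1 + \<bar>real_of_int x\<bar>" "3 / 2"] by simp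
      ultimately show ?thesis by (simp only: divide_inverse inverse_mult_distrib)
    qed
    finally show "1 / norm (lattice_point \<tau> l) ^ 3 \<le> K powr (3 / 2) * (case l of (a, b) \<Rightarrow> ?g a * ?g b)"
      using ab by simp
    show "0 \<le> 1 / norm (lattice_point \<tau> l) ^ 3" by simp
  qed
qed

text \<open>The difference equals z (2 l - z) / (l^2 (z - l)^2). Here |2 l - z| \<le> 5/2 |l| and |z
  - l| \<ge> |l| / 2, which gives the factor 10.\<close>

lemma wp_term_bound:
  fixes z l :: complex
  assumes "norm l > 2 * norm z"
  shows "norm (1 / (z - l)\<^sup>2 - 1 / l\<^sup>2) \<le> 10 * norm z * (1 / norm l ^ 3)"
proof -
  have l: "l \<noteq> 0" using assms by auto
  have zl: "norm (z - l) \<ge> norm l / 2"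
    using norm_triangle_ineq3[of l z] assms norm_minus_commute[of z l] by linarith
  then have z: "z - l \<noteq> 0" using l by auto
  have "1 / (z - l)\<^sup>2 - 1 / l\<^sup>2 = z * (2 * l - z) / (l\<^sup>2 * (z - l)\<^sup>2)"
    using l z by (simp add: divide_simps) (simp add: power2_eq_square algebra_simps)
  then have "norm (1 / (z - l)\<^sup>2 - 1 / l\<^sup>2) = norm z * norm (2 * l - z) / (norm l ^ 2 * norm (z - l) ^ 2)"
    by (simp add: norm_divide norm_mult norm_power)
  also have "\<dots> \<le> norm z * (5 / 2 * norm l) / (norm l ^ 2 * (norm l / 2) ^ 2)"
  proof (intro frac_le mult_mono power_mono)
    show "norm (2 * l - z) \<le> 5 / 2 * norm l"
      using norm_triangle_ineq4[of "2 * l" z] assms by (simp add: norm_mult)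
  qed (use l zl in auto)
  also have "\<dots> = 10 * norm z * (1 / norm l ^ 3)"
    using l by (simp add: field_simps power2_eq_square power3_eq_cube)
  finally show ?thesis .
qed

lemma wp_summable:
  assumes "Im \<tau> > 0"
  shows "(\<lambda>l. 1 / (z - lattice_point \<tau> l)\<^sup>2 - 1 / (lattice_point \<tau> l)\<^sup>2) summable_on UNIV - {(0, 0)}"
    (is "?f summable_on ?S")
proof -
  let ?F = "{p. norm (lattice_point \<tau> p) \<le> 2 * norm z} \<inter> ?S"
  have fin: "finite ?F" using finite_lattice_points[OF assms] by blast
  have "(\<lambda>l. norm (?f l)) summable_on (?S - ?F)"
  proof (rule summable_on_comparison_test)
    show "(\<lambda>l. 10 * norm z * (1 / norm (lattice_point \<tau> l) ^ 3)) summable_on ?S - ?F"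
      by (intro summable_on_cmult_right summable_on_subset_banach[OF summable_lattice_cubes[OF assms]]) auto
  qed (use wp_term_bound in \<open>auto simp: not_le\<close>)
  then have "?f summable_on (?S - ?F)" by (rule abs_summable_summable)
  then have "?f summable_on (?S - ?F) \<union> ?F" by (rule summable_on_Un_disjoint) (use fin in auto)
  moreover have "(?S - ?F) \<union> ?F = ?S" by blast
  ultimately show ?thesis by metis
qed

text \<open>Absolute convergence permits summing the series of wp in Eisenstein order. In that order
  its two parts converge separately, to E_2(z) without its polar term and to G_2.\<close>

lemma weierstrass_wp_eq:
  assumes "Im \<tau> > 0" "z \<notin> lattice \<tau>"
  shows "weierstrass_wp z \<tau> = eis_fun 2 z \<tau> - eis_reg 2 0 \<tau>"
proof -
  let ?f = "\<lambda>l. 1 / (z - lattice_point \<tau> l)\<^sup>2 - 1 / (lattice_point \<tau> l)\<^sup>2"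
  let ?S = "SIGMA b:UNIV. {a::int. (b::int, a) \<noteq> (0, 0)}"
  \<comment> \<open>The outer sum must run over the coefficient of \<tau>, which is the second
    component in \<open>lattice_point\<close>.\<close>
  have bij: "bij_betw prod.swap ?S (UNIV - {(0, 0)})"
    by (rule bij_betwI[of _ _ _ prod.swap]) auto
  have "(\<lambda>p. ?f (prod.swap p)) summable_on ?S"
    using summable_on_reindex_bij_betw[OF bij, of ?f] wp_summable[OF assms(1), of z] by blast
  then have s: "(\<lambda>(b, a). ?f (a, b)) summable_on ?S" by (simp add: case_prod_unfold prod.swap_def)
  have "infsum ?f (UNIV - {(0, 0)}) = infsum (\<lambda>p. ?f (prod.swap p)) ?S"
    by (rule infsum_reindex_bij_betw[OF bij, symmetric])
  also have "\<dots> = (\<Sum>\<^sub>\<infinity>b. \<Sum>\<^sub>\<infinity>a\<in>{a. (b, a) \<noteq> (0, 0)}. ?f (a, b))"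
    using infsum_Sigma'_banach[OF s] by (simp add: case_prod_unfold prod.swap_def)
  also have "\<dots> = (\<Sum>\<^sub>\<infinity>b::int. (if b = 0 then kreg 2 z else kap 2 (z - of_int b * \<tau>)) -
      (if b = 0 then kreg 2 0 else kap 2 (0 - of_int b * \<tau>)))"
  proof (intro infsum_cong infsumI)
    fix b :: int
    \<comment> \<open>The series of wp contains z - a - b \<tau>, whereas \<open>kap\<close> sums
      over z + a; the integer a is negated to match.\<close>
    have bij: "bij_betw uminus {a::int. (b, a) \<noteq> (0, 0)} {a. (b, a) \<noteq> (0, 0)}"
      by (rule bij_betwI[of _ _ _ uminus]) auto
    have "((\<lambda>a::int. 1 / (z - of_int b * \<tau> + of_int a)\<^sup>2) has_sum
        (if b = 0 then kreg 2 z else kap 2 (z - of_int b * \<tau>))) {a. (b, a) \<noteq> (0, 0)}"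
    proof (cases "b = 0")
      case True
      then have e: "{a. (b, a) \<noteq> (0, 0)} = UNIV - {0}" by auto
      show ?thesis using True kreg_has_sum[of 2 z] assms(2) Ints_subset_lattice unfolding e by auto
    next
      case False
      then have "{a. (b, a) \<noteq> (0, 0)} = UNIV" by auto
      moreover have "z - of_int b * \<tau> \<notin> \<int>"
        using lattice_int_cases[of z "- b" \<tau>] assms(2) by auto
      ultimately show ?thesis using False kap_has_sum[of 2] by simp
    qed
    then have "((\<lambda>a::int. 1 / (z - of_int b * \<tau> + of_int (- a))\<^sup>2) has_sum
        (if b = 0 then kreg 2 z else kap 2 (z - of_int b * \<tau>))) {a. (b, a) \<noteq> (0, 0)}"
      using has_sum_reindex_bij_betw[OF bij, of "\<lambda>a. 1 / (z - of_int b * \<tau> + of_int a)\<^sup>2"] by blast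
    moreover have "((\<lambda>a::int. 1 / (of_int b * \<tau> + of_int a)\<^sup>2) has_sum
        (if b = 0 then kreg 2 0 else kap 2 (of_int b * \<tau>))) {a. (b, a) \<noteq> (0, 0)}"
      by (rule eisenstein_inner_sum) (use assms in auto)
    ultimately have "((\<lambda>a::int. 1 / (z - of_int b * \<tau> + of_int (- a))\<^sup>2 + - (1 / (of_int b * \<tau> + of_int a)\<^sup>2)) has_sum
        ((if b = 0 then kreg 2 z else kap 2 (z - of_int b * \<tau>)) +
         - (if b = 0 then kreg 2 0 else kap 2 (of_int b * \<tau>)))) {a. (b, a) \<noteq> (0, 0)}"
      by (intro has_sum_add has_sum_uminusI)
    then show "((\<lambda>a. ?f (a, b)) has_sum (if b = 0 then kreg 2 z else kap 2 (z - of_int b * \<tau>)) -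
      (if b = 0 then kreg 2 0 else kap 2 (0 - of_int b * \<tau>))) {a. (b, a) \<noteq> (0, 0)}"
      using kap_minus[of 2] by (simp add: lattice_point_def algebra_simps cong: if_cong)
  qed
  also have "\<dots> = eis_reg 2 z \<tau> - eis_reg 2 0 \<tau>"
  proof (rule infsumI)
    have "((\<lambda>b::int. (if b = 0 then kreg 2 z else kap 2 (z - of_int b * \<tau>)) +
      - (if b = 0 then kreg 2 0 else kap 2 (0 - of_int b * \<tau>))) has_sum eis_reg 2 z \<tau> + - eis_reg 2 0 \<tau>) UNIV"
      by (intro has_sum_add has_sum_uminusI eis_reg_has_sum assms(1)) auto
    then show "((\<lambda>b::int. (if b = 0 then kreg 2 z else kap 2 (z - of_int b * \<tau>)) -
      (if b = 0 then kreg 2 0 else kap 2 (0 - of_int b * \<tau>))) has_sum eis_reg 2 z \<tau> - eis_reg 2 0 \<tau>) UNIV"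
      by simp
  qed
  finally show ?thesis unfolding weierstrass_wp_def eis_fun_def by simp
qed

lemma wp_deriv_eq:
  assumes "Im \<tau> > 0" "z \<notin> lattice \<tau>"
  shows "wp_deriv s z \<tau> = (-1) ^ s * fact (Suc s) * eis_fun (s + 2) z \<tau> - (if s = 0 then eis_reg 2 0 \<tau> else 0)"
  using assms(2)
proof (induction s arbitrary: z)
  case 0
  then show ?case using weierstrass_wp_eq[OF assms(1)] by (simp add: wp_deriv_def numeral_2_eq_2)
next
  case (Suc s)
  let ?g = "\<lambda>z. (-1) ^ s * fact (Suc s) * eis_fun (s + 2) z \<tau> - (if s = 0 then eis_reg 2 0 \<tau> else 0)"
  have "\<forall>\<^sub>F v in nhds z. v \<in> - lattice \<tau>"
    using open_Compl_lattice[OF assms(1)] Suc.prems by (intro eventually_nhds_in_open) auto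
  then have "\<forall>\<^sub>F v in nhds z. wp_deriv s v \<tau> = ?g v"
    by eventually_elim (use Suc.IH in auto)
  then have "deriv (\<lambda>v. wp_deriv s v \<tau>) z = deriv ?g z"
    by (intro deriv_cong_ev) auto
  also have "\<dots> = (-1) ^ s * fact (Suc s) * (- of_nat (s + 2) * eis_fun (Suc (s + 2)) z \<tau>) - 0"
    by (intro DERIV_imp_deriv DERIV_diff DERIV_cmult has_field_derivative_eis_fun assms Suc.prems derivative_intros) auto
  also have "\<dots> = (-1) ^ Suc s * fact (Suc (Suc s)) * eis_fun (Suc s + 2) z \<tau>"
    by (simp add: algebra_simps)
  finally show ?case by (simp add: wp_deriv_def)
qed

section \<open>The action of SL2(Z) on the upper half plane and on lattices\<close>

lemma automorphy_nonzero:
  assumes "A \<in> SL2Z" "Im \<tau> > 0"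
  shows "automorphy A \<tau> \<noteq> 0"
proof
  assume h: "automorphy A \<tau> = 0"
  then have "Im (of_int (A$2$1) * \<tau> + of_int (A$2$2)) = Im 0" unfolding automorphy_def by (rule arg_cong)
  then have "of_int (A$2$1) * Im \<tau> = 0" by simp
  then have c: "A$2$1 = 0" using assms(2) by simp
  then have "A$2$2 = 0" using h by (simp add: automorphy_def)
  with c assms(1) show False by (simp add: SL2Z_def det_2)
qed

lemma Im_moebius_act_pos:
  assumes "A \<in> SL2Z" "Im \<tau> > 0"
  shows "Im (moebius_act A \<tau>) > 0"
proof -
  have j: "automorphy A \<tau> \<noteq> 0" by (rule automorphy_nonzero[OF assms])
  have det: "real_of_int (A$1$1) * of_int (A$2$2) - of_int (A$1$2) * of_int (A$2$1) = 1"
    using assms(1) unfolding SL2Z_def det_2 mem_Collect_eq by (metis of_int_1 of_int_diff of_int_mult)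
  have "Im (moebius_act A \<tau>) = Im ((of_int (A$1$1) * \<tau> + of_int (A$1$2)) * cnj (automorphy A \<tau>)) / (norm (automorphy A \<tau>))\<^sup>2"
    unfolding moebius_act_def by (simp add: complex_div_cnj[of _ "automorphy A \<tau>"])
  also have "Im ((of_int (A$1$1) * \<tau> + of_int (A$1$2)) * cnj (automorphy A \<tau>)) =
      (real_of_int (A$1$1) * of_int (A$2$2) - of_int (A$1$2) * of_int (A$2$1)) * Im \<tau>"
    by (simp add: automorphy_def algebra_simps)
  finally show ?thesis using det j assms(2) by simp
qed

text \<open>Multiplication by the automorphy factor carries the lattice of
  \<open>moebius_act A \<tau>\<close> onto that of \<tau>. This is the induced map on coordinate
  pairs for the bases 1, \<open>moebius_act A \<tau>\<close> and 1, \<tau>.\<close>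

definition lattice_change :: "int^2^2 \<Rightarrow> int \<times> int \<Rightarrow> int \<times> int" where
  "lattice_change A = (\<lambda>(a, b). (a * A$2$2 + b * A$1$2, a * A$2$1 + b * A$1$1))"

lemma lattice_point_moebius_act:
  assumes "A \<in> SL2Z" "Im \<tau> > 0"
  shows "lattice_point (moebius_act A \<tau>) p = lattice_point \<tau> (lattice_change A p) / automorphy A \<tau>"
proof -
  obtain a b where p: "p = (a, b)" by (cases p)
  show ?thesis using automorphy_nonzero[OF assms]
    unfolding lattice_point_def moebius_act_def lattice_change_def p
    by (simp add: field_simps) (simp add: automorphy_def algebra_simps)
qed

lemma bij_lattice_change:
  assumes "A \<in> SL2Z"
  shows "bij_betw (lattice_change A) (UNIV - {(0, 0)}) (UNIV - {(0, 0)})" "bij (lattice_change A)"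
proof -
  let ?f = "lattice_change A"
  \<comment> \<open>The inverse comes from the adjugate matrix, since det A = 1.\<close>
  let ?g = "\<lambda>(x, y). (x * A$1$1 - y * A$1$2, y * A$2$2 - x * A$2$1)"
  have det: "A$1$1 * A$2$2 = 1 + A$1$2 * A$2$1"
    using assms by (simp add: SL2Z_def det_2)
  have inv: "?g (?f p) = p" "?f (?g p) = p" for p
  proof -
    obtain a b where p: "p = (a, b)" by (cases p)
    have "(a * A$2$2 + b * A$1$2) * A$1$1 - (a * A$2$1 + b * A$1$1) * A$1$2 = a"
      "(a * A$2$1 + b * A$1$1) * A$2$2 - (a * A$2$2 + b * A$1$2) * A$2$1 = b"
      "(a * A$1$1 - b * A$1$2) * A$2$2 + (b * A$2$2 - a * A$2$1) * A$1$2 = a"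
      "(a * A$1$1 - b * A$1$2) * A$2$1 + (b * A$2$2 - a * A$2$1) * A$1$1 = b"
      using det by algebra+
    then show "?g (?f p) = p" "?f (?g p) = p" by (simp_all add: p lattice_change_def)
  qed
  have z: "?f (0, 0) = (0, 0)" "?g (0, 0) = (0, 0)" by (simp_all add: lattice_change_def)
  have z': "?f p \<noteq> (0, 0)" "?g p \<noteq> (0, 0)" if "p \<noteq> (0, 0)" for p
    using inv[of p] z that by metis+
  show "bij_betw ?f (UNIV - {(0, 0)}) (UNIV - {(0, 0)})"
    by (rule bij_betw_byWitness[where f' = ?g]; use inv z' in \<open>simp del: split_paired_All add: image_subset_iff\<close>)
  show "bij ?f"
    by (rule bij_betw_byWitness[where f' = ?g]; use inv in \<open>simp del: split_paired_All add: image_subset_iff\<close>)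
qed

lemma lattice_moebius_act:
  assumes "A \<in> SL2Z" "Im \<tau> > 0"
  shows "z / automorphy A \<tau> \<in> lattice (moebius_act A \<tau>) \<longleftrightarrow> z \<in> lattice \<tau>"
proof -
  let ?f = "lattice_change A"
  have "lattice_point (moebius_act A \<tau>) p = lattice_point \<tau> (?f p) / automorphy A \<tau>" for p
    by (rule lattice_point_moebius_act[OF assms])
  then have "lattice (moebius_act A \<tau>) = (\<lambda>l. l / automorphy A \<tau>) ` lattice_point \<tau> ` range ?f"
    by (simp add: image_image)
  also have "range ?f = UNIV" using bij_lattice_change(2)[OF assms(1)] by (rule bij_is_surj)
  finally show ?thesis using automorphy_nonzero[OF assms] by (auto simp: image_iff)
qed

text \<open>The sum is over an unordered index set, so it may be reindexed by
  \<open>lattice_change A\<close>; each term is homogeneous of degree -2.\<close>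

lemma weierstrass_wp_moebius_act:
  assumes "A \<in> SL2Z" "Im \<tau> > 0"
  shows "weierstrass_wp (z / automorphy A \<tau>) (moebius_act A \<tau>) = (automorphy A \<tau>)\<^sup>2 * weierstrass_wp z \<tau>"
proof -
  let ?j = "automorphy A \<tau>"
  let ?f = "lattice_change A"
  let ?t = "\<lambda>l. 1 / (z - lattice_point \<tau> l)\<^sup>2 - 1 / (lattice_point \<tau> l)\<^sup>2"
  have j: "?j \<noteq> 0" by (rule automorphy_nonzero[OF assms])
  have l: "lattice_point (moebius_act A \<tau>) p = lattice_point \<tau> (?f p) / automorphy A \<tau>" for p
    by (rule lattice_point_moebius_act[OF assms])
  have "1 / (z / ?j - lattice_point (moebius_act A \<tau>) p)\<^sup>2 - 1 / (lattice_point (moebius_act A \<tau>) p)\<^sup>2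
     = ?j\<^sup>2 * ?t (?f p)" for p
    unfolding l by (simp add: right_diff_distrib power_divide flip: diff_divide_distrib)
  then have "(\<Sum>\<^sub>\<infinity>p\<in>UNIV - {(0, 0)}. 1 / (z / ?j - lattice_point (moebius_act A \<tau>) p)\<^sup>2 - 1 / (lattice_point (moebius_act A \<tau>) p)\<^sup>2)
     = ?j\<^sup>2 * infsum ?t (UNIV - {(0, 0)})"
    using infsum_reindex_bij_betw[OF bij_lattice_change(1)[OF assms(1)], of ?t] by (simp add: infsum_cmult_right')
  then show ?thesis unfolding weierstrass_wp_def by (simp add: power_divide distrib_left)
qed

section \<open>Modular transformation laws\<close>

(* With K = 2 pi i c / (c tau + d), the failure of E_m to be modular. *)
definition eis_corr :: "nat \<Rightarrow> complex \<Rightarrow> complex \<Rightarrow> complex" where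
  "eis_corr m K z = (if m = 1 then K * z else if m = 2 then - K else 0)"

lemma half_period_notin_lattice:
  assumes "Im \<tau> > 0"
  shows "\<tau> / 2 \<notin> lattice \<tau>"
proof
  assume "\<tau> / 2 \<in> lattice \<tau>"
  then have "(1 / 2 :: real) \<in> \<int>"
    using assms unfolding mem_lattice_coords[OF assms] by simp
  then show False using fraction_not_in_Ints[where 'a = real, of 2 1] by simp
qed

lemma eis_fun_1_moebius_act:
  assumes "A \<in> SL2Z" "Im \<tau> > 0" "z \<notin> lattice \<tau>"
  shows "eis_fun 1 (z / automorphy A \<tau>) (moebius_act A \<tau>) =
    automorphy A \<tau> * (eis_fun 1 z \<tau> + 2 * of_real pi * \<i> * of_int (A$2$1) / automorphy A \<tau> * z)"
proof -
  let ?j = "automorphy A \<tau>" and ?t = "moebius_act A \<tau>"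
  have j: "?j \<noteq> 0" by (rule automorphy_nonzero[OF assms(1,2)])
  have t: "Im ?t > 0" by (rule Im_moebius_act_pos[OF assms(1,2)])
  have lat: "v / ?j \<notin> lattice ?t" if "v \<notin> lattice \<tau>" for v
    using lattice_moebius_act[OF assms(1,2)] that by simp
  define D where "D = (\<lambda>z. eis_fun 1 (z / ?j) ?t / ?j - eis_fun 1 z \<tau>)"
  \<comment> \<open>This is the still unknown defect of G_2 under A; no transformation law of G_2 is
    presupposed. It is the constant slope of \<open>D\<close>, because E_2 - G_2 = wp is
    invariant.\<close>
  define \<delta> where "\<delta> = eis_reg 2 0 \<tau> - eis_reg 2 0 ?t / ?j\<^sup>2"
  have der: "((\<lambda>z. D z - \<delta> * z) has_field_derivative 0) (at z)" if z: "z \<notin> lattice \<tau>" for z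
  proof -
    have "((\<lambda>z. eis_fun 1 (z / ?j) ?t) has_field_derivative - of_nat 1 * eis_fun (Suc 1) (z / ?j) ?t * (1 / ?j)) (at z)"
      by (rule DERIV_chain2[of "\<lambda>z. eis_fun 1 z ?t"], rule has_field_derivative_eis_fun[OF _ t lat[OF z]])
         (use j in \<open>auto intro!: derivative_eq_intros\<close>)
    then have "((\<lambda>z. D z - \<delta> * z) has_field_derivative - of_nat 1 * eis_fun (Suc 1) (z / ?j) ?t * (1 / ?j) / ?j
        - (- of_nat 1 * eis_fun (Suc 1) z \<tau>) - \<delta> * 1) (at z)"
      unfolding D_def
      by (intro DERIV_diff DERIV_cdivide has_field_derivative_eis_fun assms z DERIV_cmult DERIV_ident) auto
    moreover have "eis_fun 2 (z / ?j) ?t - eis_reg 2 0 ?t = ?j\<^sup>2 * (eis_fun 2 z \<tau> - eis_reg 2 0 \<tau>)"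
      using weierstrass_wp_moebius_act[OF assms(1,2), of z]
      unfolding weierstrass_wp_eq[OF assms(2) z] weierstrass_wp_eq[OF t lat[OF z]] .
    then have "eis_fun 2 (z / ?j) ?t = ?j\<^sup>2 * (eis_fun 2 z \<tau> - eis_reg 2 0 \<tau>) + eis_reg 2 0 ?t" by (simp add: algebra_simps)
    then have "- of_nat 1 * eis_fun (Suc 1) (z / ?j) ?t * (1 / ?j) / ?j
        - (- of_nat 1 * eis_fun (Suc 1) z \<tau>) - \<delta> * 1 = 0"
    proof -
      have "- of_nat 1 * (j\<^sup>2 * (a - b) + c) * (1 / j) / j - (- of_nat 1 * a) - (b - c / j\<^sup>2) * 1 = 0"
        if "j \<noteq> 0" for a b c j :: complex
        using that by (simp add: field_simps power2_eq_square)
      from this[OF j] show ?thesis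
        unfolding Suc_1 \<delta>_def \<open>eis_fun 2 (z / ?j) ?t = _\<close> by blast
    qed
    ultimately show ?thesis by simp
  qed
  obtain C where C: "\<And>z. z \<notin> lattice \<tau> \<Longrightarrow> D z - \<delta> * z = C"
  proof (rule DERIV_zero_connected_constant[of "- lattice \<tau>" "{}" "\<lambda>z. D z - \<delta> * z"])
    show "continuous_on (- lattice \<tau>) (\<lambda>z. D z - \<delta> * z)"
      by (intro continuous_at_imp_continuous_on ballI DERIV_isCont[OF der]) auto
  qed (use der connected_Compl_lattice open_Compl_lattice[OF assms(2)] in auto)
  have odd: "D (- z) = - D z" for z
    using eis_fun_minus[of 1 ?t "z / ?j"] eis_fun_minus[of 1 \<tau> z] t assms(2) unfolding D_def by simp
  \<comment> \<open>Oddness is evaluated at the half periods \<tau> / 2 and -\<tau> / 2, which both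
    avoid the lattice; it forces the additive constant to vanish.\<close>
  have "C + C = (D (\<tau> / 2) - \<delta> * (\<tau> / 2)) + (D (- (\<tau> / 2)) - \<delta> * (- (\<tau> / 2)))"
    using C[of "\<tau> / 2"] C[of "- (\<tau> / 2)"] half_period_notin_lattice[OF assms(2)] by simp
  also have "\<dots> = 0" unfolding odd by simp
  finally have C0: "C = 0" by simp
  \<comment> \<open>The factor c \<tau> + d is itself a period of \<tau>, and division by it turns
    it into 1. Shifting z by it is thus invisible in the first term of \<open>D\<close>, while the
    second contributes c quasi-periods; this determines \<delta>.\<close>
  have jl: "?j \<in> lattice \<tau>"
    unfolding automorphy_def using int_comb_in_lattice[of "A$2$2" "A$2$1"] by (simp add: add.commute)
  have zj: "z + ?j \<notin> lattice \<tau>" using add_in_lattice_iff[OF jl] assms(3) by simp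
  have "(z + ?j) / ?j = z / ?j + 1" using j by (simp add: field_simps)
  then have e1: "eis_fun 1 ((z + ?j) / ?j) ?t = eis_fun 1 (z / ?j) ?t"
    using eis_fun_plus_1[OF _ t lat[OF assms(3)], of 1] by simp
  have zc: "z + of_int (A$2$1) * \<tau> \<notin> lattice \<tau>"
    using add_in_lattice_iff[of "of_int (A$2$1) * \<tau>" \<tau> z] int_comb_in_lattice[of 0 "A$2$1" \<tau>] assms(3) by simp
  have "eis_fun 1 (z + ?j) \<tau> = eis_fun 1 (z + of_int (A$2$1) * \<tau> + of_int (A$2$2)) \<tau>"
    by (simp add: automorphy_def add_ac)
  also have "\<dots> = eis_fun 1 (z + of_int (A$2$1) * \<tau>) \<tau>"
    by (rule eis_fun_plus_int[OF _ assms(2) zc]) simp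
  also have "\<dots> = eis_fun 1 z \<tau> + of_int (A$2$1) * (2 * kap_limit 1)"
    by (rule eis_fun_plus_int_tau[OF _ assms(2)]) simp
  finally have "D (z + ?j) - D z = 2 * of_real pi * \<i> * of_int (A$2$1)"
    unfolding D_def e1 by (simp add: kap_limit_def)
  moreover have "D (z + ?j) - D z = \<delta> * ?j"
    using C[OF zj] C[OF assms(3)] by (simp add: algebra_simps)
  ultimately have "\<delta> = 2 * of_real pi * \<i> * of_int (A$2$1) / ?j" using j by (simp add: field_simps)
  moreover have "D z = \<delta> * z" using C[OF assms(3)] C0 by simp
  ultimately show ?thesis using j unfolding D_def by (simp add: field_simps)
qed

text \<open>Repeated differentiation of the law for E_1: the correction \<open>eis_corr m K\<close>
  obeys the same rule f_m' = -m f_(m+1) as E_m itself.\<close>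

lemma eis_fun_moebius_act:
  assumes "A \<in> SL2Z" "Im \<tau> > 0" "z \<notin> lattice \<tau>" "m \<ge> 1"
  shows "eis_fun m (z / automorphy A \<tau>) (moebius_act A \<tau>) =
    automorphy A \<tau> ^ m * (eis_fun m z \<tau> + eis_corr m (2 * of_real pi * \<i> * of_int (A$2$1) / automorphy A \<tau>) z)"
  using assms(4,3)
proof (induction m arbitrary: z rule: nat_induct_at_least)
  case base
  then show ?case using eis_fun_1_moebius_act[OF assms(1,2)] by (simp add: eis_corr_def)
next
  case (Suc m)
  let ?j = "automorphy A \<tau>" and ?t = "moebius_act A \<tau>"
  let ?K = "2 * of_real pi * \<i> * of_int (A$2$1) / automorphy A \<tau>"
  have j: "?j \<noteq> 0" by (rule automorphy_nonzero[OF assms(1,2)])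
  have t: "Im ?t > 0" by (rule Im_moebius_act_pos[OF assms(1,2)])
  have lat: "z / ?j \<notin> lattice ?t" using lattice_moebius_act[OF assms(1,2)] Suc.prems by simp
  have m0: "of_nat m \<noteq> (0::complex)" using Suc.hyps by simp
  have d1: "((\<lambda>z. eis_fun m (z / ?j) ?t) has_field_derivative - of_nat m * eis_fun (Suc m) (z / ?j) ?t * (1 / ?j)) (at z)"
    by (rule DERIV_chain2[of "\<lambda>z. eis_fun m z ?t"], rule has_field_derivative_eis_fun[OF Suc.hyps t lat])
       (use j in \<open>auto intro!: derivative_eq_intros\<close>)
  have dc: "(eis_corr m ?K has_field_derivative - of_nat m * eis_corr (Suc m) ?K z) (at z)"
    using Suc.hyps by (cases "m = 1") (auto simp: eis_corr_def[abs_def] intro!: derivative_eq_intros)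
  have d2: "((\<lambda>z. ?j ^ m * (eis_fun m z \<tau> + eis_corr m ?K z)) has_field_derivative
      ?j ^ m * (- of_nat m * eis_fun (Suc m) z \<tau> + - of_nat m * eis_corr (Suc m) ?K z)) (at z)"
    by (intro DERIV_cmult DERIV_add has_field_derivative_eis_fun dc assms Suc.hyps Suc.prems)
  have "\<forall>\<^sub>F v in nhds z. v \<in> - lattice \<tau>"
    using open_Compl_lattice[OF assms(2)] Suc.prems by (intro eventually_nhds_in_open) auto
  then have "\<forall>\<^sub>F v in nhds z. eis_fun m (v / ?j) ?t = ?j ^ m * (eis_fun m v \<tau> + eis_corr m ?K v)"
    by eventually_elim (use Suc.IH in auto)
  then have "deriv (\<lambda>v. eis_fun m (v / ?j) ?t) z = deriv (\<lambda>v. ?j ^ m * (eis_fun m v \<tau> + eis_corr m ?K v)) z"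
    by (intro deriv_cong_ev) auto
  then have "- of_nat m * eis_fun (Suc m) (z / ?j) ?t * (1 / ?j) =
     ?j ^ m * (- of_nat m * eis_fun (Suc m) z \<tau> + - of_nat m * eis_corr (Suc m) ?K z)"
    unfolding DERIV_imp_deriv[OF d1] DERIV_imp_deriv[OF d2] .
  then have "- of_nat m * eis_fun (Suc m) (z / ?j) ?t = - of_nat m * (?j ^ Suc m * (eis_fun (Suc m) z \<tau> + eis_corr (Suc m) ?K z))"
    using j by (simp add: field_simps)
  then show ?case using m0 by simp
qed

lemma eventually_at_0_off_lattice:
  assumes "Im \<tau> > 0"
  shows "\<forall>\<^sub>F z in at 0. z \<notin> lattice \<tau>"
  using eventually_at_in_open[OF open_Compl_lattice_minus_0[OF assms], of 0] by (auto elim: eventually_mono)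

text \<open>The polar term 1 / z^m is homogeneous, so it drops out of the law for E_m; then z tends
  to 0. For m = 2 this is the law of G_2.\<close>

lemma eis_reg_moebius_act:
  assumes "A \<in> SL2Z" "Im \<tau> > 0" "m \<ge> 1"
  shows "eis_reg m 0 (moebius_act A \<tau>) =
    automorphy A \<tau> ^ m * (eis_reg m 0 \<tau> + eis_corr m (2 * of_real pi * \<i> * of_int (A$2$1) / automorphy A \<tau>) 0)"
proof -
  let ?j = "automorphy A \<tau>" and ?t = "moebius_act A \<tau>"
  let ?K = "2 * of_real pi * \<i> * of_int (A$2$1) / automorphy A \<tau>"
  have j: "?j \<noteq> 0" by (rule automorphy_nonzero[OF assms(1,2)])
  have t: "Im ?t > 0" by (rule Im_moebius_act_pos[OF assms(1,2)])
  have c1: "((\<lambda>v. eis_reg m (v / ?j) ?t) \<longlongrightarrow> eis_reg m (0 / ?j) ?t) (at 0)"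
    using DERIV_isCont[OF has_field_derivative_eis_reg[OF assms(3) t, of 0]] j
    by (intro isCont_tendsto_compose[of _ "\<lambda>v. eis_reg m v ?t"] tendsto_intros) auto
  have c2: "((\<lambda>v. eis_reg m v \<tau>) \<longlongrightarrow> eis_reg m 0 \<tau>) (at 0)"
    using DERIV_isCont[OF has_field_derivative_eis_reg[OF assms(3,2), of 0]] by (simp add: isCont_def)
  have c3: "(eis_corr m ?K \<longlongrightarrow> eis_corr m ?K 0) (at 0)"
  proof -
    have "((\<lambda>z. ?K * z) \<longlongrightarrow> ?K * 0) (at 0)" by (intro tendsto_intros)
    then show ?thesis by (auto simp: eis_corr_def[abs_def])
  qed
  have "\<forall>\<^sub>F v in at 0. eis_reg m (v / ?j) ?t = ?j ^ m * (eis_reg m v \<tau> + eis_corr m ?K v)"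
    using eventually_at_0_off_lattice[OF assms(2)]
  proof eventually_elim
    case (elim v)
    from eis_fun_moebius_act[OF assms(1,2) elim assms(3)] j
    show ?case by (simp add: eis_fun_def power_divide distrib_left)
  qed
  moreover have "((\<lambda>v. ?j ^ m * (eis_reg m v \<tau> + eis_corr m ?K v)) \<longlongrightarrow> ?j ^ m * (eis_reg m 0 \<tau> + eis_corr m ?K 0)) (at 0)"
    by (intro tendsto_intros c2 c3)
  ultimately have "((\<lambda>v. eis_reg m (v / ?j) ?t) \<longlongrightarrow> ?j ^ m * (eis_reg m 0 \<tau> + eis_corr m ?K 0)) (at 0)"
    by (simp add: tendsto_cong)
  from tendsto_unique[OF _ c1 this] show ?thesis by simp
qed

section \<open>The filtered algebra of quasi-modular forms\<close>

lemma quasimodular_of_depth_mono: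
  assumes "quasimodular_of_depth \<Gamma> w p f" "p \<le> q"
  shows "\<exists>F. F 0 = f \<and> (\<forall>i. F i holomorphic_on upper_half) \<and> (\<forall>i>p. F i = (\<lambda>_. 0)) \<and>
    (\<forall>A\<in>\<Gamma>. \<forall>\<tau>\<in>upper_half. automorphy A \<tau> powi (-w) * f (moebius_act A \<tau>) =
           (\<Sum>i\<le>q. F i \<tau> * (of_int (A$2$1) / automorphy A \<tau>) ^ i))"
proof -
  from assms(1) obtain F where F: "F 0 = f" "\<forall>i\<le>p. F i holomorphic_on upper_half"
    "\<forall>A\<in>\<Gamma>. \<forall>\<tau>\<in>upper_half. automorphy A \<tau> powi (-w) * f (moebius_act A \<tau>) =
           (\<Sum>i\<le>p. F i \<tau> * (of_int (A$2$1) / automorphy A \<tau>) ^ i)"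
    unfolding quasimodular_of_depth_def by auto
  \<comment> \<open>Padding by zero gives two forms a common depth for sums, and makes the
    coefficients beyond the depth vanish, as the product of polynomials requires.\<close>
  let ?G = "\<lambda>i. if i \<le> p then F i else (\<lambda>_. 0)"
  have "(\<Sum>i\<le>q. ?G i \<tau> * x ^ i) = (\<Sum>i\<le>p. F i \<tau> * x ^ i)" for \<tau> x
    using assms(2) by (intro sum.mono_neutral_cong_right) auto
  then show ?thesis using F by (intro exI[of _ ?G]) auto
qed

lemma QMod_zero: "(\<lambda>_. 0) \<in> QMod \<Gamma> w"
  unfolding QMod_def quasimodular_of_depth_def by (auto intro!: exI[of _ "\<lambda>_ _. 0"])

lemma QMod_const: "(\<lambda>_. c) \<in> QMod \<Gamma> 0"
  unfolding QMod_def quasimodular_of_depth_def mem_Collect_eq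
  by (intro exI[of _ 0] exI[of _ "\<lambda>_ _. c"]) auto

lemma QMod_add:
  assumes "f \<in> QMod \<Gamma> w" "g \<in> QMod \<Gamma> w"
  shows "(\<lambda>\<tau>. f \<tau> + g \<tau>) \<in> QMod \<Gamma> w"
proof -
  from assms obtain p q where pq: "quasimodular_of_depth \<Gamma> w p f" "quasimodular_of_depth \<Gamma> w q g"
    unfolding QMod_def by auto
  obtain F where F: "F 0 = f" "\<And>i. F i holomorphic_on upper_half"
    "\<forall>A\<in>\<Gamma>. \<forall>\<tau>\<in>upper_half. automorphy A \<tau> powi (-w) * f (moebius_act A \<tau>) =
           (\<Sum>i\<le>p + q. F i \<tau> * (of_int (A$2$1) / automorphy A \<tau>) ^ i)"
    using quasimodular_of_depth_mono[OF pq(1), of "p + q"] by auto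
  obtain G where G: "G 0 = g" "\<And>i. G i holomorphic_on upper_half"
    "\<forall>A\<in>\<Gamma>. \<forall>\<tau>\<in>upper_half. automorphy A \<tau> powi (-w) * g (moebius_act A \<tau>) =
           (\<Sum>i\<le>p + q. G i \<tau> * (of_int (A$2$1) / automorphy A \<tau>) ^ i)"
    using quasimodular_of_depth_mono[OF pq(2), of "p + q"] by auto
  have "quasimodular_of_depth \<Gamma> w (p + q) (\<lambda>\<tau>. f \<tau> + g \<tau>)"
    unfolding quasimodular_of_depth_def using F G
    by (intro exI[of _ "\<lambda>i \<tau>. F i \<tau> + G i \<tau>"])
       (auto intro!: holomorphic_intros simp: distrib_left distrib_right sum.distrib)
  then show ?thesis unfolding QMod_def by blast
qed

text \<open>Both laws are polynomials in c / (c \<tau> + d); the Cauchy product of their coefficient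
  functions is the expansion of the product.\<close>

lemma QMod_mult:
  assumes "f \<in> QMod \<Gamma> v" "g \<in> QMod \<Gamma> w" "\<Gamma> \<subseteq> SL2Z"
  shows "(\<lambda>\<tau>. f \<tau> * g \<tau>) \<in> QMod \<Gamma> (v + w)"
proof -
  from assms obtain p q where pq: "quasimodular_of_depth \<Gamma> v p f" "quasimodular_of_depth \<Gamma> w q g"
    unfolding QMod_def by auto
  obtain F where F: "F 0 = f" "\<And>i. F i holomorphic_on upper_half" "\<And>i. i > p \<Longrightarrow> F i = (\<lambda>_. 0)"
    "\<forall>A\<in>\<Gamma>. \<forall>\<tau>\<in>upper_half. automorphy A \<tau> powi (-v) * f (moebius_act A \<tau>) =
           (\<Sum>i\<le>p. F i \<tau> * (of_int (A$2$1) / automorphy A \<tau>) ^ i)"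
    using quasimodular_of_depth_mono[OF pq(1), of p] by auto
  obtain G where G: "G 0 = g" "\<And>i. G i holomorphic_on upper_half" "\<And>i. i > q \<Longrightarrow> G i = (\<lambda>_. 0)"
    "\<forall>A\<in>\<Gamma>. \<forall>\<tau>\<in>upper_half. automorphy A \<tau> powi (-w) * g (moebius_act A \<tau>) =
           (\<Sum>i\<le>q. G i \<tau> * (of_int (A$2$1) / automorphy A \<tau>) ^ i)"
    using quasimodular_of_depth_mono[OF pq(2), of q] by auto
  have "quasimodular_of_depth \<Gamma> (v + w) (p + q) (\<lambda>\<tau>. f \<tau> * g \<tau>)"
    unfolding quasimodular_of_depth_def
  proof (intro exI[of _ "\<lambda>i \<tau>. \<Sum>k\<le>i. F k \<tau> * G (i - k) \<tau>"] conjI allI impI ballI)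
    fix A \<tau> assume A: "A \<in> \<Gamma>" and \<tau>: "\<tau> \<in> upper_half"
    let ?x = "of_int (A$2$1) / automorphy A \<tau>"
    have "automorphy A \<tau> \<noteq> 0" using A \<tau> assms(3) automorphy_nonzero by (auto simp: upper_half_def)
    then have "automorphy A \<tau> powi (- (v + w)) * (f (moebius_act A \<tau>) * g (moebius_act A \<tau>)) =
       (automorphy A \<tau> powi (-v) * f (moebius_act A \<tau>)) * (automorphy A \<tau> powi (-w) * g (moebius_act A \<tau>))"
      using power_int_add[of "automorphy A \<tau>" "-v" "-w"] by (simp add: mult_ac)
    also have "\<dots> = (\<Sum>i\<le>p. F i \<tau> * ?x ^ i) * (\<Sum>i\<le>q. G i \<tau> * ?x ^ i)"
      using F(4) G(4) A \<tau> by simp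
    also have "\<dots> = (\<Sum>i\<le>p + q. (\<Sum>k\<le>i. F k \<tau> * G (i - k) \<tau>) * ?x ^ i)"
      using F(3) G(3) by (intro polynomial_product) auto
    finally show "automorphy A \<tau> powi (- (v + w)) * (f (moebius_act A \<tau>) * g (moebius_act A \<tau>)) =
       (\<Sum>i\<le>p + q. (\<Sum>k\<le>i. F k \<tau> * G (i - k) \<tau>) * ?x ^ i)" .
  qed (use F G in \<open>auto intro!: holomorphic_intros\<close>)
  then show ?thesis unfolding QMod_def by blast
qed

lemma QMod_leI:
  assumes "f \<in> QMod \<Gamma> v" "v \<le> w"
  shows "f \<in> QMod_le \<Gamma> w"
  unfolding QMod_le_def using assms by (auto intro!: exI[of _ "{v}"] exI[of _ "\<lambda>_. f"])

lemma QMod_leE: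
  assumes "f \<in> QMod_le \<Gamma> w"
  obtains W g where "finite W" "W \<subseteq> {..w}" "\<And>v. v \<in> W \<Longrightarrow> g v \<in> QMod \<Gamma> v"
    "\<And>\<tau>. \<tau> \<in> upper_half \<Longrightarrow> f \<tau> = (\<Sum>v\<in>W. g v \<tau>)"
  using assms unfolding QMod_le_def mem_Collect_eq by meson

lemma QMod_le_cong:
  assumes "f \<in> QMod_le \<Gamma> w" "\<And>\<tau>. Im \<tau> > 0 \<Longrightarrow> g \<tau> = f \<tau>"
  shows "g \<in> QMod_le \<Gamma> w"
  using assms unfolding QMod_le_def upper_half_def by auto

lemma QMod_le_const: "w \<ge> 0 \<Longrightarrow> (\<lambda>_. c) \<in> QMod_le \<Gamma> w"
  by (rule QMod_leI[OF QMod_const])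

lemma QMod_le_zero: "(\<lambda>_. 0) \<in> QMod_le \<Gamma> w"
  by (rule QMod_leI[OF QMod_zero order.refl])

lemma QMod_le_add:
  assumes "f \<in> QMod_le \<Gamma> w" "g \<in> QMod_le \<Gamma> w"
  shows "(\<lambda>\<tau>. f \<tau> + g \<tau>) \<in> QMod_le \<Gamma> w"
proof -
  obtain V F where F: "finite V" "V \<subseteq> {..w}" "\<And>v. v \<in> V \<Longrightarrow> F v \<in> QMod \<Gamma> v"
    "\<And>\<tau>. \<tau> \<in> upper_half \<Longrightarrow> f \<tau> = (\<Sum>v\<in>V. F v \<tau>)" by (rule QMod_leE[OF assms(1)], rule that) blast+
  obtain W G where G: "finite W" "W \<subseteq> {..w}" "\<And>v. v \<in> W \<Longrightarrow> G v \<in> QMod \<Gamma> v"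
    "\<And>\<tau>. \<tau> \<in> upper_half \<Longrightarrow> g \<tau> = (\<Sum>v\<in>W. G v \<tau>)" by (rule QMod_leE[OF assms(2)], rule that) blast+
  \<comment> \<open>The families are extended by 0 to a common set of weights; the zero function
    belongs to every weight.\<close>
  let ?F = "\<lambda>v \<tau>. if v \<in> V then F v \<tau> else 0" and ?G = "\<lambda>v \<tau>. if v \<in> W then G v \<tau> else 0"
  have FG: "?F v \<in> QMod \<Gamma> v" "?G v \<in> QMod \<Gamma> v" for v
    using F(3)[of v] G(3)[of v] QMod_zero by (cases "v \<in> V"; cases "v \<in> W"; simp)+
  have "f \<tau> + g \<tau> = (\<Sum>v\<in>V \<union> W. ?F v \<tau> + ?G v \<tau>)" if "\<tau> \<in> upper_half" for \<tau>
  proof -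
    have "(\<Sum>v\<in>V \<union> W. ?F v \<tau>) = (\<Sum>v\<in>V. F v \<tau>)" "(\<Sum>v\<in>V \<union> W. ?G v \<tau>) = (\<Sum>v\<in>W. G v \<tau>)"
      using F(1) G(1) by (intro sum.mono_neutral_cong_right; auto)+
    then show ?thesis using F(4) G(4) that by (simp add: sum.distrib)
  qed
  then show ?thesis
    unfolding QMod_le_def using F(1,2) G(1,2) QMod_add[OF FG]
    by (auto intro!: exI[of _ "V \<union> W"] exI[of _ "\<lambda>v \<tau>. ?F v \<tau> + ?G v \<tau>"])
qed

lemma QMod_le_sum:
  assumes "\<And>i. i \<in> I \<Longrightarrow> f i \<in> QMod_le \<Gamma> w"
  shows "(\<lambda>\<tau>. \<Sum>i\<in>I. f i \<tau>) \<in> QMod_le \<Gamma> w"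
  using assms by (induction I rule: infinite_finite_induct) (auto intro: QMod_le_zero QMod_le_add)

lemma QMod_le_mult:
  assumes "f \<in> QMod_le \<Gamma> v" "g \<in> QMod_le \<Gamma> w" "\<Gamma> \<subseteq> SL2Z"
  shows "(\<lambda>\<tau>. f \<tau> * g \<tau>) \<in> QMod_le \<Gamma> (v + w)"
proof -
  obtain V F where F: "finite V" "V \<subseteq> {..v}" "\<And>v. v \<in> V \<Longrightarrow> F v \<in> QMod \<Gamma> v"
    "\<And>\<tau>. \<tau> \<in> upper_half \<Longrightarrow> f \<tau> = (\<Sum>v\<in>V. F v \<tau>)" by (rule QMod_leE[OF assms(1)], rule that) blast+
  obtain W G where G: "finite W" "W \<subseteq> {..w}" "\<And>v. v \<in> W \<Longrightarrow> G v \<in> QMod \<Gamma> v"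
    "\<And>\<tau>. \<tau> \<in> upper_half \<Longrightarrow> g \<tau> = (\<Sum>v\<in>W. G v \<tau>)" by (rule QMod_leE[OF assms(2)], rule that) blast+
  have "(\<lambda>\<tau>. \<Sum>a\<in>V. \<Sum>b\<in>W. F a \<tau> * G b \<tau>) \<in> QMod_le \<Gamma> (v + w)"
    using F(2) G(2)
    by (intro QMod_le_sum QMod_leI[OF QMod_mult[OF F(3) G(3) assms(3)]]) (auto intro!: add_mono)
  then show ?thesis
    by (rule QMod_le_cong) (simp add: F(4) G(4) upper_half_def sum_product)
qed

section \<open>Eisenstein functions at torsion points as forms of level n\<close>

lemma Gamma1_subset_SL2Z: "Gamma1 n \<subseteq> SL2Z"
  by (auto simp: Gamma1_def)

lemma Gamma1_1: "Gamma1 1 = SL2Z"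
  by (auto simp: Gamma1_def cong_def)

(* The conjugate of A by diag(n, 1): it acts on n tau as A acts on tau. *)
definition scaled_matrix :: "nat \<Rightarrow> int^2^2 \<Rightarrow> int^2^2" where
  "scaled_matrix n A = vector [vector [A$1$1, int n * A$1$2], vector [A$2$1 div int n, A$2$2]]"

lemma scaled_matrix:
  assumes "A \<in> Gamma1 n" "n \<ge> 1"
  shows "scaled_matrix n A \<in> SL2Z"
    "of_int (scaled_matrix n A $2$1) = (of_int (A$2$1) / of_nat n :: complex)"
    "automorphy (scaled_matrix n A) (of_nat n * \<tau>) = automorphy A \<tau>"
    "moebius_act (scaled_matrix n A) (of_nat n * \<tau>) = of_nat n * moebius_act A \<tau>"
proof -
  have "int n dvd A$2$1" using assms by (simp add: Gamma1_def cong_0_iff)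
  then obtain c where c: "A$2$1 = int n * c" by (elim dvdE)
  have e: "scaled_matrix n A $1$1 = A$1$1" "scaled_matrix n A $1$2 = int n * A$1$2"
    "scaled_matrix n A $2$1 = c" "scaled_matrix n A $2$2 = A$2$2"
    using assms(2) by (simp_all add: scaled_matrix_def c)
  show "scaled_matrix n A \<in> SL2Z"
    using assms(1) by (simp add: Gamma1_def SL2Z_def det_2 e c mult_ac)
  show "of_int (scaled_matrix n A $2$1) = (of_int (A$2$1) / of_nat n :: complex)"
    using assms(2) by (simp add: e c)
  show a: "automorphy (scaled_matrix n A) (of_nat n * \<tau>) = automorphy A \<tau>"
    by (simp add: automorphy_def e c mult_ac)
  show "moebius_act (scaled_matrix n A) (of_nat n * \<tau>) = of_nat n * moebius_act A \<tau>"
    unfolding moebius_act_def a by (simp add: e distrib_left mult_ac)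
qed

text \<open>The Eisenstein-type forms below have depth at most 1, and the second coefficient
  function is a constant, as for G_2.\<close>

lemma QMod_depth_1I:
  assumes "\<Gamma> \<subseteq> SL2Z" "f holomorphic_on upper_half"
    "\<And>A \<tau>. A \<in> \<Gamma> \<Longrightarrow> Im \<tau> > 0 \<Longrightarrow>
      f (moebius_act A \<tau>) = automorphy A \<tau> ^ m * (f \<tau> + c * (of_int (A$2$1) / automorphy A \<tau>))"
  shows "f \<in> QMod \<Gamma> (int m)"
proof -
  have "quasimodular_of_depth \<Gamma> (int m) 1 f"
    unfolding quasimodular_of_depth_def
  proof (intro exI[of _ "\<lambda>i. if i = 0 then f else (\<lambda>_. c)"] conjI ballI)
    fix A \<tau> assume A: "A \<in> \<Gamma>" and \<tau>: "\<tau> \<in> upper_half"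
    then have "automorphy A \<tau> \<noteq> 0" using assms(1) automorphy_nonzero by (auto simp: upper_half_def)
    then have "automorphy A \<tau> powi - int m * automorphy A \<tau> ^ m = 1"
      by (simp add: power_int_minus)
    then have c: "automorphy A \<tau> powi - int m * (automorphy A \<tau> ^ m * x) = x" for x
      by (simp only: mult.assoc[symmetric] mult_1_left)
    have "f (moebius_act A \<tau>) = automorphy A \<tau> ^ m * (f \<tau> + c * (of_int (A$2$1) / automorphy A \<tau>))"
      using A \<tau> assms(3) by (simp add: upper_half_def)
    then show "automorphy A \<tau> powi - int m * f (moebius_act A \<tau>) =
      (\<Sum>i\<le>1. (if i = 0 then f else (\<lambda>_. c)) \<tau> * (of_int (A $ 2 $ 1) / automorphy A \<tau>) ^ i)"
      by (simp only: c) (simp add: atMost_Suc)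
  qed (use assms(2) in \<open>auto intro!: holomorphic_intros\<close>)
  then show ?thesis unfolding QMod_def by blast
qed

lemma holomorphic_eis_reg_0:
  assumes "n \<ge> 1" "m \<ge> 1"
  shows "(\<lambda>\<tau>. eis_reg m 0 (of_nat n * \<tau>)) holomorphic_on upper_half"
proof -
  have "open upper_half" unfolding upper_half_def by (rule open_halfspace_Im_gt)
  then have "(\<lambda>\<tau>. eis_tail m 0 (of_nat n * \<tau>)) holomorphic_on upper_half"
    using assms by (intro holomorphic_on_eis_tail holomorphic_intros off_tailI) (auto simp: upper_half_def)
  then show ?thesis unfolding eis_reg_def by (intro holomorphic_intros)
qed

lemma eis_reg_0_QMod:
  assumes "n \<ge> 1" "m \<ge> 1"
  shows "(\<lambda>\<tau>. eis_reg m 0 (of_nat n * \<tau>)) \<in> QMod (Gamma1 n) (int m)"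
\<comment> \<open>The divisor n stems from the lower left entry c / n of
  \<open>scaled_matrix\<close>.\<close>
proof (rule QMod_depth_1I[where c = "if m = 2 then - (2 * of_real pi * \<i> / of_nat n) else 0"])
  fix A \<tau> assume A: "A \<in> Gamma1 n" and \<tau>: "Im \<tau> > 0"
  note s = scaled_matrix[OF A assms(1)]
  have n\<tau>: "Im (of_nat n * \<tau>) > 0" using \<tau> assms(1) by simp
  from eis_reg_moebius_act[OF s(1) n\<tau> assms(2), unfolded s(2-4)]
  show "eis_reg m 0 (of_nat n * moebius_act A \<tau>) = automorphy A \<tau> ^ m * (eis_reg m 0 (of_nat n * \<tau>) +
      (if m = 2 then - (2 * of_real pi * \<i> / of_nat n) else 0) * (of_int (A$2$1) / automorphy A \<tau>))"
    by (simp add: eis_corr_def)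
qed (use holomorphic_eis_reg_0[OF assms] Gamma1_subset_SL2Z in auto)

lemma mult_tau_notin_lattice:
  assumes "n \<ge> 1" "\<not> int n dvd k" "Im \<tau> > 0"
  shows "of_int k * \<tau> \<notin> lattice (of_nat n * \<tau>)"
proof
  assume "of_int k * \<tau> \<in> lattice (of_nat n * \<tau>)"
  then obtain a b where "of_int k * \<tau> = of_int a + of_int b * (of_nat n * \<tau>)" by (auto simp: mem_lattice)
  from arg_cong[OF this, of Im] have "real_of_int k * Im \<tau> = real_of_int (b * int n) * Im \<tau>" by simp
  then have "k = b * int n" using assms(3) by (simp only: mult_cancel_right of_int_eq_iff) auto
  with assms(2) show False by simp
qed

lemma holomorphic_eis_fun_torsion:
  assumes "n \<ge> 1" "m \<ge> 1" "\<not> int n dvd k"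
  shows "(\<lambda>\<tau>. eis_fun m (of_int k * \<tau>) (of_nat n * \<tau>)) holomorphic_on upper_half"
proof -
  have o: "open upper_half" unfolding upper_half_def by (rule open_halfspace_Im_gt)
  have "k \<noteq> 0" using assms(3) by auto
  then have "(\<lambda>\<tau>. kap m (of_int k * \<tau>)) holomorphic_on upper_half"
    using mult_tau_notin_Ints[of _ k]
    by (intro holomorphic_on_compose_gen[OF _ holomorphic_on_kap[OF assms(2), of "- \<int>"], unfolded o_def] holomorphic_intros)
       (auto simp: upper_half_def)
  moreover have "(\<lambda>\<tau>. eis_tail m (of_int k * \<tau>) (of_nat n * \<tau>)) holomorphic_on upper_half"
    using assms mult_tau_notin_lattice[OF assms(1,3)]
    by (intro holomorphic_on_eis_tail holomorphic_intros off_tailI o) (auto simp: upper_half_def)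
  ultimately show ?thesis unfolding eis_fun_kap by (intro holomorphic_intros)
qed

text \<open>The point k A\<tau> is k (a \<tau> + b) divided by the automorphy factor. As a = 1
  modulo n, that numerator differs from k \<tau> by a period of the lattice of n \<tau>, containing
  k (a - 1) / n times n \<tau>; for m = 1 this costs as many quasi-periods.\<close>

lemma eis_fun_torsion_moebius_act:
  assumes "n \<ge> 1" "m \<ge> 1" "\<not> int n dvd k" "A \<in> Gamma1 n" "Im \<tau> > 0"
  shows "eis_fun m (of_int k * moebius_act A \<tau>) (of_nat n * moebius_act A \<tau>) = automorphy A \<tau> ^ m *
     (eis_fun m (of_int k * \<tau>) (of_nat n * \<tau>) + of_int k * (of_int (A$1$1) - 1) / of_nat n * (2 * kap_limit m) +
      eis_corr m (2 * of_real pi * \<i> * (of_int (A$2$1) / of_nat n) / automorphy A \<tau>) (of_int k * (of_int (A$1$1) * \<tau> + of_int (A$1$2))))"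
proof -
  note s = scaled_matrix[OF assms(4,1)]
  have n\<tau>: "Im (of_nat n * \<tau>) > 0" using assms(1,5) by simp
  have "int n dvd A$1$1 - 1" using assms(4) by (simp add: Gamma1_def cong_iff_dvd_diff)
  then obtain a where "A$1$1 - 1 = int n * a" by (elim dvdE)
  then have a: "A$1$1 = int n * a + 1" by simp
  define z where "z = of_int k * (of_int (A$1$1) * \<tau> + of_int (A$1$2))"
  have z: "z = of_int k * \<tau> + of_int (k * a) * (of_nat n * \<tau>) + of_int (k * A$1$2)"
    unfolding z_def a by (simp add: algebra_simps)
  note kt = mult_tau_notin_lattice[OF assms(1,3,5)]
  have kt': "of_int k * \<tau> + of_int (k * a) * (of_nat n * \<tau>) \<notin> lattice (of_nat n * \<tau>)"
    using kt add_in_lattice_iff[of "of_int (k * a) * (of_nat n * \<tau>)" "of_nat n * \<tau>"]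
      int_comb_in_lattice[of 0 "k * a" "of_nat n * \<tau>"] by simp
  have zl: "z \<notin> lattice (of_nat n * \<tau>)"
    unfolding z using kt' add_in_lattice_iff[of "of_int (k * A$1$2)" "of_nat n * \<tau>"]
      int_comb_in_lattice[of "k * A$1$2" 0 "of_nat n * \<tau>"] by simp
  have "eis_fun m z (of_nat n * \<tau>) = eis_fun m (of_int k * \<tau> + of_int (k * a) * (of_nat n * \<tau>)) (of_nat n * \<tau>)"
    unfolding z by (rule eis_fun_plus_int[OF assms(2) n\<tau> kt'])
  also have "\<dots> = eis_fun m (of_int k * \<tau>) (of_nat n * \<tau>) + of_int (k * a) * (2 * kap_limit m)"
    by (rule eis_fun_plus_int_tau[OF assms(2) n\<tau>])
  finally have e: "eis_fun m z (of_nat n * \<tau>) = eis_fun m (of_int k * \<tau>) (of_nat n * \<tau>) + of_int k * (of_int (A$1$1) - 1) / of_nat n * (2 * kap_limit m)"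
    using assms(1) by (simp add: a)
  have "z / automorphy A \<tau> = of_int k * moebius_act A \<tau>" unfolding z_def moebius_act_def by simp
  then show ?thesis
    using eis_fun_moebius_act[OF s(1) n\<tau> zl assms(2), unfolded s(2-4) e] unfolding z_def by simp
qed

lemma eis_fun_torsion_QMod_le:
  assumes "n \<ge> 1" "m \<ge> 1" "\<not> int n dvd k"
  shows "(\<lambda>\<tau>. eis_fun m (of_int k * \<tau>) (of_nat n * \<tau>)) \<in> QMod_le (Gamma1 n) (int m)"
proof (cases "m = 1")
  case False
  have "(\<lambda>\<tau>. eis_fun m (of_int k * \<tau>) (of_nat n * \<tau>)) \<in> QMod (Gamma1 n) (int m)"
  proof (rule QMod_depth_1I[where c = "if m = 2 then - (2 * of_real pi * \<i> / of_nat n) else 0"])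
    fix A \<tau> assume A: "A \<in> Gamma1 n" and \<tau>: "Im \<tau> > 0"
    from eis_fun_torsion_moebius_act[OF assms A \<tau>] False
    show "eis_fun m (of_int k * moebius_act A \<tau>) (of_nat n * moebius_act A \<tau>) = automorphy A \<tau> ^ m *
       (eis_fun m (of_int k * \<tau>) (of_nat n * \<tau>) +
        (if m = 2 then - (2 * of_real pi * \<i> / of_nat n) else 0) * (of_int (A$2$1) / automorphy A \<tau>))"
      by (simp add: eis_corr_def kap_limit_def)
  qed (use holomorphic_eis_fun_torsion[OF assms] Gamma1_subset_SL2Z in auto)
  then show ?thesis by (rule QMod_leI) simp
next
  case True
  let ?h = "2 * of_real pi * \<i> * of_int k / of_nat n"
  have "(\<lambda>\<tau>. eis_fun 1 (of_int k * \<tau>) (of_nat n * \<tau>) + ?h) \<in> QMod (Gamma1 n) (int 1)"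
  proof (rule QMod_depth_1I[where c = 0])
    fix A \<tau> assume A: "A \<in> Gamma1 n" and \<tau>: "Im \<tau> > 0"
    have AS: "A \<in> SL2Z" using A Gamma1_subset_SL2Z by auto
    have j: "automorphy A \<tau> \<noteq> 0" by (rule automorphy_nonzero[OF AS \<tau>])
    have "A$1$1 * A$2$2 - A$1$2 * A$2$1 = 1" using AS by (simp add: SL2Z_def det_2)
    then have det: "of_int (A$1$1) * of_int (A$2$2) - of_int (A$1$2) * of_int (A$2$1) = (1 :: complex)"
      by (metis of_int_1 of_int_diff of_int_mult)
    have gen: "x + h = j ^ 1 * (y + 0 * c)" if "x = j * (y - h / j)" "j \<noteq> 0" for x y h j c :: complex
      using that by (simp add: right_diff_distrib)
    \<comment> \<open>By ad - bc = 1, c (a \<tau> + b) becomes a (c \<tau> + d) - 1, so that the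
      correction term can be compared with the quasi-periods.\<close>
    have key: "of_int (A$2$1) * (of_int (A$1$1) * \<tau> + of_int (A$1$2)) = of_int (A$1$1) * automorphy A \<tau> - 1"
      using det unfolding automorphy_def by (simp add: algebra_simps)
    have "2 * of_real pi * \<i> * (of_int (A$2$1) / of_nat n) / automorphy A \<tau> * (of_int k * (of_int (A$1$1) * \<tau> + of_int (A$1$2)))
      = ?h * (of_int (A$2$1) * (of_int (A$1$1) * \<tau> + of_int (A$1$2))) / automorphy A \<tau>"
      by simp
    also have "\<dots> = ?h * (of_int (A$1$1) - 1 / automorphy A \<tau>)"
      unfolding key using j by (simp add: field_simps)
    finally have "eis_fun 1 (of_int k * moebius_act A \<tau>) (of_nat n * moebius_act A \<tau>) = automorphy A \<tau> *
      (eis_fun 1 (of_int k * \<tau>) (of_nat n * \<tau>) + of_int k * (of_int (A$1$1) - 1) / of_nat n * (2 * kap_limit 1)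
        + ?h * (of_int (A$1$1) - 1 / automorphy A \<tau>))"
      using eis_fun_torsion_moebius_act[OF assms(1) order.refl assms(3) A \<tau>] by (simp add: eis_corr_def)
    \<comment> \<open>Write h for \<open>?h\<close>, j for the automorphy factor. The quasi-periods
      contribute -h (a - 1) and the correction h (a - 1 / j). The entry a cancels, and the remainder
      h - h / j is exactly what adding the constant h to E_1 repairs.\<close>
    then have "eis_fun 1 (of_int k * moebius_act A \<tau>) (of_nat n * moebius_act A \<tau>) = automorphy A \<tau> *
      (eis_fun 1 (of_int k * \<tau>) (of_nat n * \<tau>) + ?h - ?h / automorphy A \<tau>)"
    proof -
      have "of_int k * (of_int (A$1$1) - 1) / of_nat n * (2 * kap_limit 1) = - (?h * (of_int (A$1$1) - 1))"
        by (simp add: kap_limit_def)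
      moreover have "x + - (h * (a - 1)) + h * (a - 1 / j) = x + h - h / j" for x h a j :: complex
        by (simp add: algebra_simps)
      ultimately show ?thesis
        using \<open>eis_fun 1 (of_int k * moebius_act A \<tau>) (of_nat n * moebius_act A \<tau>) = _\<close> by metis
    qed
    then show "eis_fun 1 (of_int k * moebius_act A \<tau>) (of_nat n * moebius_act A \<tau>) + ?h = automorphy A \<tau> ^ 1 *
       (eis_fun 1 (of_int k * \<tau>) (of_nat n * \<tau>) + ?h + 0 * (of_int (A$2$1) / automorphy A \<tau>))"
      by (rule gen[OF _ j])
  qed (use holomorphic_eis_fun_torsion[OF assms(1) order.refl assms(3)] Gamma1_subset_SL2Z in \<open>auto intro!: holomorphic_intros\<close>)
  then have "(\<lambda>\<tau>. eis_fun 1 (of_int k * \<tau>) (of_nat n * \<tau>) + ?h + - ?h) \<in> QMod_le (Gamma1 n) 1"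
    by (intro QMod_le_add QMod_le_const QMod_leI[of _ _ "int 1"]) auto
  then show ?thesis using True by simp
qed

lemma eisenstein_G_QMod:
  assumes "k \<in> {2, 4, 6}"
  shows "eisenstein_G k \<in> QMod SL2Z (int k)"
proof -
  let ?f = "\<lambda>\<tau>. eis_reg k 0 (of_nat 1 * \<tau>)"
  have eq: "eisenstein_G k \<tau> = ?f \<tau>" if "\<tau> \<in> upper_half" for \<tau>
    using eisenstein_G_eq_eis_reg[of k \<tau>] assms that by (auto simp: upper_half_def)
  have "?f \<in> QMod (Gamma1 1) (int k)" using assms by (intro eis_reg_0_QMod) auto
  then obtain p F where F: "F 0 = ?f" "\<forall>i\<le>p. F i holomorphic_on upper_half"
    "\<forall>A\<in>SL2Z. \<forall>\<tau>\<in>upper_half. automorphy A \<tau> powi (- int k) * ?f (moebius_act A \<tau>) =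
           (\<Sum>i\<le>p. F i \<tau> * (of_int (A$2$1) / automorphy A \<tau>) ^ i)"
    unfolding QMod_def quasimodular_of_depth_def Gamma1_1 by blast
  \<comment> \<open>\<open>QMod\<close> asks the first coefficient to be the function itself on the
    whole plane, while the identity with \<open>eis_reg\<close> is available only on the upper half
    plane.\<close>
  let ?G = "F(0 := eisenstein_G k)"
  have G: "?G i \<tau> = F i \<tau>" if "\<tau> \<in> upper_half" for i \<tau> using F(1) eq[OF that] by simp
  have "quasimodular_of_depth SL2Z (int k) p (eisenstein_G k)"
    unfolding quasimodular_of_depth_def
  proof (intro exI[of _ ?G] conjI ballI allI impI)
    show "?G 0 = eisenstein_G k" by simp
    show "?G i holomorphic_on upper_half" if "i \<le> p" for i
      using F(2) that by (subst holomorphic_cong[OF refl G]) auto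
    fix A \<tau> assume A: "A \<in> SL2Z" and \<tau>: "\<tau> \<in> upper_half"
    have "moebius_act A \<tau> \<in> upper_half" using Im_moebius_act_pos[OF A] \<tau> by (simp add: upper_half_def)
    then show "automorphy A \<tau> powi - int k * eisenstein_G k (moebius_act A \<tau>) =
       (\<Sum>i\<le>p. ?G i \<tau> * (of_int (A $ 2 $ 1) / automorphy A \<tau>) ^ i)"
      using F(3) A \<tau> unfolding G[OF \<tau>] by (simp only: eq)
  qed
  then show ?thesis unfolding QMod_def by blast
qed

section \<open>The filtered ring of Eisenstein functions\<close>

(*
All integers k are admitted, not only residues modulo n, since E_1 is not elliptic. The weight is only
an upper bound.
*)
inductive qring :: "nat \<Rightarrow> nat \<Rightarrow> int \<Rightarrow> ell_fun \<Rightarrow> bool" for n M where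
  quasi: "g \<in> QMod_le (Gamma1 n) w \<Longrightarrow> qring n M w (\<lambda>z \<tau>. g \<tau>)"
| eis: "i < M \<Longrightarrow> j < M \<Longrightarrow> i \<noteq> j \<Longrightarrow> m \<ge> 1 \<Longrightarrow>
    qring n M (int m) (\<lambda>z \<tau>. eis_fun m (z i - z j - of_int k * \<tau>) (of_nat n * \<tau>))"
| add: "qring n M w f \<Longrightarrow> qring n M w g \<Longrightarrow> qring n M w (\<lambda>z \<tau>. f z \<tau> + g z \<tau>)"
| mult: "qring n M v f \<Longrightarrow> qring n M w g \<Longrightarrow> qring n M (v + w) (\<lambda>z \<tau>. f z \<tau> * g z \<tau>)"

text \<open>The lattice is that of 1 and \<tau>, not of 1 and n \<tau>: since all shifts by k \<tau>
  occur in the generators, every point of it is a possible pole, for each n.\<close>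

definition apart :: "nat \<Rightarrow> (nat \<Rightarrow> complex) \<Rightarrow> complex \<Rightarrow> bool" where
  "apart M z \<tau> \<longleftrightarrow> Im \<tau> > 0 \<and> (\<forall>i<M. \<forall>j<M. i \<noteq> j \<longrightarrow> z i - z j \<notin> lattice \<tau>)"

lemma qring_const: "w \<ge> 0 \<Longrightarrow> qring n M w (\<lambda>z \<tau>. c)"
  by (rule qring.quasi[OF QMod_le_const])

lemma qring_zero: "qring n M w (\<lambda>z \<tau>. 0)"
  by (rule qring.quasi[OF QMod_le_zero])

text \<open>The constant 1 is available in every non-negative weight, because weights are upper
  bounds; multiply by it.\<close>

lemma qring_mono:
  assumes "qring n M v f" "v \<le> w"
  shows "qring n M w f"
  using qring.mult[OF assms(1) qring_const[of "w - v" n M 1]] assms(2) by simp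

lemma qring_cmult:
  assumes "qring n M w f"
  shows "qring n M w (\<lambda>z \<tau>. c * f z \<tau>)"
  using qring.mult[OF qring_const[of 0 n M c] assms] by simp

lemma qring_minus:
  assumes "qring n M w f"
  shows "qring n M w (\<lambda>z \<tau>. - f z \<tau>)"
  using qring_cmult[OF assms, of "-1"] by simp

lemma qring_diff:
  assumes "qring n M w f" "qring n M w g"
  shows "qring n M w (\<lambda>z \<tau>. f z \<tau> - g z \<tau>)"
  using qring.add[OF assms(1) qring_minus[OF assms(2)]] by simp

lemma qring_sum:
  assumes "\<And>i. i \<in> I \<Longrightarrow> qring n M w (f i)"
  shows "qring n M w (\<lambda>z \<tau>. \<Sum>i\<in>I. f i z \<tau>)"
  using assms by (induction I rule: infinite_finite_induct) (auto intro: qring_zero qring.add)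

lemma qring_power:
  assumes "qring n M w f"
  shows "qring n M (int d * w) (\<lambda>z \<tau>. f z \<tau> ^ d)"
proof (induction d)
  case (Suc d)
  from qring.mult[OF assms Suc.IH] show ?case by (simp add: algebra_simps)
qed (simp add: qring_const)

lemma lattice_mult_subset:
  assumes "z - of_int k * \<tau> \<in> lattice (of_nat n * \<tau>)"
  shows "z \<in> lattice \<tau>"
proof -
  from assms obtain a b where "z - of_int k * \<tau> = of_int a + of_int b * (of_nat n * \<tau>)" by (auto simp: mem_lattice)
  then have "z = of_int a + of_int (b * int n + k) * \<tau>" by (simp add: algebra_simps)
  then show ?thesis by (metis int_comb_in_lattice)
qed

lemma apart_notin:
  assumes "apart M z \<tau>" "i < M" "j < M" "i \<noteq> j"
  shows "z i - z j - of_int k * \<tau> \<notin> lattice (of_nat n * \<tau>)"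
  using assms lattice_mult_subset unfolding apart_def by blast

lemma apart_Im: "apart M z \<tau> \<Longrightarrow> Im \<tau> > 0"
  by (simp add: apart_def)

lemma apart_SucI:
  assumes "apart M z \<tau>" "\<And>j. j < M \<Longrightarrow> u - z j \<notin> lattice \<tau>"
  shows "apart (Suc M) (z(M := u)) \<tau>"
proof -
  have "z j - u \<notin> lattice \<tau>" if "j < M" for j
    using assms(2)[OF that] uminus_in_lattice_iff[of "u - z j" \<tau>] by simp
  then show ?thesis
    using assms unfolding apart_def by (auto simp: less_Suc_eq)
qed

lemma apart_shift:
  assumes "apart M z \<tau>" "l \<in> lattice \<tau>"
  shows "apart M (z(i := z i + l)) \<tau>"
proof -
  have "z a + l - z b \<notin> lattice \<tau>" "z b - (z a + l) \<notin> lattice \<tau>" if "z a - z b \<notin> lattice \<tau>" "z b - z a \<notin> lattice \<tau>" for a b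
    using that add_in_lattice_iff[OF assms(2), of "z a - z b"] add_in_lattice_iff[OF lattice_minus[OF assms(2)], of "z b - z a"]
    by (simp_all add: algebra_simps)
  then show ?thesis
    using assms unfolding apart_def by (auto simp: fun_upd_def)
qed

lemma qring_plus_int:
  assumes "qring n M w f" "n \<ge> 1" "apart M z \<tau>"
  shows "f (z(i := z i + of_int a)) \<tau> = f z \<tau>"
  using assms(1)
proof (induction rule: qring.induct)
  case (eis p q m k)
  have n\<tau>: "Im (of_nat n * \<tau>) > 0" using assms by (simp add: apart_def)
  have "eis_fun m (z p - z q - of_int k * \<tau> + of_int b) (of_nat n * \<tau>) = eis_fun m (z p - z q - of_int k * \<tau>) (of_nat n * \<tau>)" for b
    using eis by (intro eis_fun_plus_int n\<tau> apart_notin[OF assms(3)]) auto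
  from this[of a] this[of "- a"] eis(3) show ?case by (auto simp: algebra_simps)
qed auto

lemma qring_holomorphic:
  assumes "qring n (Suc M) w f" "n \<ge> 1" "apart M z \<tau>"
  shows "(\<lambda>u. f (z(M := u)) \<tau>) holomorphic_on - {u. \<exists>j<M. u - z j \<in> lattice \<tau>}" (is "_ holomorphic_on ?S")
  using assms(1)
proof (induction rule: qring.induct)
  case (eis p q m k)
  have n\<tau>: "Im (of_nat n * \<tau>) > 0" using assms by (simp add: apart_def)
  have "(\<lambda>u. eis_fun m ((z(M := u)) p - (z(M := u)) q - of_int k * \<tau>) (of_nat n * \<tau>)) field_differentiable at u" if u: "u \<in> ?S" for u
  proof -
    have ap: "apart (Suc M) (z(M := u)) \<tau>" using u by (intro apart_SucI assms) auto
    note notin = apart_notin[OF ap eis(1-3), of k n]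
    have d1: "(\<lambda>v. eis_fun m v (of_nat n * \<tau>)) field_differentiable at ((z(M := u)) p - (z(M := u)) q - of_int k * \<tau>)"
      unfolding field_differentiable_def using has_field_derivative_eis_fun[OF eis(4) n\<tau> notin] by blast
    have "(\<lambda>u. (z(M := u)) i) field_differentiable at u" for i
      by (cases "i = M") auto
    then have d2: "(\<lambda>u. (z(M := u)) p - (z(M := u)) q - of_int k * \<tau>) field_differentiable at u"
      by (intro derivative_intros)
    show ?thesis
      using field_differentiable_compose[OF d2 d1] by (simp add: o_def)
  qed
  then show ?case
    by (auto simp: holomorphic_on_def intro: field_differentiable_at_within)
qed (auto intro!: holomorphic_intros)

(* The coefficient of v^(r - D) has weight w + (r - D); the pole order D is uniform in z and tau. *)
definition laurent_in :: "nat \<Rightarrow> nat \<Rightarrow> int \<Rightarrow> ((nat \<Rightarrow> complex) \<Rightarrow> complex \<Rightarrow> complex \<Rightarrow> complex) \<Rightarrow> bool" where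
  "laurent_in n M w \<Phi> \<longleftrightarrow> (\<exists>D c. (\<forall>r. qring n M (w - int D + int r) (c r)) \<and>
     (\<forall>z \<tau>. apart M z \<tau> \<longrightarrow> \<Phi> z \<tau> has_laurent_expansion fls_shift (int D) (fps_to_fls (Abs_fps (\<lambda>r. c r z \<tau>)))))"

lemma fls_shift_fps_pad:
  "fls_shift (int D) (fps_to_fls (Abs_fps f)) = fls_shift (int (D + e)) (fps_to_fls (Abs_fps (\<lambda>r. if r < e then 0 else f (r - e))))"
  by (intro fls_eqI) (auto simp: nat_diff_distrib' nat_add_distrib intro!: arg_cong[of _ _ f])

text \<open>The number D only bounds the pole order, so leading zeros may be added to give two
  expansions the same D; the weight of the coefficient of a given power of v does not
  change.\<close>

lemma laurent_in_pad:
  assumes "\<And>r. qring n M (w - int D + int r) (c r)"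
    "\<And>z \<tau>. apart M z \<tau> \<Longrightarrow> \<Phi> z \<tau> has_laurent_expansion fls_shift (int D) (fps_to_fls (Abs_fps (\<lambda>r. c r z \<tau>)))"
  obtains c' where "\<And>r. qring n M (w - int (D + e) + int r) (c' r)"
    "\<And>z \<tau>. apart M z \<tau> \<Longrightarrow> \<Phi> z \<tau> has_laurent_expansion fls_shift (int (D + e)) (fps_to_fls (Abs_fps (\<lambda>r. c' r z \<tau>)))"
proof
  let ?c = "\<lambda>r z \<tau>. if r < e then 0 else c (r - e) z \<tau>"
  show "qring n M (w - int (D + e) + int r) (?c r)" for r
    using qring_zero[of n M] assms(1)[of "r - e"] by (cases "r < e") (simp_all add: of_nat_diff algebra_simps)
  show "\<Phi> z \<tau> has_laurent_expansion fls_shift (int (D + e)) (fps_to_fls (Abs_fps (\<lambda>r. ?c r z \<tau>)))" if "apart M z \<tau>" for z \<tau>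
    using assms(2)[OF that] unfolding fls_shift_fps_pad[of D _ e] .
qed

lemma laurent_in_add:
  assumes "laurent_in n M w \<Phi>" "laurent_in n M w \<Psi>"
  shows "laurent_in n M w (\<lambda>z \<tau> v. \<Phi> z \<tau> v + \<Psi> z \<tau> v)"
proof -
  obtain D c where c: "\<And>r. qring n M (w - int D + int r) (c r)"
    "\<And>z \<tau>. apart M z \<tau> \<Longrightarrow> \<Phi> z \<tau> has_laurent_expansion fls_shift (int D) (fps_to_fls (Abs_fps (\<lambda>r. c r z \<tau>)))"
    using assms(1) unfolding laurent_in_def by blast
  obtain E d where d: "\<And>r. qring n M (w - int E + int r) (d r)"
    "\<And>z \<tau>. apart M z \<tau> \<Longrightarrow> \<Psi> z \<tau> has_laurent_expansion fls_shift (int E) (fps_to_fls (Abs_fps (\<lambda>r. d r z \<tau>)))"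
    using assms(2) unfolding laurent_in_def by blast
  obtain c' where c': "\<And>r. qring n M (w - int (D + E) + int r) (c' r)"
    "\<And>z \<tau>. apart M z \<tau> \<Longrightarrow> \<Phi> z \<tau> has_laurent_expansion fls_shift (int (D + E)) (fps_to_fls (Abs_fps (\<lambda>r. c' r z \<tau>)))"
    using laurent_in_pad[of n M w D c \<Phi> E] c by blast
  obtain d' where d': "\<And>r. qring n M (w - int (D + E) + int r) (d' r)"
    "\<And>z \<tau>. apart M z \<tau> \<Longrightarrow> \<Psi> z \<tau> has_laurent_expansion fls_shift (int (D + E)) (fps_to_fls (Abs_fps (\<lambda>r. d' r z \<tau>)))"
    using laurent_in_pad[of n M w E d \<Psi> D] d by (metis add.commute)
  have eq: "fls_shift k (fps_to_fls (Abs_fps a)) + fls_shift k (fps_to_fls (Abs_fps b)) =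
      fls_shift k (fps_to_fls (Abs_fps (\<lambda>r. a r + b r)))" for k and a b :: "nat \<Rightarrow> complex"
    by (intro fls_eqI) simp
  have "(\<lambda>v. \<Phi> z \<tau> v + \<Psi> z \<tau> v) has_laurent_expansion
      fls_shift (int (D + E)) (fps_to_fls (Abs_fps (\<lambda>r. c' r z \<tau> + d' r z \<tau>)))" if "apart M z \<tau>" for z \<tau>
    using has_laurent_expansion_add[OF c'(2)[OF that] d'(2)[OF that]] unfolding eq .
  then show ?thesis
    unfolding laurent_in_def using qring.add[OF c'(1) d'(1)]
    by (intro exI[of _ "D + E"] exI[of _ "\<lambda>r z \<tau>. c' r z \<tau> + d' r z \<tau>"]) blast
qed

lemma laurent_in_mult:
  assumes "laurent_in n M v \<Phi>" "laurent_in n M w \<Psi>"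
  shows "laurent_in n M (v + w) (\<lambda>z \<tau> x. \<Phi> z \<tau> x * \<Psi> z \<tau> x)"
proof -
  obtain D c where c: "\<And>r. qring n M (v - int D + int r) (c r)"
    "\<And>z \<tau>. apart M z \<tau> \<Longrightarrow> \<Phi> z \<tau> has_laurent_expansion fls_shift (int D) (fps_to_fls (Abs_fps (\<lambda>r. c r z \<tau>)))"
    using assms(1) unfolding laurent_in_def by blast
  obtain E d where d: "\<And>r. qring n M (w - int E + int r) (d r)"
    "\<And>z \<tau>. apart M z \<tau> \<Longrightarrow> \<Psi> z \<tau> has_laurent_expansion fls_shift (int E) (fps_to_fls (Abs_fps (\<lambda>r. d r z \<tau>)))"
    using assms(2) unfolding laurent_in_def by blast
  let ?e = "\<lambda>r z \<tau>. \<Sum>i=0..r. c i z \<tau> * d (r - i) z \<tau>"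
  have "fls_shift (int D) (fps_to_fls (Abs_fps (\<lambda>r. c r z \<tau>))) * fls_shift (int E) (fps_to_fls (Abs_fps (\<lambda>r. d r z \<tau>)))
     = fls_shift (int (D + E)) (fps_to_fls (Abs_fps (\<lambda>r. ?e r z \<tau>)))" for z \<tau>
  proof -
    have "Abs_fps (\<lambda>r. ?e r z \<tau>) = Abs_fps (\<lambda>r. c r z \<tau>) * Abs_fps (\<lambda>r. d r z \<tau>)"
      by (intro fps_ext) (simp add: fps_mult_nth)
    then show ?thesis
      by (simp add: fls_times_fps_to_fls fls_shifted_times_simps add.commute)
  qed
  then have "(\<lambda>x. \<Phi> z \<tau> x * \<Psi> z \<tau> x) has_laurent_expansion
      fls_shift (int (D + E)) (fps_to_fls (Abs_fps (\<lambda>r. ?e r z \<tau>)))" if "apart M z \<tau>" for z \<tau>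
    using has_laurent_expansion_mult[OF c(2)[OF that] d(2)[OF that]] by simp
  moreover have "qring n M (v + w - int (D + E) + int r) (?e r)" for r
  proof (rule qring_sum)
    fix i assume "i \<in> {0..r}"
    then have "v - int D + int i + (w - int E + int (r - i)) = v + w - int (D + E) + int r" by (simp add: of_nat_diff)
    then show "qring n M (v + w - int (D + E) + int r) (\<lambda>z \<tau>. c i z \<tau> * d (r - i) z \<tau>)"
      using qring.mult[OF c(1)[of i] d(1)[of "r - i"]] by (simp only:)
  qed
  ultimately show ?thesis
    unfolding laurent_in_def by (intro exI[of _ "D + E"] exI[of _ ?e]) blast
qed

lemma laurent_in_const:
  assumes "qring n M w f"
  shows "laurent_in n M w (\<lambda>z \<tau> v. f z \<tau>)"
  unfolding laurent_in_def
proof (intro exI[of _ 0] exI[of _ "\<lambda>r. if r = 0 then f else (\<lambda>z \<tau>. 0)"] conjI allI impI)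
  show "qring n M (w - int 0 + int r) (if r = 0 then f else (\<lambda>z \<tau>. 0))" for r
    using assms qring_zero by auto
  have "Abs_fps (\<lambda>r. (if r = 0 then f else (\<lambda>z \<tau>. 0)) z \<tau>) = fps_const (f z \<tau>)" for z \<tau>
    by (intro fps_ext) simp
  then show "(\<lambda>v. f z \<tau>) has_laurent_expansion fls_shift (int 0) (fps_to_fls (Abs_fps (\<lambda>r. (if r = 0 then f else (\<lambda>z \<tau>. 0)) z \<tau>)))" for z \<tau>
    by simp
qed

lemma laurent_in_cong:
  assumes "laurent_in n M w \<Phi>" "\<And>z \<tau> v. apart M z \<tau> \<Longrightarrow> \<Psi> z \<tau> v = \<Phi> z \<tau> v"
  shows "laurent_in n M w \<Psi>"
proof -
  have "\<Psi> z \<tau> = \<Phi> z \<tau>" if "apart M z \<tau>" for z \<tau> using assms(2)[OF that] by blast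
  then show ?thesis using assms(1) unfolding laurent_in_def by simp
qed

(* Applies to E_m and to its regular part at 0, both of which satisfy f_m' = -m f_(m+1). *)
lemma has_fps_expansion_tower:
  fixes f :: "nat \<Rightarrow> complex \<Rightarrow> complex"
  assumes "open S" "\<And>m z. m \<ge> 1 \<Longrightarrow> z \<in> S \<Longrightarrow> (f m has_field_derivative - of_nat m * f (Suc m) z) (at z)"
    "m \<ge> 1" "z \<in> S"
  shows "(\<lambda>v. f m (z + v)) has_fps_expansion Abs_fps (\<lambda>r. (-1) ^ r * pochhammer (of_nat m) r / fact r * f (m + r) z)"
proof -
  let ?T = "(\<lambda>v. z + v) -` S"
  have T: "open ?T" by (intro open_vimage assms(1) continuous_intros)
  have der: "((\<lambda>v. f m (z + v)) has_field_derivative - of_nat m * f (Suc m) (z + v)) (at v)" if "v \<in> ?T" "m \<ge> 1" for m v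
  proof -
    have "((\<lambda>v. f m (z + v)) has_field_derivative - of_nat m * f (Suc m) (z + v) * (0 + 1)) (at v)"
      using that by (intro DERIV_chain2[of "f m"] assms(2) derivative_intros) auto
    then show ?thesis by simp
  qed
  have hd: "(deriv ^^ r) (\<lambda>v. f m (z + v)) v = (-1) ^ r * pochhammer (of_nat m) r * f (m + r) (z + v)" if "v \<in> ?T" for r v
    using that
  proof (induction r arbitrary: v)
    case (Suc r)
    have "\<forall>\<^sub>F x in nhds v. x \<in> ?T" using T Suc.prems by (rule eventually_nhds_in_open)
    then have "\<forall>\<^sub>F x in nhds v. (deriv ^^ r) (\<lambda>v. f m (z + v)) x = (-1) ^ r * pochhammer (of_nat m) r * f (m + r) (z + x)"
      by eventually_elim (rule Suc.IH)
    then have "deriv ((deriv ^^ r) (\<lambda>v. f m (z + v))) v = deriv (\<lambda>x. (-1) ^ r * pochhammer (of_nat m) r * f (m + r) (z + x)) v"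
      by (intro deriv_cong_ev) auto
    also have "\<dots> = (-1) ^ r * pochhammer (of_nat m) r * (- of_nat (m + r) * f (Suc (m + r)) (z + v))"
      using assms(3) Suc.prems by (intro DERIV_imp_deriv DERIV_cmult der) auto
    finally show ?case by (simp add: pochhammer_Suc algebra_simps)
  qed simp
  have "(\<lambda>v. f m (z + v)) has_fps_expansion fps_expansion (\<lambda>v. f m (z + v)) 0"
  proof (rule has_fps_expansion_fps_expansion[OF T])
    show "(\<lambda>v. f m (z + v)) holomorphic_on ?T"
      using der[OF _ assms(3)] unfolding holomorphic_on_def field_differentiable_def
      by (blast intro: has_field_derivative_at_within)
  qed (use assms(4) in auto)
  also have "fps_expansion (\<lambda>v. f m (z + v)) 0 = Abs_fps (\<lambda>r. (-1) ^ r * pochhammer (of_nat m) r / fact r * f (m + r) z)"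
    using hd[of 0] assms(4) by (intro fps_ext) (simp add: fps_expansion_def)
  finally show ?thesis .
qed

lemma laurent_in_Taylor:
  assumes "\<And>r. qring n M (w + int r) (c r)"
    "\<And>z \<tau>. apart M z \<tau> \<Longrightarrow> \<Phi> z \<tau> has_fps_expansion Abs_fps (\<lambda>r. a r * c r z \<tau>)"
  shows "laurent_in n M w \<Phi>"
  unfolding laurent_in_def
  by (intro exI[of _ 0] exI[of _ "\<lambda>r z \<tau>. a r * c r z \<tau>"])
     (use has_laurent_expansion_fps[OF assms(2)] qring_cmult[OF assms(1)] in auto)

lemma laurent_in_inverse_power: "laurent_in n M (int m) (\<lambda>z \<tau> v. 1 / v ^ m)"
  unfolding laurent_in_def
proof (intro exI[of _ m] exI[of _ "\<lambda>r z \<tau>. if r = 0 then 1 else 0"] conjI allI impI)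
  show "qring n M (int m - int m + int r) (\<lambda>z \<tau>. if r = 0 then 1 else 0)" for r
    by (rule qring_const) simp
  have "Abs_fps (\<lambda>r. if r = 0 then 1 else 0 :: complex) = 1" by (intro fps_ext) simp
  moreover have "(\<lambda>v. 1 / v ^ m) = (\<lambda>v::complex. v powi (- int m))"
    by (intro ext) (simp add: power_int_minus inverse_eq_divide)
  ultimately show "(\<lambda>v. 1 / v ^ m) has_laurent_expansion fls_shift (int m) (fps_to_fls (Abs_fps (\<lambda>r. if r = 0 then 1 else 0)))"
    using has_laurent_expansion_fps_X_power_int[of "- int m"] by simp
qed

text \<open>There are three kinds of points. For distinct variables the Taylor coefficients are
  again generators. For equal variables and q not divisible by n they are values at torsion points.
  Otherwise there is a genuine pole, and the regular part has Eisenstein series as coefficients, up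
  to quasi-periods.\<close>

lemma laurent_in_eis_fun:
  assumes "n \<ge> 1" "m \<ge> 1" "i < M" "j < M"
  shows "laurent_in n M (int m) (\<lambda>z \<tau> v. eis_fun m (z j - z i + of_int q * \<tau> + v) (of_nat n * \<tau>))"
proof -
  have Im: "Im (of_nat n * \<tau>) > 0" if "apart M z \<tau>" for z \<tau> using that assms(1) by (simp add: apart_def)
  have exp: "(\<lambda>v. eis_fun m (x + v) \<tau>) has_fps_expansion
      Abs_fps (\<lambda>r. (-1) ^ r * pochhammer (of_nat m) r / fact r * eis_fun (m + r) x \<tau>)" if "x \<notin> lattice \<tau>" "Im \<tau> > 0" for x \<tau>
    using that by (intro has_fps_expansion_tower[of "- lattice \<tau>"] open_Compl_lattice has_field_derivative_eis_fun assms(2)) auto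
  consider "i \<noteq> j" | "i = j" "\<not> int n dvd q" | "i = j" "int n dvd q" by blast
  then show ?thesis
  proof cases
    case 1
    show ?thesis
    proof (rule laurent_in_Taylor)
      fix r
      show "qring n M (int m + int r) (\<lambda>z \<tau>. eis_fun (m + r) (z j - z i - of_int (- q) * \<tau>) (of_nat n * \<tau>))"
        using qring.eis[of j M i "m + r" n "- q"] assms 1 by simp
    next
      fix z \<tau> assume a: "apart M z \<tau>"
      from exp[OF apart_notin[OF a assms(4,3) 1[symmetric], of "- q"] Im[OF a]]
      show "(\<lambda>v. eis_fun m (z j - z i + of_int q * \<tau> + v) (of_nat n * \<tau>)) has_fps_expansion
        Abs_fps (\<lambda>r. (-1) ^ r * pochhammer (of_nat m) r / fact r * eis_fun (m + r) (z j - z i - of_int (- q) * \<tau>) (of_nat n * \<tau>))"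
        by simp
    qed
  next
    case 2
    show ?thesis
    proof (rule laurent_in_Taylor)
      fix r
      show "qring n M (int m + int r) (\<lambda>z \<tau>. eis_fun (m + r) (of_int q * \<tau>) (of_nat n * \<tau>))"
        using qring.quasi[OF eis_fun_torsion_QMod_le[OF assms(1) _ 2(2), of "m + r"]] assms by simp
    next
      fix z \<tau> assume a: "apart M z \<tau>"
      from exp[OF mult_tau_notin_lattice[OF assms(1) 2(2) apart_Im[OF a]] Im[OF a]]
      show "(\<lambda>v. eis_fun m (z j - z i + of_int q * \<tau> + v) (of_nat n * \<tau>)) has_fps_expansion
        Abs_fps (\<lambda>r. (-1) ^ r * pochhammer (of_nat m) r / fact r * eis_fun (m + r) (of_int q * \<tau>) (of_nat n * \<tau>))"
        using 2 by simp
    qed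
  next
    case 3
    then obtain l where l: "q = int n * l" by (elim dvdE)
    have reg: "laurent_in n M (int m) (\<lambda>z \<tau> v. eis_reg m v (of_nat n * \<tau>))"
    proof (rule laurent_in_Taylor)
      fix r
      show "qring n M (int m + int r) (\<lambda>z \<tau>. eis_reg (m + r) 0 (of_nat n * \<tau>))"
        using qring.quasi[OF QMod_leI[OF eis_reg_0_QMod[OF assms(1), of "m + r"] order.refl]] assms by simp
    next
      fix z \<tau> assume a: "apart M z \<tau>"
      have "(\<lambda>v. eis_reg m (0 + v) (of_nat n * \<tau>)) has_fps_expansion
        Abs_fps (\<lambda>r. (-1) ^ r * pochhammer (of_nat m) r / fact r * eis_reg (m + r) 0 (of_nat n * \<tau>))"
        using Im[OF a] by (intro has_fps_expansion_tower[of "- (lattice (of_nat n * \<tau>) - {0})"]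
            open_Compl_lattice_minus_0 has_field_derivative_eis_reg assms(2)) auto
      then show "(\<lambda>v. eis_reg m v (of_nat n * \<tau>)) has_fps_expansion
        Abs_fps (\<lambda>r. (-1) ^ r * pochhammer (of_nat m) r / fact r * eis_reg (m + r) 0 (of_nat n * \<tau>))" by simp
    qed
    have "laurent_in n M (int m) (\<lambda>z \<tau> v. 1 / v ^ m + eis_reg m v (of_nat n * \<tau>) + of_int l * (2 * kap_limit m))"
      by (intro laurent_in_add laurent_in_inverse_power reg laurent_in_const qring_const) simp
    then show ?thesis
    proof (rule laurent_in_cong)
      fix z \<tau> v assume a: "apart M z \<tau>"
      have "eis_fun m (z j - z i + of_int q * \<tau> + v) (of_nat n * \<tau>) = eis_fun m (v + of_int l * (of_nat n * \<tau>)) (of_nat n * \<tau>)"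
        using 3 by (simp add: l algebra_simps)
      also have "\<dots> = eis_fun m v (of_nat n * \<tau>) + of_int l * (2 * kap_limit m)"
        by (rule eis_fun_plus_int_tau[OF assms(2) Im[OF a]])
      finally show "eis_fun m (z j - z i + of_int q * \<tau> + v) (of_nat n * \<tau>) =
         1 / v ^ m + eis_reg m v (of_nat n * \<tau>) + of_int l * (2 * kap_limit m)"
        by (simp add: eis_fun_def)
    qed
  qed
qed

text \<open>The point z j + k \<tau> is a candidate for a pole in the last variable, and v is the
  local parameter there. Generators with the last variable in the second place are turned around by
  parity.\<close>

lemma qring_laurent_in:
  assumes "qring n (Suc M) w f" "n \<ge> 1" "j < M"
  shows "laurent_in n M w (\<lambda>z \<tau> v. f (z(M := z j + of_int k * \<tau> + v)) \<tau>)"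
  using assms(1)
proof (induction rule: qring.induct)
  case (quasi g w)
  show ?case by (rule laurent_in_const[OF qring.quasi[OF quasi]])
next
  case (eis p q m l)
  consider "p < M" "q < M" | "p = M" "q < M" | "p < M" "q = M" using eis by linarith
  then show ?case
  proof cases
    case 1
    then have "laurent_in n M (int m) (\<lambda>z \<tau> v. eis_fun m (z p - z q - of_int l * \<tau>) (of_nat n * \<tau>))"
      using eis by (intro laurent_in_const qring.eis)
    then show ?thesis by (rule laurent_in_cong) (use 1 in auto)
  next
    case 2
    from laurent_in_eis_fun[OF assms(2) eis(4) 2(2) assms(3), of "k - l"]
    show ?thesis by (rule laurent_in_cong) (use 2 in \<open>auto simp: algebra_simps\<close>)
  next
    case 3
    have "laurent_in n M (0 + int m) (\<lambda>z \<tau> v. (-1) ^ m * eis_fun m (z j - z p + of_int (k + l) * \<tau> + v) (of_nat n * \<tau>))"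
      by (intro laurent_in_mult laurent_in_const qring_const laurent_in_eis_fun assms(2,3) eis(4) 3) simp
    then have "laurent_in n M (int m) (\<lambda>z \<tau> v. (-1) ^ m * eis_fun m (z j - z p + of_int (k + l) * \<tau> + v) (of_nat n * \<tau>))" by simp
    then show ?thesis
    proof (rule laurent_in_cong)
      fix z \<tau> v assume a: "apart M z \<tau>"
      have "Im (of_nat n * \<tau>) > 0" using a assms(2) by (simp add: apart_def)
      from eis_fun_minus[OF eis(4) this, of "z j - z p + of_int (k + l) * \<tau> + v"] 3
      show "eis_fun m ((z(M := z j + of_int k * \<tau> + v)) p - (z(M := z j + of_int k * \<tau> + v)) q - of_int l * \<tau>) (of_nat n * \<tau>) =
        (-1) ^ m * eis_fun m (z j - z p + of_int (k + l) * \<tau> + v) (of_nat n * \<tau>)"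
        by (simp add: algebra_simps)
    qed
  qed
next
  case (add w f g)
  from laurent_in_add[OF add.IH] show ?case .
next
  case (mult v f w g)
  from laurent_in_mult[OF mult.IH] show ?case .
qed

text \<open>The residue is the coefficient of v^(-1), whose weight is one below that of f; this pays
  back the weight spent on the antidifference.\<close>

lemma residue_qring:
  assumes "qring n (Suc M) (w + 1) f" "n \<ge> 1" "j < M"
  obtains \<rho> where "qring n M w \<rho>"
    "\<And>z \<tau>. apart M z \<tau> \<Longrightarrow> residue (\<lambda>u. f (z(M := u)) \<tau>) (z j + of_int k * \<tau>) = \<rho> z \<tau>"
proof -
  obtain D c where c: "\<And>r. qring n M (w + 1 - int D + int r) (c r)"
    "\<And>z \<tau>. apart M z \<tau> \<Longrightarrow> (\<lambda>v. f (z(M := z j + of_int k * \<tau> + v)) \<tau>) has_laurent_expansion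
        fls_shift (int D) (fps_to_fls (Abs_fps (\<lambda>r. c r z \<tau>)))"
    using qring_laurent_in[OF assms, of k] unfolding laurent_in_def by blast
  show ?thesis
  proof
    \<comment> \<open>If D = 0 there is no pole; the natural number \<open>D - 1\<close> would then
      wrongly select the constant term.\<close>
    show "qring n M w (if D = 0 then (\<lambda>z \<tau>. 0) else c (D - 1))"
      using c(1)[of "D - 1"] qring_zero by (auto simp: of_nat_diff)
    fix z \<tau> assume a: "apart M z \<tau>"
    have "residue (\<lambda>u. f (z(M := u)) \<tau>) (z j + of_int k * \<tau>) = fls_residue (fls_shift (int D) (fps_to_fls (Abs_fps (\<lambda>r. c r z \<tau>))))"
      by (rule has_laurent_expansion_residue[OF c(2)[OF a]])
    also have "\<dots> = (if D = 0 then (\<lambda>z \<tau>. 0) else c (D - 1)) z \<tau>"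
      by (auto simp: nat_diff_distrib')
    finally show "residue (\<lambda>u. f (z(M := u)) \<tau>) (z j + of_int k * \<tau>) = (if D = 0 then (\<lambda>z \<tau>. 0) else c (D - 1)) z \<tau>" .
  qed
qed

section \<open>Antidifferences along the period n \<tau>\<close>

definition elliptic_last :: "nat \<Rightarrow> nat \<Rightarrow> ell_fun \<Rightarrow> bool" where
  "elliptic_last n M e \<longleftrightarrow> (\<forall>z \<tau>. apart (Suc M) z \<tau> \<longrightarrow> e (z(M := z M + of_nat n * \<tau>)) \<tau> = e z \<tau>)"

text \<open>This is the y of the overview. It needs one further variable to be subtracted from the
  last one, and index 0 is taken.\<close>

definition shift_fun :: "nat \<Rightarrow> nat \<Rightarrow> ell_fun" where
  "shift_fun n M = (\<lambda>z \<tau>. eis_fun 1 (z M - z 0) (of_nat n * \<tau>))"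

(* Polynomials in shift_fun whose coefficients are elliptic in the last variable. *)
inductive yring :: "nat \<Rightarrow> nat \<Rightarrow> int \<Rightarrow> ell_fun \<Rightarrow> bool" for n M where
  mono: "qring n (Suc M) w e \<Longrightarrow> elliptic_last n M e \<Longrightarrow>
    yring n M (int d + w) (\<lambda>z \<tau>. shift_fun n M z \<tau> ^ d * e z \<tau>)"
| add: "yring n M w f \<Longrightarrow> yring n M w g \<Longrightarrow> yring n M w (\<lambda>z \<tau>. f z \<tau> + g z \<tau>)"

lemma qring_shift_fun:
  assumes "0 < M"
  shows "qring n (Suc M) 1 (shift_fun n M)"
  using qring.eis[of M "Suc M" 0 1 n 0] assms by (simp add: shift_fun_def)

lemma shift_fun_shift:
  assumes "0 < M" "n \<ge> 1" "apart (Suc M) z \<tau>"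
  shows "shift_fun n M (z(M := z M + of_nat n * \<tau>)) \<tau> = shift_fun n M z \<tau> + 2 * kap_limit 1"
proof -
  have "Im (of_nat n * \<tau>) > 0" using assms by (simp add: apart_def)
  from eis_fun_plus_tau[OF _ this, of 1 "z M - z 0"] assms(1) show ?thesis
    by (simp add: shift_fun_def algebra_simps)
qed

lemma yring_mult:
  assumes "yring n M v f" "yring n M w g"
  shows "yring n M (v + w) (\<lambda>z \<tau>. f z \<tau> * g z \<tau>)"
  using assms(1)
proof (induction rule: yring.induct)
  case (mono v e d)
  show ?case using assms(2)
  proof (induction rule: yring.induct)
    case (mono w e' d')
    have "yring n M (int (d + d') + (v + w)) (\<lambda>z \<tau>. shift_fun n M z \<tau> ^ (d + d') * (e z \<tau> * e' z \<tau>))"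
      using mono \<open>qring n (Suc M) v e\<close> \<open>elliptic_last n M e\<close>
      by (intro yring.mono qring.mult) (auto simp: elliptic_last_def)
    then show ?case by (simp add: power_add algebra_simps)
  next
    case (add w f g)
    from yring.add[OF add.IH] show ?case by (simp add: distrib_left)
  qed
next
  case (add v f h)
  from yring.add[OF add.IH] show ?case by (simp add: distrib_right)
qed

lemma yring_elliptic:
  assumes "qring n (Suc M) w e" "elliptic_last n M e"
  shows "yring n M w e"
  using yring.mono[OF assms, of 0] by simp

text \<open>For m > 1 the generators are elliptic, and E_1 of an argument involving the last
  variable differs from y or -y by an elliptic function, as only its quasi-period obstructs.\<close>

lemma qring_yring:
  assumes "qring n (Suc M) w f" "n \<ge> 1" "0 < M"
  shows "yring n M w f"
  using assms(1)
proof (induction rule: qring.induct)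
  case (quasi g w)
  show ?case by (intro yring_elliptic qring.quasi quasi) (auto simp: elliptic_last_def)
next
  case (eis p q m k)
  let ?E = "\<lambda>z \<tau>. eis_fun m (z p - z q - of_int k * \<tau>) (of_nat n * \<tau>)"
  \<comment> \<open>The sign with which the last variable occurs is the multiple of y to be
    subtracted.\<close>
  define s :: complex where "s = (if p = M then 1 else if q = M then - 1 else 0)"
  have E: "qring n (Suc M) (int m) ?E" using eis by (intro qring.eis)
  have sh: "?E (z(M := z M + of_nat n * \<tau>)) \<tau> = ?E z \<tau> + s * (2 * kap_limit m)" if "apart (Suc M) z \<tau>" for z \<tau>
  proof -
    have "Im (of_nat n * \<tau>) > 0" using that assms by (simp add: apart_def)
    from eis_fun_plus_int_tau[OF eis(4) this, of "z p - z q - of_int k * \<tau>" 1]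
      eis_fun_plus_int_tau[OF eis(4) this, of "z p - z q - of_int k * \<tau>" "-1"] eis(3)
    show ?thesis unfolding s_def by (auto simp: algebra_simps)
  qed
  show ?case
  proof (cases "m = 1")
    case False
    then show ?thesis using sh by (intro yring_elliptic E) (auto simp: elliptic_last_def kap_limit_def)
  next
    case True
    have "yring n M (int 1 + 0) (\<lambda>z \<tau>. shift_fun n M z \<tau> ^ 1 * s)"
      by (intro yring.mono qring_const) (auto simp: elliptic_last_def)
    moreover have "yring n M 1 (\<lambda>z \<tau>. ?E z \<tau> - s * shift_fun n M z \<tau>)"
      using E True shift_fun_shift[OF assms(3,2)] sh
      by (intro yring_elliptic qring_diff qring_cmult qring_shift_fun assms(3)) (auto simp: elliptic_last_def algebra_simps)
    ultimately have "yring n M 1 (\<lambda>z \<tau>. shift_fun n M z \<tau> ^ 1 * s + (?E z \<tau> - s * shift_fun n M z \<tau>))"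
      by (intro yring.add) auto
    then show ?thesis using True by (simp add: mult.commute)
  qed
next
  case (add w f g)
  then show ?case by (intro yring.add)
next
  case (mult v f w g)
  then show ?case by (intro yring_mult)
qed

text \<open>The polynomials are rescaled Bernoulli polynomials, up to constants. In the binomial
  expansion of (Y + c)^(d+1) - Y^(d+1) the term (d + 1) c Y^d is the wanted one, and lower powers
  are removed by induction.\<close>

lemma poly_antidifference:
  fixes c :: complex
  assumes "c \<noteq> 0"
  shows "\<exists>p. degree p \<le> Suc d \<and> (\<forall>Y. poly p Y - poly p (Y + c) = Y ^ d)"
proof (induction d rule: less_induct)
  case (less d)
  then obtain p where p: "\<And>i. i < d \<Longrightarrow> degree (p i) \<le> Suc i" "\<And>i Y. i < d \<Longrightarrow> poly (p i) Y - poly (p i) (Y + c) = Y ^ i"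
    by metis
  define a where "a = (\<lambda>i. of_nat (Suc d choose i) * c ^ (Suc d - i))"
  define q where "q = monom 1 (Suc d) + (\<Sum>i<d. smult (a i) (p i))"
  have ad: "a d \<noteq> 0" using assms by (simp add: a_def del: of_nat_Suc)
  have "degree q \<le> Suc d"
    unfolding q_def
  proof (intro degree_add_le degree_monom_le degree_sum_le)
    fix i assume "i \<in> {..<d}"
    then show "degree (smult (a i) (p i)) \<le> Suc d" using p(1)[of i] degree_smult_le[of "a i" "p i"] by simp
  qed simp
  moreover have "poly q Y - poly q (Y + c) = - a d * Y ^ d" for Y
  proof -
    have "(Y + c) ^ Suc d = (\<Sum>i\<le>Suc d. a i * Y ^ i)"
      unfolding a_def by (subst binomial_ring) (simp add: mult_ac)
    also have "{..Suc d} = insert (Suc d) (insert d {..<d})" by auto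
    finally have "(Y + c) ^ Suc d = Y ^ Suc d + a d * Y ^ d + (\<Sum>i<d. a i * Y ^ i)"
      by (simp add: a_def)
    moreover have "(\<Sum>i<d. a i * poly (p i) Y) - (\<Sum>i<d. a i * poly (p i) (Y + c)) = (\<Sum>i<d. a i * Y ^ i)"
      unfolding sum_subtractf[symmetric] right_diff_distrib[symmetric] by (intro sum.cong) (auto simp: p(2))
    ultimately show ?thesis
      unfolding q_def by (simp add: poly_monom poly_sum algebra_simps)
  qed
  then have "poly (smult (- 1 / a d) q) Y - poly (smult (- 1 / a d) q) (Y + c) = Y ^ d" for Y
    using ad unfolding poly_smult right_diff_distrib[symmetric] by simp
  ultimately show ?case
    using degree_smult_le[of "- 1 / a d" q] by (intro exI[of _ "smult (- 1 / a d) q"]) auto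
qed

text \<open>An elliptic coefficient e passes through the difference, so p(y) e solves the equation
  for y^d e. The degree bound d + 1 of p is the increase of the weight.\<close>

lemma yring_antidifference:
  assumes "yring n M w f" "n \<ge> 1" "0 < M"
  shows "\<exists>G. qring n (Suc M) (w + 1) G \<and>
    (\<forall>z \<tau>. apart (Suc M) z \<tau> \<longrightarrow> G z \<tau> - G (z(M := z M + of_nat n * \<tau>)) \<tau> = f z \<tau>)"
  using assms(1)
proof (induction rule: yring.induct)
  case (mono w e d)
  have "2 * kap_limit 1 \<noteq> 0" by (simp add: kap_limit_def)
  then obtain p where p: "degree p \<le> Suc d" "\<And>Y. poly p Y - poly p (Y + 2 * kap_limit 1) = Y ^ d"
    using poly_antidifference by blast
  let ?y = "shift_fun n M"
  let ?G = "\<lambda>z \<tau>. poly p (?y z \<tau>) * e z \<tau>"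
  have "qring n (Suc M) (int d + 1 + w) ?G"
  proof (intro qring.mult mono)
    have "qring n (Suc M) (int d + 1) (\<lambda>z \<tau>. \<Sum>i\<le>degree p. coeff p i * ?y z \<tau> ^ i)"
    proof (intro qring_sum qring_cmult)
      fix i assume "i \<in> {..degree p}"
      then show "qring n (Suc M) (int d + 1) (\<lambda>z \<tau>. ?y z \<tau> ^ i)"
        using p(1) qring_mono[OF qring_power[OF qring_shift_fun[OF assms(3)], of n i], of "int d + 1"] by simp
    qed
    then show "qring n (Suc M) (int d + 1) (\<lambda>z \<tau>. poly p (?y z \<tau>))" by (simp add: poly_altdef)
  qed
  moreover have "?G z \<tau> - ?G (z(M := z M + of_nat n * \<tau>)) \<tau> = ?y z \<tau> ^ d * e z \<tau>" if "apart (Suc M) z \<tau>" for z \<tau>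
    using mono(2) that p(2)[of "?y z \<tau>"] shift_fun_shift[OF assms(3,2) that]
    by (simp add: elliptic_last_def left_diff_distrib[symmetric])
  moreover have "int d + 1 + w = int d + w + 1" by simp
  ultimately show ?case by (intro exI[of _ ?G] conjI allI impI) (simp only:)+
next
  case (add w f g)
  then obtain F G where F: "qring n (Suc M) (w + 1) F"
      "\<And>z \<tau>. apart (Suc M) z \<tau> \<Longrightarrow> F z \<tau> - F (z(M := z M + of_nat n * \<tau>)) \<tau> = f z \<tau>"
    and G: "qring n (Suc M) (w + 1) G"
      "\<And>z \<tau>. apart (Suc M) z \<tau> \<Longrightarrow> G z \<tau> - G (z(M := z M + of_nat n * \<tau>)) \<tau> = g z \<tau>" by blast
  show ?case
    by (intro exI[of _ "\<lambda>z \<tau>. F z \<tau> + G z \<tau>"] conjI allI impI qring.add F(1) G(1))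
       (simp only: add_diff_add F(2) G(2))
qed

section \<open>Integration of one variable\<close>

lemma integral_periodic_shift:
  fixes g :: "real \<Rightarrow> complex"
  assumes cont: "continuous_on UNIV g" and per: "\<And>x. g (x + 1) = g x"
  shows "integral {0..1} (\<lambda>t. g (t + s)) = integral {0..1} g"
proof -
  have perint: "g (x + of_int k) = g x" for x k
  proof (induction k rule: int_induct[of _ 0])
    case (step1 i)
    with per[of "x + of_int i"] show ?case by (simp add: add_ac)
  next
    case (step2 i)
    with per[of "x + of_int (i - 1)"] show ?case by (simp add: add_ac)
  qed simp
  define r where "r = frac s"
  have r: "0 \<le> r" "r < 1" unfolding r_def by (auto simp: frac_lt_1)
  have int: "g integrable_on {a..b}" for a b
    by (intro integrable_continuous_interval continuous_on_subset[OF cont]) auto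
  have "g (t + s) = g (t + r)" for t
    using perint[of "t + r" "\<lfloor>s\<rfloor>"] by (simp add: r_def frac_def)
  then have "integral {0..1} (\<lambda>t. g (t + s)) = integral {0..1} (\<lambda>t. g (t + r))" by simp
  also have "\<dots> = integral {r..1 + r} g"
    using integral_shift_real_ivl[of r r "1 + r" g] by simp
  also have "\<dots> = integral {r..1} g + integral {1..1 + r} g"
    using r int by (intro Henstock_Kurzweil_Integration.integral_combine[symmetric]) auto
  also have "integral {1..1 + r} g = integral {0..r} (\<lambda>x. g (x + 1))"
    using integral_shift_real_ivl[of 1 1 "1 + r" g] by simp
  also have "\<dots> = integral {0..r} g" by (simp add: per)
  also have "integral {r..1} g + integral {0..r} g = integral {0..1} g"
    using r int Henstock_Kurzweil_Integration.integral_combine[of 0 r 1 g] by (simp add: add.commute)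
  finally show ?thesis .
qed

lemma contour_integral_linepath_unit:
  assumes "continuous_on (closed_segment (Complex x y) (Complex (x + 1) y)) G"
  shows "contour_integral (linepath (Complex x y) (Complex (x + 1) y)) G = integral {0..1} (\<lambda>t. G (of_real (t + x) + \<i> * of_real y))"
proof -
  have "linepath (Complex x y) (Complex (x + 1) y) t = of_real (t + x) + \<i> * of_real y" for t
    by (simp add: linepath_def complex_eq_iff algebra_simps)
  moreover have "Complex (x + 1) y - Complex x y = 1" by (simp add: complex_eq_iff)
  ultimately show ?thesis
    using has_contour_integral_integral[OF contour_integrable_continuous_linepath[OF assms]]
    unfolding has_contour_integral_linepath by (simp add: integral_unique[symmetric])
qed

text \<open>This will place the vertical sides of a rectangle off all translates of finitely many
  poles.\<close>

lemma exists_generic_real: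
  assumes "finite (P :: real set)"
  shows "\<exists>x. \<forall>p\<in>P. p - x \<notin> \<int>"
proof -
  have "countable (\<Union>p\<in>P. range (\<lambda>k::int. p - of_int k))"
    using assms by (intro countable_UN countable_finite[OF assms] countable_image) auto
  then obtain x where "x \<notin> (\<Union>p\<in>P. range (\<lambda>k::int. p - of_int k))"
    using uncountable_UNIV_real by (metis UNIV_eq_I)
  then have "p - x \<notin> \<int>" if "p \<in> P" for p
    using that by (auto elim!: Ints_cases simp: algebra_simps)
  then show ?thesis by blast
qed

lemma path_image_rectpath_segments:
  "path_image (rectpath (Complex x y) (Complex x' y')) =
     closed_segment (Complex x y) (Complex x' y) \<union> closed_segment (Complex x' y) (Complex x' y') \<union>
     closed_segment (Complex x' y') (Complex x y') \<union> closed_segment (Complex x y') (Complex x y)"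
  by (simp add: rectpath_def Let_def path_image_join Un_assoc)

text \<open>The two vertical sides cancel by periodicity, and the top side is traversed
  backwards.\<close>

lemma contour_integral_rectpath_periodic:
  assumes cont: "continuous_on (path_image (rectpath (Complex x y) (Complex (x + 1) y'))) G"
    and per: "\<And>t. t \<in> closed_segment y y' \<Longrightarrow> G (Complex (x + 1) t) = G (Complex x t)"
  shows "contour_integral (rectpath (Complex x y) (Complex (x + 1) y')) G =
    integral {0..1} (\<lambda>t. G (of_real (t + x) + \<i> * of_real y)) - integral {0..1} (\<lambda>t. G (of_real (t + x) + \<i> * of_real y'))"
proof -
  let ?a = "Complex x y" and ?b = "Complex (x + 1) y" and ?c = "Complex (x + 1) y'" and ?d = "Complex x y'"
  have c: "continuous_on (closed_segment ?a ?b) G" "continuous_on (closed_segment ?b ?c) G"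
    "continuous_on (closed_segment ?c ?d) G" "continuous_on (closed_segment ?d ?a) G"
    by (rule continuous_on_subset[OF cont], unfold path_image_rectpath_segments, blast)+
  have c': "continuous_on (closed_segment ?d ?c) G" "continuous_on (closed_segment ?a ?d) G"
    using c by (simp_all add: closed_segment_commute)
  note i = c[THEN contour_integrable_continuous_linepath]
  have "contour_integral (rectpath ?a ?c) G =
     contour_integral (linepath ?a ?b) G + (contour_integral (linepath ?b ?c) G +
       (contour_integral (linepath ?c ?d) G + contour_integral (linepath ?d ?a) G))"
    unfolding rectpath_def Let_def complex.sel using i by (simp add: contour_integrable_join)
  moreover have "contour_integral (linepath ?c ?d) G = - contour_integral (linepath ?d ?c) G"
    by (rule contour_integral_reverse_linepath[OF c(3)])
  moreover have "contour_integral (linepath ?d ?a) G = - contour_integral (linepath ?a ?d) G"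
    by (rule contour_integral_reverse_linepath[OF c(4)])
  moreover have "contour_integral (linepath ?b ?c) G = contour_integral (linepath ?a ?d) G"
  proof -
    have "linepath ?b ?c t = Complex (x + 1) (linepath y y' t)" "linepath ?a ?d t = Complex x (linepath y y' t)" for t
      by (simp_all add: linepath_def complex_eq_iff algebra_simps)
    moreover have "linepath y y' t \<in> closed_segment y y'" if "t \<in> {0..1}" for t
      using that by (metis linepath_in_path)
    ultimately have G: "G (linepath ?b ?c t) = G (linepath ?a ?d t)" if "t \<in> {0..1}" for t
      using per that by metis
    have "?c - ?b = ?d - ?a" by (simp add: complex_eq_iff)
    then have "(G has_contour_integral I) (linepath ?b ?c) \<longleftrightarrow> (G has_contour_integral I) (linepath ?a ?d)" for I
      unfolding has_contour_integral_linepath using G by (intro has_integral_cong) simp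
    then show ?thesis
      using has_contour_integral_integral[OF i(2)] contour_integral_unique by metis
  qed
  ultimately show ?thesis
    using contour_integral_linepath_unit[OF c(1)] contour_integral_linepath_unit[OF c'(1)] by simp
qed

text \<open>The set L is discrete and 1-periodic and contains all singularities; P represents,
  modulo 1, its points in the strip. The residue theorem is applied to a rectangle of width 1 with
  generic sides, and 1-periodicity moves the horizontal integrals back to [0, 1].\<close>

lemma strip_integral:
  assumes h: "h > 0"
    and hol: "G holomorphic_on - L"
    and fin: "\<And>B. finite (L \<inter> cball 0 B)"
    and L1: "\<And>u. u + 1 \<in> L \<longleftrightarrow> u \<in> L"
    and per: "\<And>u. u \<notin> L \<Longrightarrow> G (u + 1) = G u"
    and P: "finite P" "P \<subseteq> L" "\<And>p. p \<in> P \<Longrightarrow> a < Im p \<and> Im p < a + h"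
    and inj: "\<And>p p'. p \<in> P \<Longrightarrow> p' \<in> P \<Longrightarrow> p - p' \<in> \<int> \<Longrightarrow> p = p'"
    and cover: "\<And>u. u \<in> L \<Longrightarrow> a \<le> Im u \<Longrightarrow> Im u \<le> a + h \<Longrightarrow> \<exists>p\<in>P. u - p \<in> \<int>"
  shows "integral {0..1} (\<lambda>t. G (of_real t + \<i> * of_real a)) - integral {0..1} (\<lambda>t. G (of_real t + \<i> * of_real (a + h)))
     = 2 * of_real pi * \<i> * (\<Sum>p\<in>P. residue G p)"
proof -
  have Lint: "u + of_int k \<in> L \<longleftrightarrow> u \<in> L" for u k
  proof (induction k rule: int_induct[of _ 0])
    case (step1 i)
    with L1[of "u + of_int i"] show ?case by (simp add: add_ac)
  next
    case (step2 i)
    with L1[of "u + of_int (i - 1)"] show ?case by (simp add: add_ac)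
  qed simp
  have perint: "G (u + of_int k) = G u" if "u \<notin> L" for u k
  proof (induction k rule: int_induct[of _ 0])
    case (step1 i)
    with per[of "u + of_int i"] Lint[of u i] that show ?case by (simp add: add_ac)
  next
    case (step2 i)
    with per[of "u + of_int (i - 1)"] Lint[of u "i - 1"] that show ?case by (simp add: add_ac)
  qed simp
  have near: "\<forall>\<^sub>F x in at p. x \<notin> L" for p
  proof -
    let ?U = "ball 0 (norm p + 1) - (L \<inter> cball 0 (norm p + 1) - {p})"
    have "open ?U" using fin by (intro open_Diff finite_imp_closed) auto
    then have "\<forall>\<^sub>F x in at p. x \<in> ?U - {p}" by (intro eventually_at_in_open) auto
    then show ?thesis by eventually_elim auto
  qed
  have resint: "residue G (p + of_int k) = residue G p" for p k
  proof -
    have "\<forall>\<^sub>F x in at p. G (of_int k + x) = G x"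
      using near[of p] by eventually_elim (use perint[of _ k] in \<open>simp add: add.commute\<close>)
    then have "residue (\<lambda>x. G (of_int k + x)) p = residue G p" by (rule residue_cong) simp
    then show ?thesis
      using residue_shift_0[of G "p + of_int k"] residue_shift_0[of "\<lambda>x. G (of_int k + x)" p] by (simp add: add_ac)
  qed
  obtain x0 where "\<forall>x\<in>Re ` P. x - x0 \<notin> \<int>"
    using exists_generic_real[OF finite_imageI[OF P(1), of Re]] by (elim exE)
  then have x0: "\<And>p. p \<in> P \<Longrightarrow> Re p - x0 \<notin> \<int>" by simp
  \<comment> \<open>Translates each representative to real part between x0 and x0 + 1, hence into
    the rectangle.\<close>
  define r where "r = (\<lambda>p. p + of_int (- \<lfloor>Re p - x0\<rfloor>))"
  have r_bounds: "x0 < Re (r p)" "Re (r p) < x0 + 1" if "p \<in> P" for p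
  proof -
    have "of_int \<lfloor>Re p - x0\<rfloor> \<noteq> Re p - x0" using x0[OF that] by (metis Ints_of_int)
    moreover have "Re (r p) = Re p - of_int \<lfloor>Re p - x0\<rfloor>" by (simp add: r_def)
    ultimately show "x0 < Re (r p)" "Re (r p) < x0 + 1" by linarith+
  qed
  have r_inj: "inj_on r P"
  proof (rule inj_onI)
    fix p p' assume *: "p \<in> P" "p' \<in> P" "r p = r p'"
    then have "p - p' = of_int (\<lfloor>Re p - x0\<rfloor> - \<lfloor>Re p' - x0\<rfloor>)" unfolding r_def by (simp add: algebra_simps)
    then show "p = p'" using * inj by (metis Ints_of_int)
  qed
  let ?A = "Complex x0 a" and ?C = "Complex (x0 + 1) (a + h)"
  have inbox: "r p \<in> box ?A ?C" if "p \<in> P" for p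
    using r_bounds[OF that] P(3)[OF that] by (simp add: in_box_complex_iff r_def)
  have Lbox: "L \<inter> cbox ?A ?C = r ` P"
  proof
    show "r ` P \<subseteq> L \<inter> cbox ?A ?C"
    proof (rule image_subsetI)
      fix p assume p: "p \<in> P"
      have "r p \<in> L" using p P(2) unfolding r_def Lint by (rule subsetD[rotated])
      moreover have "r p \<in> cbox ?A ?C" using inbox[OF p] box_subset_cbox by (rule subsetD[rotated])
      ultimately show "r p \<in> L \<inter> cbox ?A ?C" by simp
    qed
    show "L \<inter> cbox ?A ?C \<subseteq> r ` P"
    proof
      fix u assume u: "u \<in> L \<inter> cbox ?A ?C"
      then obtain p where p: "p \<in> P" "u - p \<in> \<int>"
        using cover[of u] by (auto simp: in_cbox_complex_iff)
      then obtain k where k: "u = p + of_int k" by (metis Ints_cases add.commute diff_add_cancel)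
      have "x0 \<le> Re p + of_int k" "Re p + of_int k \<le> x0 + 1"
        using u unfolding k by (simp_all add: in_cbox_complex_iff)
      moreover have "Re p - x0 \<noteq> of_int (1 - k)" using x0[OF p(1)] by (metis Ints_of_int)
      ultimately have "\<lfloor>Re p - x0\<rfloor> = - k" by (intro floor_unique) auto
      then have "u = r p" unfolding r_def k by simp
      with p(1) show "u \<in> r ` P" by blast
    qed
  qed
  have pim: "path_image (rectpath ?A ?C) = cbox ?A ?C - box ?A ?C"
    using h by (intro path_image_rectpath_cbox_minus_box) auto
  have pL: "path_image (rectpath ?A ?C) \<subseteq> - L"
  proof
    fix u assume u: "u \<in> path_image (rectpath ?A ?C)"
    show "u \<in> - L"
    proof
      assume "u \<in> L"
      with u have "u \<in> r ` P" unfolding pim Lbox[symmetric] by simp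
      with u inbox show False unfolding pim by auto
    qed
  qed
  \<comment> \<open>The residue theorem is used on a disc around the rectangle; singularities of the
    disc outside the rectangle have winding number 0.\<close>
  obtain B where B: "cbox ?A ?C \<subseteq> ball 0 B"
    using bounded_subset_ballD[OF bounded_cbox[of ?A ?C], of 0] by (elim exE conjE)
  define pts where "pts = L \<inter> ball 0 B"
  have "contour_integral (rectpath ?A ?C) G = 2 * pi * \<i> * (\<Sum>p\<in>pts. winding_number (rectpath ?A ?C) p * residue G p)"
  proof (rule Residue_theorem[of "ball 0 B"])
    show "finite pts" unfolding pts_def by (rule finite_subset[OF _ fin[of B]]) auto
    show "G holomorphic_on ball 0 B - pts"
      unfolding pts_def by (rule holomorphic_on_subset[OF hol]) auto
    show "path_image (rectpath ?A ?C) \<subseteq> ball 0 B - pts"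
    proof
      fix u assume u: "u \<in> path_image (rectpath ?A ?C)"
      then have "u \<in> ball 0 B" using B unfolding pim by (meson DiffD1 subsetD)
      moreover have "u \<notin> L" using pL u by (meson ComplD subsetD)
      ultimately show "u \<in> ball 0 B - pts" unfolding pts_def by simp
    qed
    show "\<forall>z. z \<notin> ball 0 B \<longrightarrow> winding_number (rectpath ?A ?C) z = 0"
      using B h by (intro allI impI winding_number_rectpath_outside) auto
  qed auto
  also have "(\<Sum>p\<in>pts. winding_number (rectpath ?A ?C) p * residue G p) = (\<Sum>p\<in>r ` P. residue G p)"
  proof (rule sum.mono_neutral_cong_right)
    show "finite pts" unfolding pts_def by (rule finite_subset[OF _ fin[of B]]) auto
    show "r ` P \<subseteq> pts" unfolding pts_def Lbox[symmetric] using B by (intro Int_mono) auto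
    show "\<forall>p\<in>pts - r ` P. winding_number (rectpath ?A ?C) p * residue G p = 0"
    proof
      fix p assume "p \<in> pts - r ` P"
      then have "p \<notin> cbox ?A ?C" unfolding pts_def Lbox[symmetric] by simp
      then show "winding_number (rectpath ?A ?C) p * residue G p = 0"
        using winding_number_rectpath_outside[of ?A ?C p] h by simp
    qed
    show "winding_number (rectpath ?A ?C) p * residue G p = residue G p" if "p \<in> r ` P" for p
      using winding_number_rectpath[of p ?A ?C] inbox that by auto
  qed
  also have "\<dots> = (\<Sum>p\<in>P. residue G p)"
    unfolding sum.reindex[OF r_inj] o_def by (intro sum.cong refl) (simp only: r_def resint)
  finally have 1: "contour_integral (rectpath ?A ?C) G = 2 * of_real pi * \<i> * (\<Sum>p\<in>P. residue G p)" by simp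
  have contL: "continuous_on (- L) G" using hol by (rule holomorphic_on_imp_continuous_on)
  have line: "integral {0..1} (\<lambda>t. G (of_real (t + x0) + \<i> * of_real y)) = integral {0..1} (\<lambda>t. G (of_real t + \<i> * of_real y))"
    if y: "y = a \<or> y = a + h" for y
  proof -
    have notL: "of_real t + \<i> * of_real y \<notin> L" for t
    proof
      assume L: "of_real t + \<i> * of_real y \<in> L"
      then obtain p where p: "p \<in> P" "of_real t + \<i> * of_real y - p \<in> \<int>"
        using cover[OF L] y h by auto
      then obtain k where "of_real t + \<i> * of_real y - p = of_int k" by (elim Ints_cases)
      from arg_cong[OF this, of Im] have "Im p = y" by simp
      with P(3)[OF p(1)] y show False by auto
    qed
    show ?thesis
    proof (rule integral_periodic_shift)
      show "continuous_on UNIV (\<lambda>t. G (of_real t + \<i> * of_real y))"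
        using notL by (intro continuous_on_compose2[OF contL] continuous_intros) auto
      show "G (of_real (t + 1) + \<i> * of_real y) = G (of_real t + \<i> * of_real y)" for t
        using per[OF notL[of t]] by (simp add: add_ac)
    qed
  qed
  have "contour_integral (rectpath ?A ?C) G =
    integral {0..1} (\<lambda>t. G (of_real (t + x0) + \<i> * of_real a)) - integral {0..1} (\<lambda>t. G (of_real (t + x0) + \<i> * of_real (a + h)))"
  proof (rule contour_integral_rectpath_periodic)
    show "continuous_on (path_image (rectpath ?A ?C)) G" using contL pL by (rule continuous_on_subset)
    fix t assume "t \<in> closed_segment a (a + h)"
    then have "Complex x0 t \<in> cbox ?A ?C - box ?A ?C"
      using h by (auto simp: in_cbox_complex_iff in_box_complex_iff closed_segment_eq_real_ivl)
    then have "Complex x0 t \<notin> L" using pL unfolding pim by (meson ComplD subsetD)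
    moreover have "Complex (x0 + 1) t = Complex x0 t + 1" by (simp add: complex_eq_iff)
    ultimately show "G (Complex (x0 + 1) t) = G (Complex x0 t)" using per by simp
  qed
  then show ?thesis using 1 line[of a] line[of "a + h"] by simp
qed

text \<open>Unlike \<open>apart\<close>, this depends on imaginary parts only, so it keeps whole
  horizontal lines off the poles while the real parts vary.\<close>

definition heights_apart :: "nat \<Rightarrow> (nat \<Rightarrow> complex) \<Rightarrow> complex \<Rightarrow> bool" where
  "heights_apart M z \<tau> \<longleftrightarrow> Im \<tau> > 0 \<and> (\<forall>i<M. \<forall>j<M. i \<noteq> j \<longrightarrow> (Im (z i) - Im (z j)) / Im \<tau> \<notin> \<int>)"

lemma heights_apart_imp_apart: "heights_apart M z \<tau> \<Longrightarrow> apart M z \<tau>"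
  unfolding heights_apart_def apart_def by (auto simp: mem_lattice_coords)

lemma heights_apart_Suc:
  "heights_apart (Suc M) z \<tau> \<longleftrightarrow> heights_apart M z \<tau> \<and> (\<forall>j<M. (Im (z M) - Im (z j)) / Im \<tau> \<notin> \<int>)"
proof -
  have "(Im (z j) - Im (z M)) / Im \<tau> \<in> \<int> \<longleftrightarrow> (Im (z M) - Im (z j)) / Im \<tau> \<in> \<int>" for j
  proof -
    have "(Im (z M) - Im (z j)) / Im \<tau> = - ((Im (z j) - Im (z M)) / Im \<tau>)" by (simp add: diff_divide_distrib)
    then show ?thesis using minus_in_Ints_iff[of "(Im (z j) - Im (z M)) / Im \<tau>"] by simp
  qed
  then show ?thesis unfolding heights_apart_def by (auto simp: less_Suc_eq)
qed

lemma finite_lattice_translates_cball: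
  fixes M :: nat
  assumes "Im \<tau> > 0"
  shows "finite ({u. \<exists>j<M. u - z j \<in> lattice \<tau>} \<inter> cball 0 B)"
proof -
  have "{u. \<exists>j<M. u - z j \<in> lattice \<tau>} \<inter> cball 0 B \<subseteq>
     (\<Union>j<M. (\<lambda>p. z j + lattice_point \<tau> p) ` {p. norm (lattice_point \<tau> p) \<le> B + norm (z j)})"
  proof
    fix u assume u: "u \<in> {u. \<exists>j<M. u - z j \<in> lattice \<tau>} \<inter> cball 0 B"
    then obtain j p where j: "j < M" "u - z j = lattice_point \<tau> p" by auto
    have "norm (lattice_point \<tau> p) \<le> B + norm (z j)"
      using norm_triangle_ineq4[of u "z j"] u j(2) by simp
    moreover have "u = z j + lattice_point \<tau> p" using j(2) by (simp add: algebra_simps)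
    ultimately show "u \<in> (\<Union>j<M. (\<lambda>p. z j + lattice_point \<tau> p) ` {p. norm (lattice_point \<tau> p) \<le> B + norm (z j)})"
      using j(1) by blast
  qed
  moreover have "finite ((\<lambda>p. z j + lattice_point \<tau> p) ` {p. norm (lattice_point \<tau> p) \<le> B + norm (z j)})" for j
    by (intro finite_imageI finite_lattice_points assms)
  then have "finite (\<Union>j<M. (\<lambda>p. z j + lattice_point \<tau> p) ` {p. norm (lattice_point \<tau> p) \<le> B + norm (z j)})"
    by (intro finite_UN_I[OF finite_lessThan])
  ultimately show ?thesis by (rule finite_subset)
qed

text \<open>A single variable admits no pair of distinct indices, so there are no Eisenstein
  generators.\<close>

lemma qring_Suc_0:
  assumes "qring n (Suc 0) w f"
  shows "qring n 0 w f \<and> (\<forall>z z' \<tau>. f z \<tau> = f z' \<tau>)"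
  using assms
proof (induction rule: qring.induct)
  case (add w f g)
  have "f z \<tau> + g z \<tau> = f z' \<tau> + g z' \<tau>" for z z' \<tau>
    by (rule arg_cong2[of _ _ _ _ "(+)"]) (use add.IH in blast)+
  moreover have "qring n 0 w (\<lambda>z \<tau>. f z \<tau> + g z \<tau>)" by (intro qring.add) (use add.IH in blast)+
  ultimately show ?case by blast
next
  case (mult v f w g)
  have "f z \<tau> * g z \<tau> = f z' \<tau> * g z' \<tau>" for z z' \<tau>
    by (rule arg_cong2[of _ _ _ _ "(*)"]) (use mult.IH in blast)+
  moreover have "qring n 0 (v + w) (\<lambda>z \<tau>. f z \<tau> * g z \<tau>)" by (intro qring.mult) (use mult.IH in blast)+
  ultimately show ?case by blast
qed (auto intro: qring.quasi)

text \<open>The order of quantifiers matters: the integers q j decide which poles lie in the strip,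
  and for them one ring element g is valid for all z and \<tau>.\<close>

lemma integrate_last_coordinate:
  assumes f: "qring n (Suc M) w f" and n: "n \<ge> 1"
  shows "\<exists>g. qring n M w g \<and> (\<forall>z \<tau>. heights_apart (Suc M) z \<tau> \<longrightarrow> (\<forall>j<M. \<lfloor>(Im (z M) - Im (z j)) / Im \<tau>\<rfloor> = q j) \<longrightarrow>
     integral {0..1} (\<lambda>t. f (z(M := of_real t + \<i> * of_real (Im (z M)))) \<tau>) = g z \<tau>)"
proof (cases "M = 0")
  case True
  have "f (z(M := u)) \<tau> = f z \<tau>" for z u \<tau> using qring_Suc_0[of n w f] f True by blast
  then have "integral {0..1} (\<lambda>t. f (z(M := of_real t + \<i> * of_real (Im (z M)))) \<tau>) = f z \<tau>" for z \<tau>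
    by (simp only: integral_const_real) simp
  then show ?thesis using qring_Suc_0[of n w f] f True by (intro exI[of _ f]) blast
next
  case False
  then have M: "0 < M" by simp
  obtain G where G: "qring n (Suc M) (w + 1) G"
    "\<And>z \<tau>. apart (Suc M) z \<tau> \<Longrightarrow> G z \<tau> - G (z(M := z M + of_nat n * \<tau>)) \<tau> = f z \<tau>"
    using yring_antidifference[OF qring_yring[OF f n M] n M] by blast
  have "\<exists>\<rho>. qring n M w \<rho> \<and> (\<forall>z \<tau>. apart M z \<tau> \<longrightarrow> residue (\<lambda>u. G (z(M := u)) \<tau>) (z j + of_int k * \<tau>) = \<rho> z \<tau>)" if "j < M" for j k
    using residue_qring[OF G(1) n that, of k] by metis
  then obtain \<rho> where \<rho>: "\<And>j k. j < M \<Longrightarrow> qring n M w (\<rho> j k)"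
    "\<And>j k z \<tau>. j < M \<Longrightarrow> apart M z \<tau> \<Longrightarrow> residue (\<lambda>u. G (z(M := u)) \<tau>) (z j + of_int k * \<tau>) = \<rho> j k z \<tau>"
    by metis
  \<comment> \<open>The quotient (Im (z M) - Im (z j)) / Im \<tau> lies strictly between q j and q j
    + 1. Hence the translates z j + k \<tau> inside the strip of height n Im \<tau> above z M are
    those with q j < k \<le> q j + n.\<close>
  let ?K = "\<lambda>j. {q j + 1..q j + int n}"
  let ?g = "\<lambda>z \<tau>. 2 * of_real pi * \<i> * (\<Sum>j<M. \<Sum>k\<in>?K j. \<rho> j k z \<tau>)"
  have "qring n M w ?g" by (intro qring_cmult qring_sum \<rho>(1)) auto
  moreover have "integral {0..1} (\<lambda>t. f (z(M := of_real t + \<i> * of_real (Im (z M)))) \<tau>) = ?g z \<tau>"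
    if ha: "heights_apart (Suc M) z \<tau>" and q: "\<And>j. j < M \<Longrightarrow> \<lfloor>(Im (z M) - Im (z j)) / Im \<tau>\<rfloor> = q j" for z \<tau>
  proof -
    have \<tau>: "Im \<tau> > 0" using ha by (simp add: heights_apart_def)
    have haM: "heights_apart M z \<tau>" "\<And>j. j < M \<Longrightarrow> (Im (z M) - Im (z j)) / Im \<tau> \<notin> \<int>"
      using ha by (auto simp: heights_apart_Suc)
    have ap: "apart M z \<tau>" using haM(1) by (rule heights_apart_imp_apart)
    define a where "a = Im (z M)"
    define h where "h = of_nat n * Im \<tau>"
    define L where "L = {u. \<exists>j<M. u - z j \<in> lattice \<tau>}"
    define Gu where "Gu = (\<lambda>u. G (z(M := u)) \<tau>)"
    have h: "h > 0" unfolding h_def using n \<tau> by simp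
    define y where "y = (\<lambda>j. (a - Im (z j)) / Im \<tau>)"
    have a: "a = Im (z j) + y j * Im \<tau>" for j unfolding y_def using \<tau> by simp
    have y: "real_of_int (q j) < y j" "y j < real_of_int (q j) + 1" if "j < M" for j
    proof -
      have "q j = \<lfloor>y j\<rfloor>" using q[OF that] by (simp add: y_def a_def)
      moreover have "y j \<noteq> of_int \<lfloor>y j\<rfloor>" using haM(2)[OF that] unfolding y_def a_def by (metis Ints_of_int)
      ultimately show "real_of_int (q j) < y j" "y j < real_of_int (q j) + 1" by linarith+
    qed
    define \<pi> where "\<pi> = (\<lambda>(j, k). z j + of_int k * \<tau>)"
    let ?I = "Sigma {..<M} ?K"
    \<comment> \<open>Poles attached to different variables have different heights, so no residue is
      counted twice.\<close>
    have cross: "j = j'" if "j < M" "j' < M" "Im (z j) + of_int k * Im \<tau> = Im (z j') + of_int k' * Im \<tau>" for j j' and k k' :: int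
    proof (rule ccontr)
      assume ne: "j \<noteq> j'"
      have "(Im (z j) - Im (z j')) / Im \<tau> = of_int (k' - k)" using that(3) \<tau> by (simp add: field_simps)
      then have "(Im (z j) - Im (z j')) / Im \<tau> \<in> \<int>" by (metis Ints_of_int)
      with haM(1) that(1,2) ne show False unfolding heights_apart_def by blast
    qed
    have inj: "p = p'" if p: "p \<in> ?I" "p' \<in> ?I" "\<pi> p - \<pi> p' \<in> \<int>" for p p'
    proof -
      obtain j k j' k' where e: "p = (j, k)" "p' = (j', k')" by (cases p; cases p') auto
      obtain l where "\<pi> p - \<pi> p' = of_int l" using p(3) by (elim Ints_cases)
      from arg_cong[OF this, of Im] have im: "Im (z j) + of_int k * Im \<tau> = Im (z j') + of_int k' * Im \<tau>"
        by (simp add: \<pi>_def e)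
      then have "j = j'" using cross p e by auto
      with im \<tau> show ?thesis by (simp add: e)
    qed
    have injon: "inj_on \<pi> ?I" by (rule inj_onI) (use inj in auto)
    have G1: "Gu (u + 1) = Gu u" if "u \<notin> L" for u
    proof -
      have "apart (Suc M) (z(M := u)) \<tau>" using that by (intro apart_SucI ap) (auto simp: L_def)
      from qring_plus_int[OF G(1) n this, of M 1] show ?thesis by (simp add: Gu_def)
    qed
    have Lper: "u + 1 \<in> L \<longleftrightarrow> u \<in> L" for u
    proof -
      have "u + 1 - z j \<in> lattice \<tau> \<longleftrightarrow> u - z j \<in> lattice \<tau>" for j
        using add_in_lattice_iff[of 1 \<tau> "u - z j"] int_comb_in_lattice[of 1 0 \<tau>] by (simp add: algebra_simps)
      then show ?thesis by (simp add: L_def)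
    qed
    have notL: "of_real t + \<i> * of_real (a + of_int k * h) \<notin> L" for t and k :: int
    proof
      assume "of_real t + \<i> * of_real (a + of_int k * h) \<in> L"
      then obtain j where j: "j < M" "of_real t + \<i> * of_real (a + of_int k * h) - z j \<in> lattice \<tau>" by (auto simp: L_def)
      then obtain l where l: "(a + of_int k * h - Im (z j)) / Im \<tau> = of_int l"
        unfolding mem_lattice_coords[OF \<tau>] by (auto elim!: Ints_cases)
      have "(a - Im (z j)) / Im \<tau> = of_int (l - k * int n)"
        using l \<tau> by (simp add: h_def field_simps)
      then show False using haM(2)[OF j(1)] unfolding a_def by (metis Ints_of_int)
    qed
    have hol: "Gu holomorphic_on - L"
      unfolding Gu_def L_def by (rule qring_holomorphic[OF G(1) n ap])
    have contL: "continuous_on (- L) Gu" using hol by (rule holomorphic_on_imp_continuous_on)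
    have cont: "continuous_on UNIV (\<lambda>t. Gu (of_real t + \<i> * of_real (a + of_int k * h)))" for k :: int
      using notL by (intro continuous_on_compose2[OF contL] continuous_intros) auto
    have "integral {0..1} (\<lambda>t. Gu (of_real t + \<i> * of_real a)) - integral {0..1} (\<lambda>t. Gu (of_real t + \<i> * of_real (a + h)))
     = 2 * of_real pi * \<i> * (\<Sum>p\<in>\<pi> ` ?I. residue Gu p)"
    proof (rule strip_integral[OF h hol])
      show "finite (L \<inter> cball 0 B)" for B unfolding L_def by (rule finite_lattice_translates_cball[OF \<tau>])
      show "\<pi> ` ?I \<subseteq> L"
      proof (rule image_subsetI)
        fix p assume "p \<in> ?I"
        then obtain j k where jk: "j < M" "p = (j, k)" by auto
        have "\<pi> p - z j \<in> lattice \<tau>" using int_comb_in_lattice[of 0 k \<tau>] by (simp add: \<pi>_def jk)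
        with jk(1) show "\<pi> p \<in> L" unfolding L_def by blast
      qed
      show "a < Im p \<and> Im p < a + h" if p: "p \<in> \<pi> ` ?I" for p
      proof -
        obtain j k where jk: "j < M" "k \<in> ?K j" "p = \<pi> (j, k)" using p by auto
        have "y j < of_int k" "of_int k < y j + of_nat n"
          using y[OF jk(1)] jk(2) by auto
        then have "y j * Im \<tau> < of_int k * Im \<tau>" "of_int k * Im \<tau> < (y j + of_nat n) * Im \<tau>"
          using \<tau> by (simp_all only: mult_less_cancel_right_pos)
        then show ?thesis using a[of j] by (simp add: jk(3) \<pi>_def h_def algebra_simps)
      qed
      show "p = p'" if "p \<in> \<pi> ` ?I" "p' \<in> \<pi> ` ?I" "p - p' \<in> \<int>" for p p'
        using that inj by blast
      show "\<exists>p\<in>\<pi> ` ?I. u - p \<in> \<int>" if u: "u \<in> L" "a \<le> Im u" "Im u \<le> a + h" for u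
      proof -
        obtain j l k where j: "j < M" "u - z j = of_int l + of_int k * \<tau>" using u(1) unfolding L_def mem_lattice by blast
        then have e: "u = z j + of_int l + of_int k * \<tau>" by (simp add: algebra_simps)
        have "y j * Im \<tau> \<le> of_int k * Im \<tau>" "of_int k * Im \<tau> \<le> (y j + of_nat n) * Im \<tau>"
          using u(2,3) a[of j] unfolding e h_def by (simp_all add: algebra_simps)
        then have "y j \<le> of_int k" "of_int k \<le> y j + of_nat n"
          using \<tau> by (simp_all only: mult_le_cancel_right_pos)
        then have "q j < k" "k \<le> q j + int n" using y[OF j(1)] by linarith+
        then have "(j, k) \<in> ?I" using j(1) by auto
        then have "\<pi> (j, k) \<in> \<pi> ` ?I" by (rule imageI)
        moreover have "u - \<pi> (j, k) \<in> \<int>" by (simp add: e \<pi>_def)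
        ultimately show ?thesis by (rule bexI[rotated])
      qed
    qed (use G1 Lper in auto)
    moreover have "(\<Sum>p\<in>\<pi> ` ?I. residue Gu p) = (\<Sum>(j, k)\<in>?I. \<rho> j k z \<tau>)"
      unfolding sum.reindex[OF injon] o_def using \<rho>(2)[OF _ ap]
      by (intro sum.cong refl) (auto simp: \<pi>_def Gu_def)
    moreover have "\<dots> = (\<Sum>j<M. \<Sum>k\<in>?K j. \<rho> j k z \<tau>)"
      by (subst sum.Sigma) auto
    moreover have "integral {0..1} (\<lambda>t. f (z(M := of_real t + \<i> * of_real a)) \<tau>) =
      integral {0..1} (\<lambda>t. Gu (of_real t + \<i> * of_real a)) - integral {0..1} (\<lambda>t. Gu (of_real t + \<i> * of_real (a + h)))"
    proof -
      \<comment> \<open>The point u + n \<tau> lies on the upper edge, but displaced by n Re \<tau>;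
        periodicity will remove the displacement under the integral.\<close>
      have "f (z(M := of_real t + \<i> * of_real a)) \<tau> =
        Gu (of_real t + \<i> * of_real a) - Gu (of_real (t + of_nat n * Re \<tau>) + \<i> * of_real (a + h))" for t
      proof -
        have "apart (Suc M) (z(M := of_real t + \<i> * of_real a)) \<tau>"
          using notL[of t 0] by (intro apart_SucI ap) (auto simp: L_def)
        from G(2)[OF this] have "f (z(M := of_real t + \<i> * of_real a)) \<tau> =
           Gu (of_real t + \<i> * of_real a) - Gu (of_real t + \<i> * of_real a + of_nat n * \<tau>)"
          by (simp add: Gu_def)
        moreover have "of_real t + \<i> * of_real a + of_nat n * \<tau> = of_real (t + of_nat n * Re \<tau>) + \<i> * of_real (a + h)"
          by (simp add: complex_eq_iff h_def)
        ultimately show ?thesis by simp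
      qed
      then have "integral {0..1} (\<lambda>t. f (z(M := of_real t + \<i> * of_real a)) \<tau>) =
        integral {0..1} (\<lambda>t. Gu (of_real t + \<i> * of_real a) - Gu (of_real (t + of_nat n * Re \<tau>) + \<i> * of_real (a + h)))"
        by simp
      also have "\<dots> = integral {0..1} (\<lambda>t. Gu (of_real t + \<i> * of_real a)) -
          integral {0..1} (\<lambda>t. Gu (of_real (t + of_nat n * Re \<tau>) + \<i> * of_real (a + h)))"
      proof (rule Henstock_Kurzweil_Integration.integral_diff)
        show "(\<lambda>t. Gu (of_real t + \<i> * of_real a)) integrable_on {0..1}"
          using continuous_on_subset[OF cont[of 0]] by (intro integrable_continuous_interval) auto
        have "continuous_on UNIV (\<lambda>t. Gu (of_real (t + of_nat n * Re \<tau>) + \<i> * of_real (a + of_int 1 * h)))"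
          by (rule continuous_on_compose2[OF cont[of 1]]) (auto intro!: continuous_intros)
        then show "(\<lambda>t. Gu (of_real (t + of_nat n * Re \<tau>) + \<i> * of_real (a + h))) integrable_on {0..1}"
          using continuous_on_subset by (intro integrable_continuous_interval) auto
      qed
      also have "integral {0..1} (\<lambda>t. Gu (of_real (t + of_nat n * Re \<tau>) + \<i> * of_real (a + h))) =
         integral {0..1} (\<lambda>t. Gu (of_real t + \<i> * of_real (a + h)))"
      proof (rule integral_periodic_shift)
        show "continuous_on UNIV (\<lambda>t. Gu (of_real t + \<i> * of_real (a + h)))" using cont[of 1] by simp
        show "Gu (of_real (t + 1) + \<i> * of_real (a + h)) = Gu (of_real t + \<i> * of_real (a + h))" for t
          using G1[OF notL[of t 1]] by (simp add: add_ac)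
      qed
      finally show ?thesis .
    qed
    ultimately show ?thesis unfolding a_def by simp
  qed
  ultimately show ?thesis by (intro exI[of _ ?g]) blast
qed

section \<open>Iterated torus integrals\<close>

lemma qring_cong:
  assumes "qring n M w f" "\<And>i. i < M \<Longrightarrow> z i = z' i"
  shows "f z \<tau> = f z' \<tau>"
  using assms(1) by (induction rule: qring.induct) (auto simp: assms(2))

lemma qring_0:
  assumes "qring n 0 w f"
  shows "\<exists>g\<in>QMod_le (Gamma1 n) w. \<forall>z \<tau>. f z \<tau> = g \<tau>"
  using assms
proof (induction rule: qring.induct)
  case (add w f g)
  then obtain f' g' where "f' \<in> QMod_le (Gamma1 n) w" "\<forall>z \<tau>. f z \<tau> = f' \<tau>"
    "g' \<in> QMod_le (Gamma1 n) w" "\<forall>z \<tau>. g z \<tau> = g' \<tau>" by blast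
  then show ?case by (intro bexI[of _ "\<lambda>\<tau>. f' \<tau> + g' \<tau>"] QMod_le_add) auto
next
  case (mult v f w g)
  then obtain f' g' where "f' \<in> QMod_le (Gamma1 n) v" "\<forall>z \<tau>. f z \<tau> = f' \<tau>"
    "g' \<in> QMod_le (Gamma1 n) w" "\<forall>z \<tau>. g z \<tau> = g' \<tau>" by blast
  then show ?case by (intro bexI[of _ "\<lambda>\<tau>. f' \<tau> * g' \<tau>"] QMod_le_mult Gamma1_subset_SL2Z) auto
qed auto

lemma qring_continuous_on:
  fixes Z :: "'a::topological_space \<Rightarrow> nat \<Rightarrow> complex"
  assumes "qring n M w f" "n \<ge> 1" "\<And>i. i < M \<Longrightarrow> continuous_on S (\<lambda>s. Z s i)" "\<And>s. s \<in> S \<Longrightarrow> apart M (Z s) \<tau>"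
  shows "continuous_on S (\<lambda>s. f (Z s) \<tau>)"
  using assms(1)
proof (induction rule: qring.induct)
  case (eis p q m k)
  show ?case
  proof (cases "S = {}")
    case False
    then have n\<tau>: "Im (of_nat n * \<tau>) > 0" using assms(2,4) by (auto simp: apart_def)
    have c: "continuous_on (- lattice (of_nat n * \<tau>)) (\<lambda>z. eis_fun m z (of_nat n * \<tau>))"
      by (intro continuous_at_imp_continuous_on ballI DERIV_isCont[OF has_field_derivative_eis_fun[OF eis(4) n\<tau>]]) auto
    show ?thesis
    proof (rule continuous_on_compose2[OF c])
      show "continuous_on S (\<lambda>s. Z s p - Z s q - of_int k * \<tau>)"
        by (intro continuous_on_diff continuous_on_const assms(3) eis(1,2))
      show "(\<lambda>s. Z s p - Z s q - of_int k * \<tau>) ` S \<subseteq> - lattice (of_nat n * \<tau>)"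
        using apart_notin[OF assms(4) eis(1-3)] by (intro image_subsetI) simp
    qed
  qed auto
qed (auto intro!: continuous_intros)

definition torus_point :: "(nat \<Rightarrow> real) \<Rightarrow> (nat \<Rightarrow> real) \<Rightarrow> nat \<Rightarrow> complex" where
  "torus_point \<alpha> t = (\<lambda>j. complex_of_real (t j) + \<i> * complex_of_real (\<alpha> j))"

definition generic_heights :: "nat \<Rightarrow> (nat \<Rightarrow> real) \<Rightarrow> complex \<Rightarrow> bool" where
  "generic_heights M \<alpha> \<tau> \<longleftrightarrow> Im \<tau> > 0 \<and> (\<forall>i<M. \<forall>j<M. i \<noteq> j \<longrightarrow> (\<alpha> i - \<alpha> j) / Im \<tau> \<notin> \<int>)"

lemma heights_apart_torus_point: "heights_apart M (torus_point \<alpha> t) \<tau> \<longleftrightarrow> generic_heights M \<alpha> \<tau>"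
  by (simp add: heights_apart_def generic_heights_def torus_point_def)

lemma apart_torus_point: "generic_heights M \<alpha> \<tau> \<Longrightarrow> apart M (torus_point \<alpha> t) \<tau>"
  using heights_apart_torus_point heights_apart_imp_apart by blast

lemma torus_point_upd: "torus_point \<alpha> (t(j := y)) = (torus_point \<alpha> t)(j := of_real y + \<i> * of_real (\<alpha> j))"
  by (auto simp: torus_point_def)

text \<open>On the torus a generator depends on t p - t q alone, which ranges over [-1, 1]. It is
  therefore a continuous function of one real variable composed with a measurable map, and
  compactness bounds it.\<close>

lemma qring_torus_measurable:
  assumes "qring n M w f" "n \<ge> 1" "generic_heights M \<alpha> \<tau>"
  shows "(\<lambda>t. f (torus_point \<alpha> t) \<tau>) \<in> borel_measurable (\<Pi>\<^sub>M j\<in>{..<M}. lborel)"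
    and "\<exists>B. \<forall>t. (\<forall>j<M. t j \<in> {0..1}) \<longrightarrow> norm (f (torus_point \<alpha> t) \<tau>) \<le> B"
proof -
  have "(\<lambda>t. f (torus_point \<alpha> t) \<tau>) \<in> borel_measurable (\<Pi>\<^sub>M j\<in>{..<M}. lborel) \<and>
    (\<exists>B. \<forall>t. (\<forall>j<M. t j \<in> {0..1}) \<longrightarrow> norm (f (torus_point \<alpha> t) \<tau>) \<le> B)"
    using assms(1)
  proof (induction rule: qring.induct)
    case (quasi g w)
    show ?case by auto
  next
    case (eis p q m k)
    define h where "h = (\<lambda>x. eis_fun m (of_real x + \<i> * of_real (\<alpha> p - \<alpha> q) - of_int k * \<tau>) (of_nat n * \<tau>))"
    have h: "eis_fun m (torus_point \<alpha> t p - torus_point \<alpha> t q - of_int k * \<tau>) (of_nat n * \<tau>) = h (t p - t q)" for t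
      unfolding h_def torus_point_def by (rule arg_cong[of _ _ "\<lambda>z. eis_fun m z (of_nat n * \<tau>)"]) (simp add: algebra_simps)
    have "continuous_on UNIV (\<lambda>x. eis_fun m (torus_point \<alpha> ((\<lambda>_. 0)(p := x)) p - torus_point \<alpha> ((\<lambda>_. 0)(p := x)) q - of_int k * \<tau>) (of_nat n * \<tau>))"
    proof (rule qring_continuous_on[OF qring.eis[OF eis] assms(2) _ apart_torus_point[OF assms(3)]])
      show "continuous_on UNIV (\<lambda>x. torus_point \<alpha> ((\<lambda>_. 0)(p := x)) i)" for i
        by (cases "i = p") (auto simp: torus_point_def intro!: continuous_intros)
    qed
    then have cont: "continuous_on UNIV h" unfolding h using eis(3) by simp
    have hm: "h \<in> borel_measurable borel" using cont by (rule borel_measurable_continuous_onI)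
    have comp: "(\<lambda>t. t i) \<in> borel_measurable (\<Pi>\<^sub>M j\<in>{..<M}. lborel)" if "i < M" for i :: nat
      using measurable_component_singleton[of i "{..<M}" "\<lambda>_. lborel :: real measure"] that by simp
    have "(\<lambda>t. h (t p - t q)) \<in> borel_measurable (\<Pi>\<^sub>M j\<in>{..<M}. lborel)"
      by (intro measurable_compose[OF _ hm] borel_measurable_diff comp eis)
    moreover have "compact (h ` {-1..1})"
      by (intro compact_continuous_image continuous_on_subset[OF cont]) auto
    then obtain B where B: "\<And>x. x \<in> {-1..1} \<Longrightarrow> norm (h x) \<le> B"
      using compact_imp_bounded bounded_iff by (metis image_eqI)
    have "norm (h (t p - t q)) \<le> B" if "\<forall>j<M. t j \<in> {0..1}" for t
      using that[rule_format, OF eis(1)] that[rule_format, OF eis(2)] by (intro B) auto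
    ultimately show ?case unfolding h by blast
  next
    case (add w f g)
    then obtain B C where "\<And>t. (\<forall>j<M. t j \<in> {0..1}) \<Longrightarrow> norm (f (torus_point \<alpha> t) \<tau>) \<le> B"
      "\<And>t. (\<forall>j<M. t j \<in> {0..1}) \<Longrightarrow> norm (g (torus_point \<alpha> t) \<tau>) \<le> C" by blast
    then have "norm (f (torus_point \<alpha> t) \<tau> + g (torus_point \<alpha> t) \<tau>) \<le> B + C" if "\<forall>j<M. t j \<in> {0..1}" for t
      using that by (intro norm_triangle_mono) auto
    with add.IH show ?case by (intro conjI borel_measurable_add) blast+
  next
    case (mult v f w g)
    then obtain B C where "\<And>t. (\<forall>j<M. t j \<in> {0..1}) \<Longrightarrow> norm (f (torus_point \<alpha> t) \<tau>) \<le> B"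
      "\<And>t. (\<forall>j<M. t j \<in> {0..1}) \<Longrightarrow> norm (g (torus_point \<alpha> t) \<tau>) \<le> C" by blast
    then have "norm (f (torus_point \<alpha> t) \<tau> * g (torus_point \<alpha> t) \<tau>) \<le> B * C" if "\<forall>j<M. t j \<in> {0..1}" for t
      unfolding norm_mult using that by (intro mult_mono') auto
    with mult.IH show ?case by (intro conjI borel_measurable_times) blast+
  qed
  then show "(\<lambda>t. f (torus_point \<alpha> t) \<tau>) \<in> borel_measurable (\<Pi>\<^sub>M j\<in>{..<M}. lborel)"
    and "\<exists>B. \<forall>t. (\<forall>j<M. t j \<in> {0..1}) \<longrightarrow> norm (f (torus_point \<alpha> t) \<tau>) \<le> B" by blast+
qed

lemma qring_torus_integrable:
  assumes "qring n M w f" "n \<ge> 1" "generic_heights M \<alpha> \<tau>"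
  shows "integrable (\<Pi>\<^sub>M j\<in>{..<M}. lborel)
    (\<lambda>t. indicator (\<Pi>\<^sub>E j\<in>{..<M}. {0..1}) t *\<^sub>R f (torus_point \<alpha> t) \<tau>)"
proof -
  interpret product_sigma_finite "\<lambda>_::nat. lborel :: real measure"
    by (simp add: product_sigma_finite_def sigma_finite_lborel)
  obtain B where B: "\<And>t. (\<forall>j<M. t j \<in> {0..1}) \<Longrightarrow> norm (f (torus_point \<alpha> t) \<tau>) \<le> B"
    using qring_torus_measurable(2)[OF assms] by blast
  have em: "emeasure (\<Pi>\<^sub>M j\<in>{..<M}. lborel) (\<Pi>\<^sub>E j\<in>{..<M}. {0..1::real}) = 1"
    by (subst emeasure_PiM) auto
  show ?thesis
  proof (rule integrableI_bounded_set_indicator)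
    show "(\<Pi>\<^sub>E j\<in>{..<M}. {0..1::real}) \<in> sets (\<Pi>\<^sub>M j\<in>{..<M}. lborel)"
      by (rule sets_PiM_I_finite) auto
    show "emeasure (\<Pi>\<^sub>M j\<in>{..<M}. lborel) (\<Pi>\<^sub>E j\<in>{..<M}. {0..1::real}) < \<infinity>" unfolding em by simp
    show "AE t in (\<Pi>\<^sub>M j\<in>{..<M}. lborel). t \<in> (\<Pi>\<^sub>E j\<in>{..<M}. {0..1}) \<longrightarrow> norm (f (torus_point \<alpha> t) \<tau>) \<le> B"
      by (intro AE_I2 impI B) (auto simp: PiE_def Pi_def)
  qed (rule qring_torus_measurable(1)[OF assms])
qed

text \<open>Fubini for an arbitrary coordinate j: the last one is split off in the induction on the
  number of variables, any other one when a height is shifted by a period.\<close>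

lemma torus_integral_split:
  assumes f: "qring n M w f" "n \<ge> 1" and gen: "generic_heights M \<alpha> \<tau>" and j: "j < M"
  shows "torus_integral M f \<alpha> \<tau> =
    (LINT t:(\<Pi>\<^sub>E i\<in>{..<M} - {j}. {0..1})|(\<Pi>\<^sub>M i\<in>{..<M} - {j}. lborel).
       integral {0..1} (\<lambda>y. f ((torus_point \<alpha> t)(j := of_real y + \<i> * of_real (\<alpha> j))) \<tau>))"
proof -
  interpret product_sigma_finite "\<lambda>_::nat. lborel :: real measure"
    by (simp add: product_sigma_finite_def sigma_finite_lborel)
  let ?I = "{..<M} - {j}"
  have ins: "{..<M} = insert j ?I" using j by auto
  let ?F = "\<lambda>t. indicator (\<Pi>\<^sub>E j\<in>{..<M}. {0..1::real}) t *\<^sub>R f (torus_point \<alpha> t) \<tau>"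
  have "torus_integral M f \<alpha> \<tau> = integral\<^sup>L (\<Pi>\<^sub>M j\<in>{..<M}. lborel) ?F"
    by (simp add: torus_integral_def set_lebesgue_integral_def torus_point_def)
  also have "\<dots> = (\<integral>t. (\<integral>y. ?F (t(j := y)) \<partial>lborel) \<partial>(\<Pi>\<^sub>M i\<in>?I. lborel))"
    using product_integral_insert[of ?I j ?F] qring_torus_integrable[OF f gen] unfolding ins[symmetric] by simp
  also have "\<dots> = (\<integral>t. indicator (\<Pi>\<^sub>E i\<in>?I. {0..1}) t *\<^sub>R
       integral {0..1} (\<lambda>y. f ((torus_point \<alpha> t)(j := of_real y + \<i> * of_real (\<alpha> j))) \<tau>) \<partial>(\<Pi>\<^sub>M i\<in>?I. lborel))"
  proof (rule Bochner_Integration.integral_cong[OF refl])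
    fix t assume t: "t \<in> space (\<Pi>\<^sub>M i\<in>?I. (lborel :: real measure))"
    then have ext: "t \<in> extensional ?I" by (simp add: space_PiM PiE_def)
    let ?g = "\<lambda>y. f ((torus_point \<alpha> t)(j := of_real y + \<i> * of_real (\<alpha> j))) \<tau>"
    have ind: "indicator (\<Pi>\<^sub>E j\<in>{..<M}. {0..1}) (t(j := y)) =
       (indicator (\<Pi>\<^sub>E i\<in>?I. {0..1}) t * indicator {0..1} y :: real)" for y
    proof -
      have "t(j := y) \<in> (\<Pi>\<^sub>E j\<in>{..<M}. {0..1}) \<longleftrightarrow> t \<in> (\<Pi>\<^sub>E i\<in>?I. {0..1}) \<and> y \<in> {0..1}"
        using ext j by (auto simp: PiE_def Pi_def extensional_def)
      then show ?thesis by (auto simp: indicator_def)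
    qed
    have "continuous_on UNIV ?g"
    proof (rule qring_continuous_on[OF f])
      show "apart M ((torus_point \<alpha> t)(j := of_real y + \<i> * of_real (\<alpha> j))) \<tau>" for y
        using apart_torus_point[OF gen, of "t(j := y)"] by (simp add: torus_point_upd)
      show "continuous_on UNIV (\<lambda>y. ((torus_point \<alpha> t)(j := of_real y + \<i> * of_real (\<alpha> j))) i)" for i
        by (cases "i = j") (auto intro!: continuous_intros)
    qed
    then have "set_integrable lborel {0..1} ?g"
      by (intro borel_integrable_atLeastAtMost') (rule continuous_on_subset, auto)
    from set_borel_integral_eq_integral(2)[OF this]
    have "(\<integral>y. indicator {0..1} y *\<^sub>R ?g y \<partial>lborel) = integral {0..1} ?g"
      by (simp add: set_lebesgue_integral_def)
    moreover have "(\<integral>y. ?F (t(j := y)) \<partial>lborel) = (\<integral>y. indicator (\<Pi>\<^sub>E i\<in>?I. {0..1}) t *\<^sub>R (indicator {0..1} y *\<^sub>R ?g y) \<partial>lborel)"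
      unfolding ind torus_point_upd by simp
    ultimately show "(\<integral>y. ?F (t(j := y)) \<partial>lborel) = indicator (\<Pi>\<^sub>E i\<in>?I. {0..1}) t *\<^sub>R integral {0..1} ?g"
      by (simp only: Bochner_Integration.integral_scaleR_right)
  qed
  finally show ?thesis by (simp add: set_lebesgue_integral_def)
qed

lemma torus_integral_torus_point:
  "torus_integral M f \<alpha> \<tau> = (LINT t:(\<Pi>\<^sub>E i\<in>{..<M}. {0..1})|(\<Pi>\<^sub>M i\<in>{..<M}. lborel). f (torus_point \<alpha> t) \<tau>)"
  by (simp only: torus_integral_def torus_point_def)

lemma generic_heights_mono: "generic_heights M \<alpha> \<tau> \<Longrightarrow> K \<le> M \<Longrightarrow> generic_heights K \<alpha> \<tau>"
  by (auto simp: generic_heights_def)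

text \<open>The integer parts q are fixed before g is chosen, so one form serves every \<tau>; its
  row \<open>q M\<close> selects the poles when the last variable is integrated out.\<close>

lemma torus_integral_quasimodular:
  assumes "qring n M w f" "n \<ge> 1"
  shows "\<exists>g\<in>QMod_le (Gamma1 n) w. \<forall>\<alpha> \<tau>. generic_heights M \<alpha> \<tau> \<longrightarrow>
    (\<forall>i<M. \<forall>j<M. \<lfloor>(\<alpha> i - \<alpha> j) / Im \<tau>\<rfloor> = q i j) \<longrightarrow> torus_integral M f \<alpha> \<tau> = g \<tau>"
  using assms(1)
proof (induction M arbitrary: f)
  case 0
  obtain g where g: "g \<in> QMod_le (Gamma1 n) w" "\<And>z \<tau>. f z \<tau> = g \<tau>" using qring_0[OF 0] by blast
  have "torus_integral 0 f \<alpha> \<tau> = g \<tau>" for \<alpha> \<tau>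
    by (simp add: torus_integral_def set_lebesgue_integral_def PiM_empty lebesgue_integral_count_space_finite g)
  with g show ?case by blast
next
  case (Suc M)
  obtain h where h: "qring n M w h"
    "\<And>z \<tau>. heights_apart (Suc M) z \<tau> \<Longrightarrow> (\<forall>j<M. \<lfloor>(Im (z M) - Im (z j)) / Im \<tau>\<rfloor> = q M j) \<Longrightarrow>
     integral {0..1} (\<lambda>t. f (z(M := of_real t + \<i> * of_real (Im (z M)))) \<tau>) = h z \<tau>"
    using integrate_last_coordinate[OF Suc.prems assms(2), of "q M"] by blast
  obtain g where g: "g \<in> QMod_le (Gamma1 n) w"
    "\<And>\<alpha> \<tau>. generic_heights M \<alpha> \<tau> \<Longrightarrow> (\<forall>i<M. \<forall>j<M. \<lfloor>(\<alpha> i - \<alpha> j) / Im \<tau>\<rfloor> = q i j) \<Longrightarrow> torus_integral M h \<alpha> \<tau> = g \<tau>"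
    using Suc.IH[OF h(1)] by blast
  have "torus_integral (Suc M) f \<alpha> \<tau> = g \<tau>"
    if gen: "generic_heights (Suc M) \<alpha> \<tau>" and q: "\<forall>i<Suc M. \<forall>j<Suc M. \<lfloor>(\<alpha> i - \<alpha> j) / Im \<tau>\<rfloor> = q i j" for \<alpha> \<tau>
  proof -
    have I: "{..<Suc M} - {M} = {..<M}" by auto
    have "integral {0..1} (\<lambda>y. f ((torus_point \<alpha> t)(M := of_real y + \<i> * of_real (\<alpha> M))) \<tau>) = h (torus_point \<alpha> t) \<tau>" for t
      using h(2)[of "torus_point \<alpha> t" \<tau>] gen q unfolding heights_apart_torus_point by (simp add: torus_point_def)
    then have "torus_integral (Suc M) f \<alpha> \<tau> = torus_integral M h \<alpha> \<tau>"
      using torus_integral_split[OF Suc.prems assms(2) gen, of M] unfolding I torus_integral_torus_point[of M h]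
      by (simp only: lessI)
    also have "\<dots> = g \<tau>"
      using gen q by (intro g(2) generic_heights_mono[OF gen]) auto
    finally show ?thesis .
  qed
  with g(1) show ?case by blast
qed

text \<open>Raising a height by m n Im \<tau> is a translation by m n \<tau>, under which f is
  invariant, followed by a real translation, which the circle integral does not see.\<close>

lemma torus_integral_shift:
  assumes f: "qring n M w f" "n \<ge> 1" and gen: "generic_heights M \<alpha> \<tau>" and j: "j < M"
    and ell: "\<And>z. apart M z \<tau> \<Longrightarrow> f (z(j := z j + of_nat n * \<tau>)) \<tau> = f z \<tau>"
  shows "torus_integral M f (\<alpha>(j := \<alpha> j + of_int m * (of_nat n * Im \<tau>))) \<tau> = torus_integral M f \<alpha> \<tau>"
proof -
  let ?\<alpha> = "\<alpha>(j := \<alpha> j + of_int m * (of_nat n * Im \<tau>))"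
  let ?p = "\<lambda>t y. (torus_point \<alpha> t)(j := of_real y + \<i> * of_real (\<alpha> j))"
  have \<tau>: "Im \<tau> > 0" using gen by (simp add: generic_heights_def)
  have ap: "apart M (?p t y) \<tau>" for t y
    using apart_torus_point[OF gen, of "t(j := y)"] by (simp add: torus_point_upd)
  have lat: "of_int k * (of_nat n * \<tau>) \<in> lattice \<tau>" for k
    using int_comb_in_lattice[of 0 "k * int n" \<tau>] by (simp add: mult_ac)
  have ellm: "f (z(j := z j + of_int k * (of_nat n * \<tau>))) \<tau> = f z \<tau>" if a: "apart M z \<tau>" for z k
  proof -
    define H where "H = (\<lambda>k::int. f (z(j := z j + of_int k * (of_nat n * \<tau>))) \<tau>)"
    have step: "H (k + 1) = H k" for k
    proof -
      have "(z(j := z j + of_int k * (of_nat n * \<tau>)))(j := (z(j := z j + of_int k * (of_nat n * \<tau>))) j + of_nat n * \<tau>) =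
        z(j := z j + of_int (k + 1) * (of_nat n * \<tau>))" by (auto simp: fun_eq_iff algebra_simps)
      with ell[OF apart_shift[OF a lat[of k], of j]] show ?thesis unfolding H_def by (simp only:)
    qed
    have "H k = H 0"
      by (induction k rule: int_induct[of _ 0]) (use step in \<open>simp_all, metis diff_add_cancel\<close>)
    then show ?thesis by (simp add: H_def)
  qed
  have gen': "generic_heights M ?\<alpha> \<tau>"
  proof -
    have "x / Im \<tau> \<in> \<int> \<longleftrightarrow> (x + of_int k * (of_nat n * Im \<tau>)) / Im \<tau> \<in> \<int>" for x k
    proof -
      have "(x + of_int k * (of_nat n * Im \<tau>)) / Im \<tau> = x / Im \<tau> + of_int (k * int n)"
        using \<tau> by (simp add: add_divide_distrib)
      then show ?thesis by (metis Ints_of_int Ints_add Ints_diff add_diff_cancel_right')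
    qed
    from this[of "\<alpha> j - \<alpha> i" m for i] this[of "\<alpha> i - \<alpha> j" "- m" for i] gen show ?thesis
      unfolding generic_heights_def by (auto simp: algebra_simps)
  qed
  have "integral {0..1} (\<lambda>y. f ((torus_point ?\<alpha> t)(j := of_real y + \<i> * of_real (?\<alpha> j))) \<tau>) =
     integral {0..1} (\<lambda>y. f (?p t y) \<tau>)" for t
  proof -
    \<comment> \<open>The real displacement left over after the translation by m n \<tau>.\<close>
    let ?s = "- of_int m * (of_nat n * Re \<tau>)"
    have "f ((torus_point ?\<alpha> t)(j := of_real y + \<i> * of_real (?\<alpha> j))) \<tau> = f (?p t (y + ?s)) \<tau>" for y
    proof -
      have "of_real y + \<i> * of_real (?\<alpha> j) = of_real (y + ?s) + \<i> * of_real (\<alpha> j) + of_int m * (of_nat n * \<tau>)"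
        by (simp add: complex_eq_iff)
      then have "(torus_point ?\<alpha> t)(j := of_real y + \<i> * of_real (?\<alpha> j)) =
          (?p t (y + ?s))(j := ?p t (y + ?s) j + of_int m * (of_nat n * \<tau>))"
        by (auto simp: torus_point_def fun_eq_iff)
      with ellm[OF ap, of t "y + ?s" m] show ?thesis by simp
    qed
    moreover have "integral {0..1} (\<lambda>y. f (?p t (y + ?s)) \<tau>) = integral {0..1} (\<lambda>y. f (?p t y) \<tau>)"
    proof (rule integral_periodic_shift)
      show "continuous_on UNIV (\<lambda>y. f (?p t y) \<tau>)"
      proof (rule qring_continuous_on[OF f _ ap])
        show "continuous_on UNIV (\<lambda>y. ?p t y i)" for i
          by (cases "i = j") (auto intro!: continuous_intros)
      qed
      show "f (?p t (y + 1)) \<tau> = f (?p t y) \<tau>" for y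
        using qring_plus_int[OF f ap[of t y], of j 1] by (simp add: add_ac)
    qed
    ultimately show ?thesis by (simp only:)
  qed
  then show ?thesis
    unfolding torus_integral_split[OF f gen j] torus_integral_split[OF f gen' j] by (simp only:)
qed

section \<open>Chambers\<close>

lemma circle_class_eqD:
  assumes "circle_class n x = circle_class n y"
  shows "\<exists>m::int. y = x + of_nat n * of_int m"
proof -
  have "y \<in> circle_class n y" unfolding circle_class_def by (rule image_eqI[of _ _ 0]) auto
  then show ?thesis unfolding assms[symmetric] by (auto simp: circle_class_def)
qed

lemma circle_class_shift: "circle_class n (x + of_nat n * of_int m) = circle_class n x"
proof -
  have "circle_class n (x + of_nat n * of_int m) = range (\<lambda>k. x + of_nat n * of_int (m + k))"
    by (simp add: circle_class_def algebra_simps)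
  also have "\<dots> = (\<lambda>k. x + of_nat n * of_int k) ` range ((+) m)" by (simp only: image_image)
  also have "\<dots> = circle_class n x" unfolding circle_class_def surj_plus ..
  finally show ?thesis .
qed

text \<open>The full preimage of the image is a union of translates by n times integers. Openness of
  the projection turns small boxes of lifts into neighbourhoods in the torus.\<close>

lemma openin_circle_class_image:
  assumes "open U"
  shows "openin (circle_top n) (circle_class n ` U)"
proof -
  have "circle_class n -` circle_class n ` U = (\<Union>m::int. (\<lambda>x. x + of_nat n * of_int m) -` U)"
  proof (intro set_eqI iffI)
    fix x assume "x \<in> circle_class n -` circle_class n ` U"
    then obtain u where u: "u \<in> U" "circle_class n x = circle_class n u" by auto
    then show "x \<in> (\<Union>m::int. (\<lambda>x. x + of_nat n * of_int m) -` U)" using circle_class_eqD[OF u(2)] by auto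
  next
    fix x assume "x \<in> (\<Union>m::int. (\<lambda>x. x + of_nat n * of_int m) -` U)"
    then obtain m :: int where m: "x + of_nat n * of_int m \<in> U" by auto
    have "circle_class n x = circle_class n (x + of_nat n * of_int m)" by (rule circle_class_shift[symmetric])
    with m show "x \<in> circle_class n -` circle_class n ` U" by auto
  qed
  moreover have "open (\<Union>m::int. (\<lambda>x. x + of_nat n * of_int m) -` U)"
    by (intro open_UN ballI open_vimage assms continuous_intros)
  ultimately show ?thesis unfolding openin_circle_top by auto
qed

definition off_diag :: "nat \<Rightarrow> (nat \<Rightarrow> real) \<Rightarrow> bool" where
  "off_diag N x \<longleftrightarrow> (\<forall>i<N. \<forall>j<N. i \<noteq> j \<longrightarrow> x j - x i \<notin> \<int>)"

lemma torus_class_eqD: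
  assumes "torus_class N n x = torus_class N n y" "j < N"
  shows "\<exists>m::int. y j = x j + of_nat n * of_int m"
proof -
  have "torus_class N n x j = torus_class N n y j" using assms(1) by simp
  then show ?thesis using assms(2) by (intro circle_class_eqD) (simp add: torus_class_def)
qed

text \<open>\<open>off_diagonals\<close> is an image, so some lift avoids the diagonals; every lift
  does, because shifts by multiples of n preserve integrality of differences.\<close>

lemma off_diag_torus_class:
  assumes "torus_class N n x \<in> off_diagonals N n"
  shows "off_diag N x"
proof -
  obtain y where y: "off_diag N y" "torus_class N n x = torus_class N n y"
    using assms unfolding off_diagonals_def off_diag_def by auto
  have "x j - x i \<notin> \<int>" if ij: "i < N" "j < N" "i \<noteq> j" for i j
  proof
    assume *: "x j - x i \<in> \<int>"
    obtain a :: int where a: "y i = x i + of_nat n * of_int a"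
      using torus_class_eqD[OF y(2) ij(1)] by (elim exE)
    obtain b :: int where b: "y j = x j + of_nat n * of_int b"
      using torus_class_eqD[OF y(2) ij(2)] by (elim exE)
    from a b have "y j - y i = (x j - x i) + of_int (int n * (b - a))" by (simp add: algebra_simps)
    then have "y j - y i \<in> \<int>" using * by (metis Ints_add Ints_of_int)
    with y(1) ij show False by (simp add: off_diag_def)
  qed
  then show ?thesis by (simp add: off_diag_def)
qed

text \<open>By \<open>cls\<close> the function P lives on torus classes, and by \<open>loc\<close>
  it is locally constant, as integer parts of non-integral differences survive small perturbations.
  So the sets \<open>V Q\<close> are open, and a connected S cannot meet both the one where P equals
  \<open>P x\<close> and the one where it does not.\<close>

lemma chamber_constant:
  fixes P :: "(nat \<Rightarrow> real) \<Rightarrow> 'c"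
  assumes S: "S \<in> chambers N n"
    and cls: "\<And>x y. off_diag N x \<Longrightarrow> torus_class N n x = torus_class N n y \<Longrightarrow> P x = P y"
    and loc: "\<And>x y. off_diag N x \<Longrightarrow> off_diag N y \<Longrightarrow>
      (\<forall>i<N. \<forall>j<N. \<lfloor>x i - x j\<rfloor> = \<lfloor>y i - y j\<rfloor>) \<Longrightarrow> P x = P y"
    and xy: "torus_class N n x \<in> S" "torus_class N n y \<in> S"
  shows "P x = P y"
proof -
  let ?X = "product_topology (\<lambda>_. circle_top n) {..<N}"
  have conn: "connectedin (subtopology ?X (off_diagonals N n)) S"
    using S unfolding chambers_def by (rule connectedin_connected_components_of)
  have Soff: "S \<subseteq> off_diagonals N n"     using connectedin_subset_topspace[OF conn] unfolding topspace_subtopology by (rule order_trans[OF _ Int_lower2])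
  have xo: "off_diag N x" "off_diag N y" using xy Soff off_diag_torus_class by auto
  define V where "V = (\<lambda>Q. {c. \<exists>u. torus_class N n u = c \<and> off_diag N u \<and> Q (P u)})"
  have openV: "openin (subtopology ?X (off_diagonals N n)) (V Q)" for Q
  proof (subst openin_subopen, intro ballI)
    fix c assume "c \<in> V Q"
    then obtain u where u: "torus_class N n u = c" "off_diag N u" "Q (P u)" by (auto simp: V_def)
    \<comment> \<open>The bound is 2 e because a difference moves by less than 2 e when each
      coordinate moves by less than e.\<close>
    have "\<exists>e>0. \<forall>i<N. \<forall>j<N. i \<noteq> j \<longrightarrow> (\<forall>t. \<bar>t\<bar> < 2 * e \<longrightarrow> \<lfloor>u i - u j + t\<rfloor> = \<lfloor>u i - u j\<rfloor>)"
    proof -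
      have *: "\<exists>e>0. \<forall>t. \<bar>t\<bar> < 2 * e \<longrightarrow> \<lfloor>r + t\<rfloor> = \<lfloor>r\<rfloor>" if "r \<notin> \<int>" for r :: real
      proof -
        have "r \<noteq> of_int \<lfloor>r\<rfloor>" using that by (metis Ints_of_int)
        then have "of_int \<lfloor>r\<rfloor> < r" "r < of_int \<lfloor>r\<rfloor> + 1" by linarith+
        then have "\<bar>t\<bar> < 2 * (min (r - of_int \<lfloor>r\<rfloor>) (of_int \<lfloor>r\<rfloor> + 1 - r) / 2) \<Longrightarrow> \<lfloor>r + t\<rfloor> = \<lfloor>r\<rfloor>" for t
          by (intro floor_unique) (auto simp: min_def split: if_splits)
        then show ?thesis using \<open>of_int \<lfloor>r\<rfloor> < r\<close> \<open>r < of_int \<lfloor>r\<rfloor> + 1\<close>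
          by (intro exI[of _ "min (r - of_int \<lfloor>r\<rfloor>) (of_int \<lfloor>r\<rfloor> + 1 - r) / 2"]) auto
      qed
      let ?I = "{(i, j). i < N \<and> j < N \<and> i \<noteq> j}"
      have fin: "finite ?I" by (rule finite_subset[of _ "{..<N} \<times> {..<N}"]) auto
      have "\<forall>p\<in>?I. \<exists>e>0. \<forall>t. \<bar>t\<bar> < 2 * e \<longrightarrow> \<lfloor>u (fst p) - u (snd p) + t\<rfloor> = \<lfloor>u (fst p) - u (snd p)\<rfloor>"
      proof
        fix p assume p: "p \<in> ?I"
        have "u (fst p) - u (snd p) \<notin> \<int>" using u(2) p unfolding off_diag_def by auto
        then show "\<exists>e>0. \<forall>t. \<bar>t\<bar> < 2 * e \<longrightarrow> \<lfloor>u (fst p) - u (snd p) + t\<rfloor> = \<lfloor>u (fst p) - u (snd p)\<rfloor>" by (rule *)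
      qed
      from bchoice[OF this] obtain e where e': "\<forall>p\<in>?I. e p > 0 \<and>
        (\<forall>t. \<bar>t\<bar> < 2 * e p \<longrightarrow> \<lfloor>u (fst p) - u (snd p) + t\<rfloor> = \<lfloor>u (fst p) - u (snd p)\<rfloor>)" by (elim exE)
      have e: "e p > 0" "\<bar>t\<bar> < 2 * e p \<Longrightarrow> \<lfloor>u (fst p) - u (snd p) + t\<rfloor> = \<lfloor>u (fst p) - u (snd p)\<rfloor>" if "p \<in> ?I" for p t
        using bspec[OF e' that] by blast+
      \<comment> \<open>The element 1 keeps the minimum meaningful when N \<le> 1 and there are no
        pairs.\<close>
      define d where "d = Min (insert 1 (e ` ?I))"
      have "d > 0" unfolding d_def using fin e(1) by (subst Min_gr_iff) auto
      moreover have "d \<le> e p" if "p \<in> ?I" for p unfolding d_def using fin that by (intro Min_le) auto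
      then have "\<lfloor>u i - u j + t\<rfloor> = \<lfloor>u i - u j\<rfloor>" if "i < N" "j < N" "i \<noteq> j" "\<bar>t\<bar> < 2 * d" for i j t
        using e(2)[of "(i, j)" t] that by fastforce
      ultimately show ?thesis by blast
    qed
    then obtain e where e: "e > 0" "\<And>i j t. i < N \<Longrightarrow> j < N \<Longrightarrow> i \<noteq> j \<Longrightarrow> \<bar>t\<bar> < 2 * e \<Longrightarrow> \<lfloor>u i - u j + t\<rfloor> = \<lfloor>u i - u j\<rfloor>"
      by blast
    define W where "W = (\<Pi>\<^sub>E j\<in>{..<N}. circle_class n ` {u j - e<..<u j + e})"
    have "openin ?X W"
      unfolding W_def by (subst openin_PiE) (auto intro!: openin_circle_class_image)
    then have W: "openin (subtopology ?X (off_diagonals N n)) (W \<inter> off_diagonals N n)"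
      unfolding openin_subtopology by blast
    have "c \<in> W" unfolding u(1)[symmetric] W_def torus_class_def using e(1) by (auto simp: PiE_def)
    moreover have "c \<in> off_diagonals N n" using u(1,2) unfolding off_diagonals_def off_diag_def by blast
    moreover have "W \<inter> off_diagonals N n \<subseteq> V Q"
    proof
      fix d assume d: "d \<in> W \<inter> off_diagonals N n"
      have "\<forall>j\<in>{..<N}. \<exists>v. v \<in> {u j - e<..<u j + e} \<and> d j = circle_class n v"
      proof
        fix j assume j: "j \<in> {..<N}"
        have "d j \<in> circle_class n ` {u j - e<..<u j + e}" using d j unfolding W_def by (blast dest: PiE_mem)
        then show "\<exists>v. v \<in> {u j - e<..<u j + e} \<and> d j = circle_class n v" by blast
      qed
      from bchoice[OF this] obtain v where v': "\<forall>j\<in>{..<N}. v j \<in> {u j - e<..<u j + e} \<and> d j = circle_class n (v j)"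
        by (elim exE)
      then have v: "v j \<in> {u j - e<..<u j + e}" "d j = circle_class n (v j)" if "j < N" for j
        using that by auto
      have dv: "torus_class N n v = d"
        using d v(2) by (intro ext) (auto simp: torus_class_def W_def PiE_def extensional_def)
      have vo: "off_diag N v" using d dv off_diag_torus_class by blast
      have "\<lfloor>u i - u j\<rfloor> = \<lfloor>v i - v j\<rfloor>" if "i < N" "j < N" for i j
      proof (cases "i = j")
        case False
        have "\<bar>(v i - u i) - (v j - u j)\<bar> < 2 * e" using v(1)[OF that(1)] v(1)[OF that(2)] by auto
        from e(2)[OF that False this] show ?thesis by simp
      qed simp
      then have "P u = P v" using u(2) vo by (intro loc) auto
      with u(3) dv vo show "d \<in> V Q" unfolding V_def by auto
    qed
    ultimately show "\<exists>T. openin (subtopology ?X (off_diagonals N n)) T \<and> c \<in> T \<and> T \<subseteq> V Q"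
      using W by blast
  qed
  let ?A = "V (\<lambda>p. p = P x)" and ?B = "V (\<lambda>p. p \<noteq> P x)"
  have cover: "off_diagonals N n \<subseteq> ?A \<union> ?B"
    unfolding off_diagonals_def V_def off_diag_def by auto
  have disj: "?A \<inter> ?B = {}"
  proof (rule equals0I)
    fix c assume "c \<in> ?A \<inter> ?B"
    then obtain u v where "torus_class N n u = c" "off_diag N u" "P u = P x" "torus_class N n v = c" "P v \<noteq> P x"
      unfolding V_def by blast
    with cls[of u v] show False by simp
  qed
  show ?thesis
  proof (rule ccontr)
    assume "P x \<noteq> P y"
    then have "torus_class N n y \<in> ?B" using xo(2) unfolding V_def by auto
    then have "?B \<inter> S \<noteq> {}" using xy(2) by blast
    moreover have "torus_class N n x \<in> ?A" using xo(1) unfolding V_def by auto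
    then have "?A \<inter> S \<noteq> {}" using xy(1) by blast
    moreover have "S \<subseteq> ?A \<union> ?B" using Soff cover by (rule order_trans)
    ultimately show False
      using connectedinD[OF conn openV openV] disj by (metis Int_empty_left)
  qed
qed

section \<open>From the rings of elliptic functions and the chambers to the filtered ring\<close>

lemma generic_heights_iff_off_diag:
  assumes "Im \<tau> > 0"
  shows "generic_heights N (\<lambda>j. y j * Im \<tau>) \<tau> \<longleftrightarrow> off_diag N y"
proof -
  have "(y i * Im \<tau> - y j * Im \<tau>) / Im \<tau> = y i - y j" for i j using assms by (simp add: diff_divide_distrib)
  then show ?thesis using assms unfolding generic_heights_def off_diag_def by auto
qed

text \<open>Reducing the coefficient of \<tau> modulo n shows that the n translates of the lattice
  of n \<tau> by k \<tau> together fill the lattice of \<tau>.\<close>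

lemma regular_points_apart:
  assumes "n \<ge> 1"
  shows "(z, \<tau>) \<in> regular_points N n \<longleftrightarrow> apart N z \<tau>"
proof
  assume "apart N z \<tau>"
  then show "(z, \<tau>) \<in> regular_points N n"
    using apart_notin[of N z \<tau> _ _ "int _" n] by (auto simp: regular_points_def upper_half_def apart_def)
next
  assume *: "(z, \<tau>) \<in> regular_points N n"
  have "z i - z j \<notin> lattice \<tau>" if ij: "i < N" "j < N" "i \<noteq> j" for i j
  proof
    assume "z i - z j \<in> lattice \<tau>"
    then obtain a b where ab: "z i - z j = of_int a + of_int b * \<tau>" by (auto simp: mem_lattice)
    define k where "k = nat (b mod int n)"
    have k: "k < n" "b = int k + int n * (b div int n)" using assms by (simp_all add: k_def nat_less_iff)
    have "z i - z j - of_nat k * \<tau> = of_int a + of_int (b div int n) * (of_nat n * \<tau>)"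
      unfolding ab by (subst k(2)) (simp add: algebra_simps)
    then have "z i - z j - of_nat k * \<tau> \<in> lattice (of_nat n * \<tau>)" by (simp only: int_comb_in_lattice)
    with * ij k(1) show False unfolding regular_points_def by auto
  qed
  with * show "apart N z \<tau>" by (auto simp: regular_points_def upper_half_def apart_def)
qed

text \<open>The member f of the ring may take arbitrary values at poles. It is replaced by an
  explicit expression g in Eisenstein functions that agrees with it off the poles and is elliptic in
  every variable.\<close>

lemma graded_part_qring:
  assumes "graded_part N n (gens_Gamma1 N n) w f" "n \<ge> 1"
  shows "\<exists>g. qring n N w g \<and> (\<forall>z \<tau>. apart N z \<tau> \<longrightarrow> g z \<tau> = f z \<tau>) \<and>
    (\<forall>z \<tau> j. apart N z \<tau> \<longrightarrow> j < N \<longrightarrow> g (z(j := z j + of_nat n * \<tau>)) \<tau> = g z \<tau>)"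
  using assms(1)
proof (induction rule: graded_part.induct)
  case (gen w f)
  then show ?case
  proof (cases rule: gens_Gamma1.cases)
    case (1 g)
    then show ?thesis using qring.quasi[OF QMod_leI[of g "Gamma1 n" w w]] by auto
  next
    case (2 i j k s)
    let ?g = "\<lambda>z \<tau>. (-1) ^ s * fact (Suc s) * eis_fun (s + 2) (z i - z j - of_int (int k) * \<tau>) (of_nat n * \<tau>) -
      (if s = 0 then eis_reg 2 0 (of_nat n * \<tau>) else 0)"
    have q: "qring n N (int (s + 2)) ?g"
    proof (intro qring_diff qring_cmult qring.eis 2)
      show "qring n N (int (s + 2)) (\<lambda>z \<tau>. if s = 0 then eis_reg 2 0 (of_nat n * \<tau>) else 0)"
        using qring.quasi[OF QMod_leI[OF eis_reg_0_QMod[OF assms(2), of 2] order.refl], of N] qring_zero by (cases "s = 0") auto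
    qed auto
    have "int (s + 2) = w" using 2(1) by simp
    with q have "qring n N w ?g" by (simp only:)
    moreover have "?g z \<tau> = f z \<tau>" if a: "apart N z \<tau>" for z \<tau>
    proof -
      have "Im (of_nat n * \<tau>) > 0" using a assms(2) by (simp add: apart_def)
      from wp_deriv_eq[OF this apart_notin[OF a 2(3-5), of "int k"], of s] 2 show ?thesis by simp
    qed
    moreover have "?g (z(l := z l + of_nat n * \<tau>)) \<tau> = ?g z \<tau>" if a: "apart N z \<tau>" for z \<tau> l
    proof -
      have n\<tau>: "Im (of_nat n * \<tau>) > 0" using a assms(2) by (simp add: apart_def)
      have per: "eis_fun (s + 2) (u + of_int b * (of_nat n * \<tau>)) (of_nat n * \<tau>) = eis_fun (s + 2) u (of_nat n * \<tau>)" for u b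
        using eis_fun_plus_int_tau[OF _ n\<tau>, of "s + 2" u b] by (simp add: kap_limit_def)
      define b :: int where "b = (if i = l then 1 else if j = l then - 1 else 0)"
      have "(z(l := z l + of_nat n * \<tau>)) i - (z(l := z l + of_nat n * \<tau>)) j - of_int (int k) * \<tau> =
          z i - z j - of_int (int k) * \<tau> + of_int b * (of_nat n * \<tau>)"
        using 2(5) by (auto simp: b_def)
      then show ?thesis by (simp only: per)
    qed
    ultimately show ?thesis by (intro exI[of _ ?g] conjI allI impI) (simp_all only:)
  qed
next
  case (const c)
  show ?case by (intro exI[of _ "\<lambda>z \<tau>. c"]) (auto intro: qring_const)
next
  case (zero w)
  show ?case by (intro exI[of _ "\<lambda>z \<tau>. 0"]) (auto intro: qring_zero)
next
  case (add w f g)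
  then obtain f' g' where f': "qring n N w f'" "\<forall>z \<tau>. apart N z \<tau> \<longrightarrow> f' z \<tau> = f z \<tau>"
      "\<forall>z \<tau> j. apart N z \<tau> \<longrightarrow> j < N \<longrightarrow> f' (z(j := z j + of_nat n * \<tau>)) \<tau> = f' z \<tau>"
    and g': "qring n N w g'" "\<forall>z \<tau>. apart N z \<tau> \<longrightarrow> g' z \<tau> = g z \<tau>"
      "\<forall>z \<tau> j. apart N z \<tau> \<longrightarrow> j < N \<longrightarrow> g' (z(j := z j + of_nat n * \<tau>)) \<tau> = g' z \<tau>" by blast
  let ?h = "\<lambda>z \<tau>. f' z \<tau> + g' z \<tau>"
  have "qring n N w ?h" by (intro qring.add f'(1) g'(1))
  moreover have "?h z \<tau> = f z \<tau> + g z \<tau>" if "apart N z \<tau>" for z \<tau>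
    using f'(2) g'(2) that by simp
  moreover have "?h (z(j := z j + of_nat n * \<tau>)) \<tau> = ?h z \<tau>" if "apart N z \<tau>" "j < N" for z \<tau> j
    using f'(3) g'(3) that by simp
  ultimately show ?case by (intro exI[of _ ?h] conjI allI impI)
next
  case (mult v f w g)
  then obtain f' g' where f': "qring n N v f'" "\<forall>z \<tau>. apart N z \<tau> \<longrightarrow> f' z \<tau> = f z \<tau>"
      "\<forall>z \<tau> j. apart N z \<tau> \<longrightarrow> j < N \<longrightarrow> f' (z(j := z j + of_nat n * \<tau>)) \<tau> = f' z \<tau>"
    and g': "qring n N w g'" "\<forall>z \<tau>. apart N z \<tau> \<longrightarrow> g' z \<tau> = g z \<tau>"
      "\<forall>z \<tau> j. apart N z \<tau> \<longrightarrow> j < N \<longrightarrow> g' (z(j := z j + of_nat n * \<tau>)) \<tau> = g' z \<tau>" by blast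
  let ?h = "\<lambda>z \<tau>. f' z \<tau> * g' z \<tau>"
  have "qring n N (v + w) ?h" by (intro qring.mult f'(1) g'(1))
  moreover have "?h z \<tau> = f z \<tau> * g z \<tau>" if "apart N z \<tau>" for z \<tau>
    using f'(2) g'(2) that by simp
  moreover have "?h (z(j := z j + of_nat n * \<tau>)) \<tau> = ?h z \<tau>" if "apart N z \<tau>" "j < N" for z \<tau> j
    using f'(3) g'(3) that by simp
  ultimately show ?case by (intro exI[of _ ?h] conjI allI impI)
next
  case (agree w f g)
  then show ?case using regular_points_apart[OF assms(2)] by auto
qed

text \<open>Two lifts of one class differ by multiples of n in each coordinate; these are carried
  over one coordinate at a time.\<close>

lemma torus_integral_torus_class:
  assumes f: "qring n N w f" "n \<ge> 1" and \<tau>: "Im \<tau> > 0"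
    and ell: "\<And>z j. apart N z \<tau> \<Longrightarrow> j < N \<Longrightarrow> f (z(j := z j + of_nat n * \<tau>)) \<tau> = f z \<tau>"
    and x: "off_diag N x" and xy: "torus_class N n x = torus_class N n y"
  shows "torus_integral N f (\<lambda>j. x j * Im \<tau>) \<tau> = torus_integral N f (\<lambda>j. y j * Im \<tau>) \<tau>"
proof -
  have "\<forall>j. \<exists>m::int. j < N \<longrightarrow> y j = x j + of_nat n * of_int m"
    using torus_class_eqD[OF xy] by blast
  then obtain m where m: "\<And>j. j < N \<Longrightarrow> y j = x j + of_nat n * of_int (m j)" by metis
  \<comment> \<open>In \<open>X K\<close> the coordinates below K are already moved, so consecutive
    heights differ in one place only. All of them stay generic, as the torus class never
    changes.\<close>
  define X where "X = (\<lambda>K j. if j < K then (x j + of_nat n * of_int (m j)) * Im \<tau> else x j * Im \<tau>)"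
  have gX: "generic_heights N (X K) \<tau>" for K
  proof -
    let ?x = "\<lambda>j. if j < K then x j + of_nat n * of_int (m j) else x j"
    have "torus_class N n ?x = torus_class N n x"
      by (intro ext) (auto simp: torus_class_def circle_class_shift restrict_def)
    moreover have "torus_class N n x \<in> off_diagonals N n"
      using x unfolding off_diagonals_def off_diag_def by blast
    ultimately have "off_diag N ?x" by (intro off_diag_torus_class[of N n]) simp
    then have "generic_heights N (\<lambda>j. ?x j * Im \<tau>) \<tau>" by (rule generic_heights_iff_off_diag[OF \<tau>, THEN iffD2])
    moreover have "(\<lambda>j. ?x j * Im \<tau>) = X K" by (auto simp: X_def)
    ultimately show ?thesis by simp
  qed
  have "torus_integral N f (X K) \<tau> = torus_integral N f (X 0) \<tau>" if "K \<le> N" for K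
    using that
  proof (induction K)
    case (Suc K)
    have "X (Suc K) = (X K)(K := X K K + of_int (m K) * (of_nat n * Im \<tau>))"
      by (auto simp: X_def fun_eq_iff less_Suc_eq algebra_simps)
    then have "torus_integral N f (X (Suc K)) \<tau> = torus_integral N f (X K) \<tau>"
      using torus_integral_shift[OF f gX[of K], of K "m K"] ell Suc.prems by simp
    with Suc show ?case by simp
  qed simp
  from this[OF order.refl] have "torus_integral N f (X N) \<tau> = torus_integral N f (X 0) \<tau>" .
  moreover have "X 0 = (\<lambda>j. x j * Im \<tau>)" by (simp add: X_def)
  moreover have "torus_integral N f (X N) \<tau> = torus_integral N f (\<lambda>j. y j * Im \<tau>) \<tau>"
  proof -
    have "f (\<lambda>j. of_real (t j) + \<i> * of_real (X N j)) \<tau> = f (\<lambda>j. of_real (t j) + \<i> * of_real (y j * Im \<tau>)) \<tau>" for t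
      by (rule qring_cong[OF f(1)]) (simp add: X_def m)
    then show ?thesis by (simp add: torus_integral_def)
  qed
  ultimately show ?thesis by simp
qed

text \<open>A single point x of the chamber, in the rescaled coordinates, is fixed before \<tau>.
  Its integer parts of differences determine the form h, and for each \<tau> the bracket is then
  compared with the integral at the heights x j * Im \<tau>.\<close>

lemma bracket_Gamma1_quasimodular:
  assumes n: "n \<ge> 1" and f: "f \<in> ellring_Gamma1 N n w" and S: "S \<in> chambers N n"
  shows "bracket N n S f \<in> QMod_le (Gamma1 n) w"
proof -
  obtain g where g: "qring n N w g" "\<And>z \<tau>. apart N z \<tau> \<Longrightarrow> g z \<tau> = f z \<tau>"
    "\<And>z \<tau> j. apart N z \<tau> \<Longrightarrow> j < N \<Longrightarrow> g (z(j := z j + of_nat n * \<tau>)) \<tau> = g z \<tau>"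
    using graded_part_qring[of N n w f] f n unfolding ellring_Gamma1_def by blast
  have ne: "S \<noteq> {}" using S unfolding chambers_def by (rule nonempty_connected_components_of)
  have Soff: "S \<subseteq> off_diagonals N n"
    using connectedin_subset_topspace[OF connectedin_connected_components_of[OF S[unfolded chambers_def]]]
    unfolding topspace_subtopology by (rule order_trans[OF _ Int_lower2])
  obtain x where x: "torus_class N n x \<in> S"
    using ne Soff unfolding off_diagonals_def by blast
  have xo: "off_diag N x" using x Soff off_diag_torus_class by blast
  obtain h where h: "h \<in> QMod_le (Gamma1 n) w"
    "\<And>\<alpha> \<tau>. generic_heights N \<alpha> \<tau> \<Longrightarrow> (\<forall>i<N. \<forall>j<N. \<lfloor>(\<alpha> i - \<alpha> j) / Im \<tau>\<rfloor> = \<lfloor>x i - x j\<rfloor>) \<Longrightarrow> torus_integral N g \<alpha> \<tau> = h \<tau>"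
    using torus_integral_quasimodular[OF g(1) n, of "\<lambda>i j. \<lfloor>x i - x j\<rfloor>"] by blast
  show ?thesis
  proof (rule QMod_le_cong[OF h(1)])
    fix \<tau> :: complex assume \<tau>: "Im \<tau> > 0"
    have div: "(u * Im \<tau> - v * Im \<tau>) / Im \<tau> = u - v" for u v using \<tau> by (simp add: diff_divide_distrib)
    let ?P = "\<lambda>y. torus_integral N g (\<lambda>j. y j * Im \<tau>) \<tau>"
    \<comment> \<open>The heights chosen by \<open>SOME\<close> may have other integer parts of
      differences than x, since already lifts of one class differ by multiples of n. Constancy on
      the chamber bridges this.\<close>
    have const: "?P y = ?P x" if "torus_class N n y \<in> S" for y
    proof (rule chamber_constant[where P = ?P, OF S _ _ that x])
      show "?P a = ?P b" if "off_diag N a" "torus_class N n a = torus_class N n b" for a b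
        by (rule torus_integral_torus_class[OF g(1) n \<tau> _ that], rule g(3))
      show "?P a = ?P b" if a: "off_diag N a" and b: "off_diag N b"
        and ab: "\<forall>i<N. \<forall>j<N. \<lfloor>a i - a j\<rfloor> = \<lfloor>b i - b j\<rfloor>" for a b
      proof -
        obtain k where k: "\<And>\<alpha> \<tau>. generic_heights N \<alpha> \<tau> \<Longrightarrow> (\<forall>i<N. \<forall>j<N. \<lfloor>(\<alpha> i - \<alpha> j) / Im \<tau>\<rfloor> = \<lfloor>a i - a j\<rfloor>) \<Longrightarrow> torus_integral N g \<alpha> \<tau> = k \<tau>"
          using torus_integral_quasimodular[OF g(1) n, of "\<lambda>i j. \<lfloor>a i - a j\<rfloor>"] by blast
        have "?P a = k \<tau>"
          using a by (intro k) (simp_all add: generic_heights_iff_off_diag[OF \<tau>] div)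
        moreover have "?P b = k \<tau>"
          using b ab by (intro k) (simp_all add: generic_heights_iff_off_diag[OF \<tau>] div)
        ultimately show ?thesis by simp
      qed
    qed
    define \<alpha> where "\<alpha> = (SOME \<alpha>. \<alpha> \<in> chamber_lifts N n S \<tau>)"
    have "(\<lambda>j. x j * Im \<tau>) \<in> chamber_lifts N n S \<tau>" using x \<tau> by (simp add: chamber_lifts_def)
    then have "\<alpha> \<in> chamber_lifts N n S \<tau>" unfolding \<alpha>_def
      by (rule someI[where P = "\<lambda>\<alpha>. \<alpha> \<in> chamber_lifts N n S \<tau>"])
    then have y: "torus_class N n (\<lambda>j. \<alpha> j / Im \<tau>) \<in> S" by (simp add: chamber_lifts_def)
    then have "off_diag N (\<lambda>j. \<alpha> j / Im \<tau>)" using Soff off_diag_torus_class by blast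
    then have "generic_heights N (\<lambda>j. \<alpha> j / Im \<tau> * Im \<tau>) \<tau>"
      using generic_heights_iff_off_diag[OF \<tau>, of N "\<lambda>j. \<alpha> j / Im \<tau>"] by simp
    then have gen: "generic_heights N \<alpha> \<tau>" using \<tau> by simp
    have "bracket N n S f \<tau> = torus_integral N f \<alpha> \<tau>" unfolding bracket_def \<alpha>_def ..
    also have "\<dots> = torus_integral N g \<alpha> \<tau>"
      using g(2)[OF apart_torus_point[OF gen]] by (simp add: torus_integral_def torus_point_def)
    also have "\<dots> = ?P (\<lambda>j. \<alpha> j / Im \<tau>)" using \<tau> by simp
    also have "\<dots> = ?P x" using y by (rule const)
    also have "\<dots> = h \<tau>"
      using xo by (intro h(2)) (simp_all add: generic_heights_iff_off_diag[OF \<tau>] div)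
    finally show "bracket N n S f \<tau> = h \<tau>" .
  qed
qed

text \<open>At level 1 the only shift is k = 0 and the group is all of SL2(Z), so the level-one
  statement is a special case once G_2, G_4, G_6 are known to be quasi-modular.\<close>

lemma ellring_subset_ellring_Gamma1: "ellring N w \<subseteq> ellring_Gamma1 N 1 w"
proof
  fix f assume "f \<in> ellring N w"
  then have "graded_part N 1 (gens_full N) w f" by (simp add: ellring_def)
  then have "graded_part N 1 (gens_Gamma1 N 1) w f"
  proof (induction rule: graded_part.induct)
    case (gen w f)
    then show ?case
    proof (cases rule: gens_full.cases)
      case (1 k)
      have "eisenstein_G k \<in> QMod (Gamma1 1) (int k)" unfolding Gamma1_1 by (rule eisenstein_G_QMod[OF 1(3)])
      then have "gens_Gamma1 N 1 (int k) (\<lambda>z \<tau>. eisenstein_G k \<tau>)" by (rule gens_Gamma1.intros(1)[where g = "eisenstein_G k"])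
      then show ?thesis unfolding 1(1,2) by (rule graded_part.gen[where gens = "gens_Gamma1 N 1"])
    next
      case (2 i j s)
      have "gens_Gamma1 N 1 (int s + 2) (\<lambda>z \<tau>. wp_deriv s (z i - z j) \<tau>)"
        using gens_Gamma1.intros(2)[OF 2(3-5), of 0 1 s] by simp
      then show ?thesis unfolding 2(1,2) by (rule graded_part.gen[where gens = "gens_Gamma1 N 1"])
    qed
  qed (auto intro: graded_part.intros)
  then show "f \<in> ellring_Gamma1 N 1 w" by (simp add: ellring_Gamma1_def)
qed

theorem theorem5p13:
  fixes N n :: nat and w :: int
  assumes "n \<ge> 1"
  shows "(\<forall>f \<in> ellring N w. \<forall>S \<in> chambers N 1. bracket N 1 S f \<in> QMod_le SL2Z w) \<and>
    (\<forall>f \<in> ellring_Gamma1 N n w. \<forall>S \<in> chambers N n. bracket N n S f \<in> QMod_le (Gamma1 n) w)"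
proof (intro conjI ballI)
  fix f S assume "f \<in> ellring N w" "S \<in> chambers N 1"
  then show "bracket N 1 S f \<in> QMod_le SL2Z w"
    using bracket_Gamma1_quasimodular[OF order.refl subsetD[OF ellring_subset_ellring_Gamma1]] unfolding Gamma1_1 by blast
next
  fix f S assume "f \<in> ellring_Gamma1 N n w" "S \<in> chambers N n"
  then show "bracket N n S f \<in> QMod_le (Gamma1 n) w"
    by (rule bracket_Gamma1_quasimodular[OF assms])
qed

end
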